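(* Let $n\in\mathbb{N}$, $n\ge 1$, and let $0<\beta\le 1$, $0<\alpha\le 2$ with $2\beta+\alpha<4$. Let $G_{\alpha,\beta,n}(\mathrm{x},t)$ be the first fundamental solution of the multi-dimensional space-time-fractional diffusion-wave equation $$D_t^{\beta}u(\mathrm{x},t)=-(-\Delta)^{\frac{\alpha}{2}}u(\mathrm{x},t),\quad \mathrm{x}\in\mathbb{R}^n,\ t>0.$$ Define, for $\tau>0$ (and $\tau\neq 1$ in the case $\frac{\beta}{\alpha}=\frac12$), $$\Phi_{\alpha,\beta}(\tau)=\begin{cases}\tau^{\frac{\alpha}{2}-1}\,W_{(1-\beta,-\beta),(\frac{\alpha}{2},\frac{\alpha}{2})}\left(-\tau^{\frac{\alpha}{2}}\right) & \text{if } \frac{\beta}{\alpha}<\frac12,\\[2mm] \tau^{-1}\,W_{(1,\beta),(0,-\frac{\alpha}{2})}\left(-\tau^{-\frac{\alpha}{2}}\right) & \text{if } \frac{\beta}{\alpha}>\frac12,\end{cases}$$ and, if $\frac{\beta}{\alpha}=\frac12$, $$\Phi_{\alpha,\beta}(\tau)=\begin{cases}\dfrac{\tau^{\frac{\alpha}{2}-1}}{\pi}\displaystyle\sum_{k=0}^\infty \sin\left(\frac{\pi\alpha}{2}(k+1)\right)\left(-\tau^{\frac{\alpha}{2}}\right)^k & \text{if } 0<\tau<1,\\[3mm] -\dfrac{\tau^{-1}}{\pi}\displaystyle\sum_{k=0}^\infty \sin\left(\frac{\pi\alpha}{2}k\right)\left(-\tau^{-\frac{\alpha}{2}}\right)^k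 & \text{if } \tau>1.\end{cases}$$ Then $\Phi_{\alpha,\beta}$ is a probability density function on $(0,\infty)$, i.e. $\Phi_{\alpha,\beta}\ge 0$ and $\int_0^\infty\Phi_{\alpha,\beta}(\tau)\,d\tau=1$, and for all $\mathrm{x}\in\mathbb{R}^n\setminus\{0\}$ and $t>0$ the subordination formula $$G_{\alpha,\beta,n}(\mathrm{x},t)=\int_0^\infty t^{-\frac{2\beta}{\alpha}}\,\Phi_{\alpha,\beta}\left(s\,t^{-\frac{2\beta}{\alpha}}\right)\,G_{2,1,n}(\mathrm{x},s)\,ds$$ holds, where $$G_{2,1,n}(\mathrm{x},t)=\frac{1}{(\sqrt{4\pi t})^{n}}\exp\left(-\frac{|\mathrm{x}|^{2}}{4t}\right)$$ is the fundamental solution of the conventional diffusion equation.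
   Context: Four parameters Wright function: for $\mu,\nu\in\mathbb{R}$ and $a,b,z\in\mathbb{C}$, $$W_{(a,\mu),(b,\nu)}(z)=\sum_{k=0}^\infty\frac{z^k}{\Gamma(a+\mu k)\,\Gamma(b+\nu k)},$$ with the convention that $1/\Gamma$ is the entire reciprocal Gamma function (equal to $0$ at $0,-1,-2,\dots$). The series defines an entire function of $z$ when $\mu+\nu>0$. Equation: for $0<\beta<1$, $D_t^\beta$ is the Caputo derivative $D_t^\beta u=I_t^{1-\beta}\frac{\partial u}{\partial t}$, where $(I_t^\gamma f)(t)=\frac{1}{\Gamma(\gamma)}\int_0^t(t-\tau)^{\gamma-1}f(\tau)\,d\tau$ for $\gamma>0$; for $\beta=1$ it is $\frac{\partial}{\partial t}$. The fractional Laplacian $(-\Delta)^{\frac{\alpha}{2}}$ is the pseudo-differential operator with symbol $|\kappa|^\alpha$, with respect to the Fourier transform $\hat f(\kappa)=\int_{\mathbb{R}^n}e^{i\kappa\cdot\mathrm{x}}f(\mathrm{x})\,d\mathrm{x}$. First fundamental solution: for $0<\beta\le 1$, $G_{\alpha,\beta,n}$ is the solution of the equation $D_t^{\beta}u(\mathrm{x},t)=-(-\Delta)^{\frac{\alpha}{2}}u(\mathrm{x},t)$, $\mathrm{x}\in\mathbb{R}^n$, $t>0$, with initial condition $u(\mathrm{x},0)=\prod_{i=1}^n\delta(x_i)$ ($\delta$ the Dirac delta function). Equivalently, for each $t>0$, $G_{\alpha,\beta,n}(\cdot,t)$ is the function on $\mathbb{R}^n$ whose Fourier transform in $\mathrm{x}$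 (in the sense of tempered distributions) is $$\hat G_{\alpha,\beta,n}(\kappa,t)=E_\beta\left(-|\kappa|^\alpha t^\beta\right),\qquad E_\beta(z)=\sum_{k=0}^\infty\frac{z^k}{\Gamma(1+\beta k)},$$ where pointwise values at $\mathrm{x}\neq 0$ are those of its representative that is continuous on $\mathbb{R}^n\setminus\{0\}$ (at $\mathrm{x}=0$ it may have an integrable singularity). *)

theory Defs
  imports "HOL-Analysis.Analysis"
begin

section \<open>Special functions\<close>

text \<open>
  Polymorphic in the type of the arguments, so that the real instance used below and the
  complex one are given by the same series; \<^const>\<open>rGamma\<close> is the entire reciprocal Gamma
  function.
\<close>

definition wright4 :: "'a::Gamma \<Rightarrow> real \<Rightarrow> 'a \<Rightarrow> real \<Rightarrow> 'a \<Rightarrow> 'a" where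
  "wright4 a \<mu> b \<nu> z =
     (\<Sum>k. z ^ k * rGamma (a + of_real (\<mu> * real k)) * rGamma (b + of_real (\<nu> * real k)))"

definition mittag_leffler :: "real \<Rightarrow> 'a::{real_normed_field,banach} \<Rightarrow> 'a" where
  "mittag_leffler \<beta> z = (\<Sum>k. z ^ k / of_real (Gamma (1 + \<beta> * real k)))"


section \<open>Fourier transform of tempered distributions\<close>

text \<open>
  \<open>pderivs [i\<^sub>1, \<dots>, i\<^sub>m] f\<close> is the iterated partial derivative in the listed coordinate
  directions. If all of them are differentiable everywhere, then \<open>f\<close> is infinitely
  differentiable, and conversely.
\<close>

fun pderivs :: "'n list \<Rightarrow> (real ^ 'n::finite \<Rightarrow> complex) \<Rightarrow> real ^ 'n \<Rightarrow> complex" where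
  "pderivs [] f = f"
| "pderivs (i # is) f = (\<lambda>x. frechet_derivative (pderivs is f) (at x) (axis i 1))"

definition schwartz :: "(real ^ 'n::finite \<Rightarrow> complex) \<Rightarrow> bool" where
  "schwartz f \<longleftrightarrow>
     (\<forall>is. (\<forall>x. pderivs is f differentiable (at x)) \<and>
           (\<forall>m::nat. bounded (range (\<lambda>x. norm x ^ m *\<^sub>R pderivs is f x))))"

definition fourier :: "(real ^ 'n::finite \<Rightarrow> complex) \<Rightarrow> real ^ 'n \<Rightarrow> complex" where
  "fourier f \<kappa> = (LINT x|lborel. exp (\<i> * complex_of_real (\<kappa> \<bullet> x)) * f x)"

text \<open>
  Functions that define a tempered distribution \<open>\<phi> \<mapsto> \<integral> f \<phi>\<close>. Testing with a Gaussian shows that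
  such an \<open>f\<close> is Borel measurable and locally integrable.
\<close>

definition tempered :: "(real ^ 'n::finite \<Rightarrow> complex) \<Rightarrow> bool" where
  "tempered f \<longleftrightarrow> (\<forall>\<phi>. schwartz \<phi> \<longrightarrow> integrable lborel (\<lambda>x. f x * \<phi> x))"

text \<open>
  \<open>g\<close> is the Fourier transform of \<open>f\<close> in the sense of tempered distributions: the transform
  \<open>F\<close> of a distribution \<open>T\<close> is given by \<open>F \<phi> = T (fourier \<phi>)\<close>.
\<close>

definition has_tempered_fourier ::
    "(real ^ 'n::finite \<Rightarrow> complex) \<Rightarrow> (real ^ 'n \<Rightarrow> complex) \<Rightarrow> bool" where
  "has_tempered_fourier f g \<longleftrightarrow>
     tempered f \<and> tempered g \<and>
     (\<forall>\<phi>. schwartz \<phi> \<longrightarrow>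
        (LINT x|lborel. f x * fourier \<phi> x) = (LINT \<kappa>|lborel. g \<kappa> * \<phi> \<kappa>))"


section \<open>Fundamental solutions\<close>

text \<open>
  First fundamental solution \<open>G x t\<close> of \<open>D\<^sub>t\<^sup>\<beta> u = -(-\<Delta>)\<^bsup>\<alpha>/2\<^esup> u\<close> on \<open>\<real>\<^sup>n\<close>, where \<open>n = CARD('n)\<close>:
  its spatial Fourier transform solves the transformed Cauchy problem
  \<open>D\<^sub>t\<^sup>\<beta> v = -|\<kappa>|\<^sup>\<alpha> v\<close>, \<open>v(0) = 1\<close>, i.e. equals \<open>E\<^sub>\<beta>(-|\<kappa>|\<^sup>\<alpha> t\<^sup>\<beta>)\<close>.
  Continuity away from the origin singles out the representative whose values at \<open>x \<noteq> 0\<close> are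
  meant; the value at \<open>x = 0\<close> and the values for \<open>t \<le> 0\<close> are unconstrained.
\<close>

definition first_fundamental_solution ::
    "real \<Rightarrow> real \<Rightarrow> (real ^ 'n::finite \<Rightarrow> real \<Rightarrow> real) \<Rightarrow> bool" where
  "first_fundamental_solution \<alpha> \<beta> G \<longleftrightarrow>
     (\<forall>t>0. continuous_on (- {0}) (\<lambda>x. G x t) \<and>
            has_tempered_fourier
              (\<lambda>x. complex_of_real (G x t))
              (\<lambda>\<kappa>. mittag_leffler \<beta> (- complex_of_real (norm \<kappa> powr \<alpha> * t powr \<beta>))))"

definition heat_kernel :: "real ^ 'n::finite \<Rightarrow> real \<Rightarrow> real" where
  "heat_kernel x t = 1 / sqrt (4 * pi * t) ^ CARD('n) * exp (- (norm x)\<^sup>2 / (4 * t))"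


section \<open>The subordination density\<close>

text \<open>
  Only \<open>\<tau> > 0\<close> matters. For \<open>\<beta>/\<alpha> = 1/2\<close> the density is not defined at \<open>\<tau> = 1\<close>; the value \<open>0\<close>
  there is a convention.
\<close>

definition Phi :: "real \<Rightarrow> real \<Rightarrow> real \<Rightarrow> real" where
  "Phi \<alpha> \<beta> \<tau> =
     (if \<beta> / \<alpha> < 1 / 2 then
        \<tau> powr (\<alpha> / 2 - 1) * wright4 (1 - \<beta>) (- \<beta>) (\<alpha> / 2) (\<alpha> / 2) (- (\<tau> powr (\<alpha> / 2)))
      else if \<beta> / \<alpha> > 1 / 2 then
        1 / \<tau> * wright4 1 \<beta> 0 (- (\<alpha> / 2)) (- (\<tau> powr (- (\<alpha> / 2))))
      else if \<tau> < 1 then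
        \<tau> powr (\<alpha> / 2 - 1) / pi *
          (\<Sum>k. sin (pi * \<alpha> / 2 * (real k + 1)) * (- (\<tau> powr (\<alpha> / 2))) ^ k)
      else if \<tau> > 1 then
        - (1 / \<tau> / pi) *
          (\<Sum>k. sin (pi * \<alpha> / 2 * real k) * (- (\<tau> powr (- (\<alpha> / 2)))) ^ k)
      else 0)"

end

theory Submission
  imports Defs "HOL-Complex_Analysis.Complex_Analysis" "HOL-Probability.Probability"
begin

text \<open>
  Put \<open>\<gamma> = \<alpha> / 2\<close>. The function \<open>Phi \<alpha> \<beta>\<close> is the density of a \<open>\<gamma>\<close>-stable subordinator evaluated at an
  independent random time whose density is the Mainardi function \<open>M\<^sub>\<beta>\<close>:
  \<open>Phi \<alpha> \<beta> x = \<integral> g\<^sub>\<gamma>(t, x) M\<^sub>\<beta>(t) dt\<close>, where the stable density \<open>g\<^sub>\<gamma>(t, \<cdot>)\<close> has the Laplace transform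
  \<open>exp (- t q\<^sup>\<gamma>)\<close> and \<open>M\<^sub>\<beta>\<close> has the Laplace transform \<open>E\<^sub>\<beta>(- x)\<close>. From this formula \<open>Phi\<close> is nonnegative
  and has the Laplace transform \<open>E\<^sub>\<beta>(- q\<^sup>\<gamma>)\<close>, in particular mass \<open>1\<close>. With \<open>q = |k|\<^sup>2\<close> and the scaling in \<open>t\<close>
  this says that the mixture of the Gaussian transforms \<open>exp (- s |k|\<^sup>2)\<close> over the rescaled density is the
  Fourier transform \<open>E\<^sub>\<beta>(- |k|\<^sup>\<alpha> t\<^sup>\<beta>)\<close> of the fundamental solution, which is the subordination formula in
  Fourier space.

  The two densities are the same function up to a change of variables,
  \<open>g\<^sub>\<beta>(t, x) = \<beta> t x\<^bsup>-\<beta>-1\<^esup> M\<^sub>\<beta>(t x\<^bsup>-\<beta>\<^esup>)\<close>, and all that is needed about them follows from the Laplace transform of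
  \<open>g\<^sub>\<beta>\<close> (\<open>stable_density_Laplace\<close>). It is obtained by writing the series of \<open>g\<^sub>\<beta>\<close> as an integral over two
  rays and applying Cauchy's formula. Nonnegativity follows because \<open>exp (- q\<^sup>\<beta>)\<close> is completely monotone
  (\<open>nonneg_if_Laplace_alternating\<close>). The moments of \<open>M\<^sub>\<beta>\<close> follow by integrating \<open>t\<^sup>k exp (- x) g\<^sub>\<beta>(t, x)\<close> in both
  orders, and its Laplace transform follows from the moments (\<open>mainardi_Laplace\<close>).

  The three series that define \<open>Phi\<close> come from the mixture by expanding one factor in powers of \<open>t\<close> and
  integrating against the moments of the other one (\<open>Phi_eq_mixture\<close>). Expanding \<open>g\<^sub>\<gamma>\<close> works for \<open>\<gamma> < \<beta>\<close>,
  expanding \<open>M\<^sub>\<beta>\<close> for \<open>\<beta> < \<gamma>\<close>; for \<open>\<gamma> = \<beta>\<close> the series are dominated by geometric ones, and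
  each of them covers one side of \<open>1\<close>.
  If \<open>\<alpha> = 2\<close> or \<open>\<beta> = 1\<close>, one of the two factors degenerates to a point mass and \<open>Phi\<close> is the other one; the
  hypothesis \<open>2 \<beta> + \<alpha> < 4\<close> excludes that both do.

  To pass from Fourier space to pointwise values (\<open>eq_heat_mixture_of_Fourier\<close>), the distributional identity
  for \<open>G\<close> is tested with modulated Gaussians whose Fourier transforms are heat kernels centred at \<open>y \<noteq> 0\<close>. This
  yields \<open>\<integral> G(x, t) h(x - y, e) dx = \<integral> h(y, s + e) d\<mu> s\<close> for the heat kernel \<open>h\<close> and the rescaled density
  \<open>\<mu>\<close>, and the limit \<open>e \<longrightarrow> 0\<close> gives the formula, by continuity of \<open>G\<close> at \<open>y\<close> on the left and by dominated
  convergence on the right.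
\<close>


section \<open>Contour shifts in a horizontal strip\<close>

lemma has_contour_integral_horizontal:
  fixes f :: "complex \<Rightarrow> complex"
  assumes R: "R > 0" and int: "integrable lborel (\<lambda>u. f (Complex u y))"
  shows "(f has_contour_integral (LINT u:{-R..R}|lborel. f (Complex u y)))
           (linepath (Complex (-R) y) (Complex R y))"
proof -
  have "set_integrable lborel {-R..R} (\<lambda>u. f (Complex u y))"
    unfolding set_integrable_def by (rule integrable_mult_indicator) (use int in auto)
  from set_borel_integral_eq_integral[OF this]
  have "((\<lambda>u. f (Complex u y)) has_integral (LINT u:{-R..R}|lborel. f (Complex u y))) (cbox (-R) R)"
    by (simp add: has_integral_iff)
  from has_integral_affinity[OF this, of "2*R" "-R"] R
  have "((\<lambda>s. f (Complex (2 * R * s - R) y)) has_integral (1/(2*R)) *\<^sub>R (LINT u:{-R..R}|lborel. f (Complex u y)))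
      ((\<lambda>x. x / (2*R) + 1/2) ` {-R..R})" by (simp add: field_simps)
  also have "(\<lambda>x. x / (2*R) + 1/2) ` {-R..R} = {0..1}"
  proof -
    have "(\<lambda>x. x / (2*R) + 1/2) ` {-R..R} = (\<lambda>x. (1/(2*R)) * x + 1/2) ` {-R..R}" by simp
    also have "\<dots> = {0..1}" using R by (subst image_affinity_atLeastAtMost) (auto simp: field_simps)
    finally show ?thesis .
  qed
  finally have "((\<lambda>s. f (Complex (2 * R * s - R) y) * (2*R)) has_integral
      ((1/(2*R)) *\<^sub>R (LINT u:{-R..R}|lborel. f (Complex u y))) * (2*R)) {0..1}"
    by (rule has_integral_mult_left)
  moreover have "linepath (Complex (-R) y) (Complex R y) s = Complex (2 * R * s - R) y" for s
    by (simp add: linepath_def complex_eq_iff algebra_simps)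
  moreover have "Complex R y - Complex (-R) y = complex_of_real (2*R)"
    by (simp add: complex_eq_iff)
  ultimately show ?thesis using R
    unfolding has_contour_integral_linepath by (simp add: scaleR_conv_of_real field_simps)
qed

lemma tendsto_integral_symmetric_interval:
  fixes f :: "real \<Rightarrow> complex"
  assumes int: "integrable lborel f"
  shows "((\<lambda>R. LINT u:{-R..R}|lborel. f u) \<longlongrightarrow> (LINT u|lborel. f u)) at_top"
  unfolding set_lebesgue_integral_def
proof (rule integral_dominated_convergence_at_top[where w="\<lambda>u. norm (f u)"])
  show "AE x in lborel. ((\<lambda>R. indicat_real {- R..R} x *\<^sub>R f x) \<longlongrightarrow> f x) at_top"
  proof (intro always_eventually allI)
    fix x :: real
    have "\<forall>\<^sub>F R in at_top. indicat_real {- R..R} x *\<^sub>R f x = f x"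
      using eventually_ge_at_top[of "\<bar>x\<bar>"] by eventually_elim (auto simp: indicator_def)
    then show "((\<lambda>R. indicat_real {- R..R} x *\<^sub>R f x) \<longlongrightarrow> f x) at_top"
      by (rule tendsto_eventually)
  qed
qed (use int in \<open>auto simp: indicator_def\<close>)

text \<open>
  The residue theorem on the rectangles with vertical sides at \<open>\<plusminus>R\<close>, in the limit \<open>R \<longrightarrow> \<infinity>\<close>.
  In the variable \<open>w = log z\<close> a ray from the origin becomes a horizontal line, so this lemma rotates
  contours that consist of rays: without poles it compares two rays, with one pole it is Cauchy's
  integral formula for the sector between two rays.
\<close>

lemma strip_integral_difference:
  fixes f :: "complex \<Rightarrow> complex" and a b :: real
  assumes ab: "a < b" and S: "open S" "convex S" "{z. a \<le> Im z \<and> Im z \<le> b} \<subseteq> S"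
    and pts: "finite pts" "pts \<subseteq> {z. a < Im z \<and> Im z < b}"
    and holo: "f holomorphic_on S - pts"
    and int: "integrable lborel (\<lambda>u. f (Complex u a))" "integrable lborel (\<lambda>u. f (Complex u b))"
    and B: "(B \<longlongrightarrow> 0) at_top"
    and decay: "eventually (\<lambda>R. \<forall>y\<in>{a..b}. norm (f (Complex R y)) \<le> B R \<and> norm (f (Complex (-R) y)) \<le> B R) at_top"
  shows "(LINT u|lborel. f (Complex u a)) - (LINT u|lborel. f (Complex u b)) =
           2 * of_real pi * \<i> * (\<Sum>p\<in>pts. residue f p)"
proof -
  define H where "H y R = (LINT u:{-R..R}|lborel. f (Complex u y))" for y R
  define V where "V R = contour_integral (linepath (Complex R a) (Complex R b)) f" for R
  from pts(1) have "bounded (Re ` pts)" by (intro finite_imp_bounded) auto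
  then obtain R0 where R0: "\<And>p. p \<in> pts \<Longrightarrow> \<bar>Re p\<bar> \<le> R0" by (auto simp: bounded_iff)
  have ev: "\<forall>\<^sub>F R in at_top. R > 0 \<and> R > R0"
    using eventually_gt_at_top[of 0] eventually_gt_at_top[of R0] by eventually_elim auto
  have segV: "closed_segment (Complex R a) (Complex R b) = {z. Re z = R \<and> a \<le> Im z \<and> Im z \<le> b}" for R
    using ab by (subst closed_segment_same_Re) (auto simp: closed_segment_eq_real_ivl)
  have int_V: "f contour_integrable_on linepath (Complex R a) (Complex R b)"
    if "R > R0 \<or> -R > R0" for R
  proof (rule contour_integrable_continuous_linepath)
    have "closed_segment (Complex R a) (Complex R b) \<subseteq> S - pts"
      using segV[of R] S(3) R0 that by force
    then show "continuous_on (closed_segment (Complex R a) (Complex R b)) f"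
      using holomorphic_on_imp_continuous_on[OF holo] continuous_on_subset by blast
  qed
  have rect: "\<forall>\<^sub>F R in at_top. H a R + V R - H b R - V (-R) =
      of_real (2 * pi) * \<i> * (\<Sum>p\<in>pts. residue f p)"
    using ev
  proof eventually_elim
    case (elim R)
    let ?\<gamma> = "rectpath (Complex (-R) a) (Complex R b)"
    have img: "path_image ?\<gamma> = {z. Re z \<in> {-R, R} \<and> Im z \<in> {a..b} \<or> Im z \<in> {a, b} \<and> Re z \<in> {-R..R}}"
      using elim ab by (subst path_image_rectpath) auto
    have sub: "path_image ?\<gamma> \<subseteq> S - pts"
      unfolding img using S(3) pts(2) R0 elim ab by fastforce
    have pin: "p \<in> box (Complex (-R) a) (Complex R b)" if "p \<in> pts" for p
      using R0[OF that] that pts(2) elim by (auto simp: in_box_complex_iff)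
    have "contour_integral ?\<gamma> f = of_real (2 * pi) * \<i> * (\<Sum>p\<in>pts. winding_number ?\<gamma> p * residue f p)"
    proof (rule Residue_theorem[OF S(1) _ pts(1) holo _ _ sub])
      have "path_image ?\<gamma> \<subseteq> S" using sub by blast
      then show "\<forall>z. z \<notin> S \<longrightarrow> winding_number ?\<gamma> z = 0"
        by (intro allI impI winding_number_zero_outside[OF path_rectpath S(2)]) simp_all
    qed (use S in \<open>auto simp: convex_connected\<close>)
    also have "(\<Sum>p\<in>pts. winding_number ?\<gamma> p * residue f p) = (\<Sum>p\<in>pts. residue f p)"
      using pin by (intro sum.cong) (auto simp: winding_number_rectpath)
    finally have 1: "contour_integral ?\<gamma> f = of_real (2 * pi) * \<i> * (\<Sum>p\<in>pts. residue f p)" .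
    have h1: "(f has_contour_integral H a R) (linepath (Complex (-R) a) (Complex R a))"
      and h3: "(f has_contour_integral H b R) (linepath (Complex (-R) b) (Complex R b))"
      unfolding H_def using has_contour_integral_horizontal elim int by auto
    have v2: "(f has_contour_integral V R) (linepath (Complex R a) (Complex R b))"
      and v4: "(f has_contour_integral V (-R)) (linepath (Complex (-R) a) (Complex (-R) b))"
      unfolding V_def using int_V elim by (auto intro!: has_contour_integral_integral)
    have "(f has_contour_integral (H a R + (V R + (- H b R + (- V (-R)))))) ?\<gamma>"
      unfolding rectpath_def Let_def
      using has_contour_integral_reversepath[OF _ h3] has_contour_integral_reversepath[OF _ v4] h1 v2
      by (intro has_contour_integral_join) (simp_all add: valid_path_join)
    from contour_integral_unique[OF this] 1 show ?case by simp
  qed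
  have VB: "\<forall>\<^sub>F R in at_top. norm (V R) \<le> B R * (b - a) \<and> norm (V (-R)) \<le> B R * (b - a)"
    using ev decay
  proof eventually_elim
    case (elim R)
    have "norm (f (Complex R a)) \<le> B R" using elim(2) ab by simp
    then have "0 \<le> B R" using norm_ge_zero order_trans by blast
    have *: "cmod (Complex R' b - Complex R' a) = b - a" for R' using ab by (simp add: cmod_def)
    have "norm (V R') \<le> B R * (b - a)" if "R' = R \<or> R' = -R" for R'
      unfolding V_def *[of R', symmetric]
    proof (rule contour_integral_bound_linepath)
      show "f contour_integrable_on linepath (Complex R' a) (Complex R' b)"
        using int_V elim that by auto
      fix z assume "z \<in> closed_segment (Complex R' a) (Complex R' b)"
      then have "z = Complex R' (Im z)" "Im z \<in> {a..b}" by (auto simp: segV complex_eq_iff)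
      moreover have "norm (f (Complex R' (Im z))) \<le> B R" using elim(2) that \<open>Im z \<in> {a..b}\<close> by blast
      ultimately show "norm (f z) \<le> B R" by simp
    qed fact
    then show ?case by blast
  qed
  have B': "((\<lambda>R. B R * (b - a)) \<longlongrightarrow> 0) at_top" using tendsto_mult_left_zero[OF B] by simp
  have "(V \<longlongrightarrow> 0) at_top"
    by (rule tendsto_norm_zero_cancel, rule tendsto_sandwich[OF _ _ tendsto_const B'])
       (use VB in \<open>auto elim: eventually_mono\<close>)
  moreover have "((\<lambda>R. V (-R)) \<longlongrightarrow> 0) at_top"
    by (rule tendsto_norm_zero_cancel, rule tendsto_sandwich[OF _ _ tendsto_const B'])
       (use VB in \<open>auto elim: eventually_mono\<close>)
  moreover have "(H y \<longlongrightarrow> (LINT u|lborel. f (Complex u y))) at_top" if "y = a \<or> y = b" for y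
    unfolding H_def[abs_def] using tendsto_integral_symmetric_interval int that by blast
  ultimately have "((\<lambda>R. H a R + V R - H b R - V (-R)) \<longlongrightarrow>
     (LINT u|lborel. f (Complex u a)) + 0 - (LINT u|lborel. f (Complex u b)) - 0) at_top"
    by (intro tendsto_intros) auto
  moreover have "((\<lambda>R. H a R + V R - H b R - V (-R)) \<longlongrightarrow> of_real (2 * pi) * \<i> * (\<Sum>p\<in>pts. residue f p)) at_top"
    using rect by (rule tendsto_eventually)
  ultimately have "(LINT u|lborel. f (Complex u a)) + 0 - (LINT u|lborel. f (Complex u b)) - 0 =
      of_real (2 * pi) * \<i> * (\<Sum>p\<in>pts. residue f p)"
    by (intro tendsto_unique[OF trivial_limit_at_top_linorder])
  then show ?thesis by simp
qed

lemma set_integral_substitution: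
  fixes f g g' :: "real \<Rightarrow> real"
  assumes S: "S \<in> sets borel" "g ` S \<in> sets borel" and fm[measurable]: "f \<in> borel_measurable borel"
    and gm[measurable]: "g \<in> borel_measurable borel" and g'm[measurable]: "g' \<in> borel_measurable borel"
    and der: "\<And>x. x \<in> S \<Longrightarrow> (g has_field_derivative g' x) (at x)"
    and inj: "inj_on g S"
  shows "set_integrable lborel (g ` S) f \<longleftrightarrow> set_integrable lborel S (\<lambda>x. \<bar>g' x\<bar> * f (g x))"
    and "set_integrable lborel (g ` S) f \<Longrightarrow> (LINT x:S|lborel. \<bar>g' x\<bar> * f (g x)) = (LINT x:g ` S|lborel. f x)"
proof -
  have der': "(g has_field_derivative g' x) (at x within S)" if "x \<in> S" for x
    using der[OF that] has_field_derivative_at_within by blast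
  have 1: "set_integrable lborel T h \<longleftrightarrow> set_integrable lebesgue T h" if "h \<in> borel_measurable borel" "T \<in> sets borel" for T and h :: "real \<Rightarrow> real"
    using that unfolding set_integrable_def by (subst integrable_completion) auto
  have 2: "(LINT x:T|lborel. h x) = (LINT x:T|lebesgue. h x)" if "h \<in> borel_measurable borel" "T \<in> sets borel" for T and h :: "real \<Rightarrow> real"
    using that unfolding set_lebesgue_integral_def by (subst integral_completion) auto
  have m: "(\<lambda>x. \<bar>g' x\<bar> * f (g x)) \<in> borel_measurable borel" by measurable
  have ch: "(\<lambda>x. \<bar>g' x\<bar> * f(g x)) absolutely_integrable_on S \<and> integral S (\<lambda>x. \<bar>g' x\<bar> * f (g x)) = b
     \<longleftrightarrow> f absolutely_integrable_on (g ` S) \<and> integral (g ` S) f = b" for b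
    by (rule has_absolute_integral_change_of_variables_1') (use S der' inj in auto)
  show "set_integrable lborel (g ` S) f \<longleftrightarrow> set_integrable lborel S (\<lambda>x. \<bar>g' x\<bar> * f (g x))"
    using ch 1[OF fm S(2)] 1[OF m S(1)] by blast
  assume "set_integrable lborel (g ` S) f"
  then have "f absolutely_integrable_on (g ` S)" using 1[OF fm S(2)] by simp
  with ch show "(LINT x:S|lborel. \<bar>g' x\<bar> * f (g x)) = (LINT x:g ` S|lborel. f x)"
    unfolding 2[OF fm S(2)] 2[OF m S(1)]
    by (metis set_lebesgue_integral_eq_integral(2))
qed


section \<open>Growth of the Gamma function and Gamma integrals\<close>

lemma rGamma_reflection_real: "rGamma z * rGamma (1 - z :: real) = sin (pi * z) / pi"
proof -
  have "complex_of_real (rGamma z * rGamma (1 - z)) = of_real (sin (pi * z) / pi)"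
    using rGamma_reflection_complex[of "of_real z"]
    by (simp add: rGamma_complex_of_real[symmetric] sin_of_real[symmetric] del: rGamma_complex_of_real)
  then show ?thesis by (simp only: of_real_eq_iff)
qed

lemma rGamma_one_minus: "z > 0 \<Longrightarrow> rGamma (1 - z :: real) = Gamma z * sin (pi * z) / pi"
  using rGamma_reflection_real[of z] Gamma_real_pos[of z]
  by (simp add: Gamma_def field_simps)

lemma abs_rGamma_one_minus_le:
  assumes "z > (0::real)" shows "\<bar>rGamma (1 - z)\<bar> \<le> Gamma z"
proof -
  have "\<bar>sin (pi * z)\<bar> \<le> pi" using pi_ge_two abs_sin_le_one[of "pi * z"] by linarith
  then have "\<bar>sin (pi * z) / pi\<bar> \<le> 1" by simp
  then have "Gamma z * \<bar>sin (pi * z) / pi\<bar> \<le> Gamma z * 1"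
    using Gamma_real_pos[OF assms] by (intro mult_left_mono) auto
  then show ?thesis using Gamma_real_pos[OF assms] by (simp add: rGamma_one_minus[OF assms] abs_mult)
qed

text \<open>
  Logarithmic convexity: \<open>1 + a\<close> and \<open>1 + b\<close> are complementary convex combinations of \<open>1\<close> and
  \<open>1 + a + b\<close>, and \<open>ln (Gamma 1) = 0\<close>.
\<close>

lemma Gamma_mult_le:
  assumes "0 \<le> a" "0 \<le> b" shows "Gamma (1 + a) * Gamma (1 + b) \<le> Gamma (1 + a + b :: real)"
proof (cases "a + b = 0")
  case True then show ?thesis using assms by (simp add: add_nonneg_eq_0_iff)
next
  case False
  then have ab: "a + b > 0" using assms by linarith
  define u where "u = b / (a + b)"
  have u: "0 \<le> u" "u \<le> 1" using assms ab by (auto simp: u_def)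
  have e: "u * (a + b) = b" "(1 - u) * (a + b) = a" using ab by (auto simp: u_def field_simps)
  have cv: "(ln \<circ> Gamma) ((1 - v) *\<^sub>R 1 + v *\<^sub>R (1 + a + b)) \<le>
      (1 - v) * (ln \<circ> Gamma) 1 + v * (ln \<circ> Gamma) (1 + a + b)" if "0 \<le> v" "v \<le> 1" for v
    using assms by (intro convex_onD[OF log_convex_Gamma_real that]) auto
  have "ln (Gamma (1 + a)) \<le> (1 - u) * ln (Gamma (1 + a + b))"
    using cv[of "1 - u"] u e by (simp add: algebra_simps)
  moreover have "ln (Gamma (1 + b)) \<le> u * ln (Gamma (1 + a + b))"
    using cv[of u] u e by (simp add: algebra_simps)
  ultimately have "ln (Gamma (1 + a)) + ln (Gamma (1 + b)) \<le> ln (Gamma (1 + a + b))"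
    by (simp add: algebra_simps)
  then have "ln (Gamma (1 + a) * Gamma (1 + b)) \<le> ln (Gamma (1 + a + b))"
    using assms Gamma_real_pos[of "1 + a"] Gamma_real_pos[of "1 + b"] by (simp add: ln_mult_pos)
  moreover have "Gamma (1 + a) * Gamma (1 + b) > 0" "Gamma (1 + a + b) > 0"
    using assms by (auto intro!: mult_pos_pos Gamma_real_pos)
  ultimately show ?thesis by (simp only: ln_le_cancel_iff)
qed

lemma Gamma_quotient_le:
  assumes "0 \<le> a" "a \<le> b" shows "Gamma (1 + a) / Gamma (1 + b) \<le> 1 / Gamma (1 + (b - a) :: real)"
  using Gamma_mult_le[of a "b - a"] assms Gamma_real_pos[of "1 + b"] Gamma_real_pos[of "1 + (b - a)"]
  by (simp add: field_simps)

text \<open>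
  Restrict the Gamma integral to \<open>[R, \<infinity>)\<close>, where \<open>t\<^sup>y \<ge> R\<^sup>y\<close>. As \<open>R\<close> is arbitrary, the Gamma function
  grows faster than every exponential.
\<close>

lemma Gamma_ge_exp_times_power:
  assumes "0 \<le> y" "0 < R" shows "exp (- R) * R powr y \<le> Gamma (1 + y :: real)"
proof -
  have 1: "((\<lambda>t. t powr y / exp t) has_integral Gamma (1 + y)) {0..}"
    using Gamma_integral_real[of "1 + y"] assms by simp
  have "((\<lambda>t. R powr y * exp (- t)) has_integral R powr y * exp (- R)) {R..}"
    using has_integral_mult_right[OF has_integral_exp_minus_to_infinity[of 1 R], of "R powr y"] by simp
  then have 2: "((\<lambda>t. if t \<in> {R..} then R powr y * exp (- t) else 0) has_integral R powr y * exp (- R)) {0..}"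
    using assms by (subst has_integral_restrict) auto
  have "R powr y * exp (- t) \<le> t powr y / exp t" if "R \<le> t" for t
  proof -
    have "R powr y * exp (- t) \<le> t powr y * exp (- t)" using that assms by (intro mult_right_mono powr_mono2) auto
    then show ?thesis by (simp add: exp_minus field_simps)
  qed
  then have "R powr y * exp (- R) \<le> Gamma (1 + y)"
    by (intro has_integral_le[OF 2 1]) auto
  then show ?thesis by (simp add: mult.commute)
qed

lemma summable_power_over_Gamma:
  assumes "0 < \<delta>" shows "summable (\<lambda>k. x ^ k / Gamma (1 + \<delta> * real k))"
proof -
  define q where "q = 2 * \<bar>x\<bar> + 1"
  \<comment> \<open>chosen such that \<open>R\<^bsup>\<delta>k\<^esup> = q\<^sup>k\<close> with \<open>q > |x|\<close>, which leaves a geometric series\<close>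
  define R where "R = q powr (1 / \<delta>)"
  have q: "q > 0" "\<bar>x\<bar> / q < 1" by (auto simp: q_def field_simps)
  have R: "R > 0" using q by (simp add: R_def)
  have Rk: "R powr (\<delta> * real k) = q ^ k" for k
    using assms q by (simp add: R_def powr_powr powr_realpow)
  show ?thesis
  proof (rule summable_comparison_test')
    show "summable (\<lambda>k. exp R * (\<bar>x\<bar> / q) ^ k)"
      using q by (intro summable_mult summable_geometric) auto
    fix k :: nat
    have *: "exp (- R) * q ^ k \<le> Gamma (1 + \<delta> * real k)" "Gamma (1 + \<delta> * real k) > 0"
      using Gamma_ge_exp_times_power[of "\<delta> * real k" R] R assms Rk by (auto intro!: Gamma_real_pos add_pos_nonneg)
    have "\<bar>x\<bar> ^ k / Gamma (1 + \<delta> * real k) \<le> \<bar>x\<bar> ^ k / (exp (- R) * q ^ k)"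
      using * q by (intro divide_left_mono) auto
    also have "\<dots> = exp R * (\<bar>x\<bar> / q) ^ k" by (simp add: exp_minus field_simps power_divide)
    finally show "norm (x ^ k / Gamma (1 + \<delta> * real k)) \<le> exp R * (\<bar>x\<bar> / q) ^ k"
      using * by (simp add: power_abs)
  qed
qed

text \<open>
  The majorant of the Mainardi series and of the expansions derived from it. The quotient of Gamma values is at most
  \<open>1 / Gamma (1 + (b - a) k)\<close>, which turns the series into one of Mittag-Leffler type.
\<close>

lemma summable_Gamma_quotient:
  assumes "0 \<le> a" "a < b" shows "summable (\<lambda>k. x ^ k * Gamma (1 + a * real k) / Gamma (1 + b * real k))"
proof (rule summable_comparison_test')
  show "summable (\<lambda>k. \<bar>x\<bar> ^ k / Gamma (1 + (b - a) * real k))"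
    using assms by (intro summable_power_over_Gamma) auto
  fix k :: nat
  have p: "Gamma (1 + a * real k) > 0" "Gamma (1 + b * real k) > 0"
    using assms by (auto intro!: Gamma_real_pos add_pos_nonneg)
  have "Gamma (1 + a * real k) / Gamma (1 + b * real k) \<le> 1 / Gamma (1 + (b * real k - a * real k))"
    using assms by (intro Gamma_quotient_le) (auto intro: mult_right_mono)
  then have "\<bar>x\<bar> ^ k * (Gamma (1 + a * real k) / Gamma (1 + b * real k)) \<le> \<bar>x\<bar> ^ k * (1 / Gamma (1 + (b - a) * real k))"
    by (intro mult_left_mono) (auto simp: algebra_simps)
  then show "norm (x ^ k * Gamma (1 + a * real k) / Gamma (1 + b * real k)) \<le> \<bar>x\<bar> ^ k / Gamma (1 + (b - a) * real k)"
    using p by (simp add: power_abs abs_mult)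
qed

lemma Gamma_set_integral:
  fixes s :: real assumes "s > 0"
  shows "set_integrable lborel {0<..} (\<lambda>t. t powr (s - 1) / exp t)"
    "(LINT t:{0<..}|lborel. t powr (s - 1) / exp t) = Gamma s"
proof -
  have "has_bochner_integral lborel (\<lambda>t. indicat_real {0..} t * t powr (s - 1) / exp t) (Gamma s)"
    by (rule has_bochner_integral_nn_integral)
      (use assms Gamma_real_pos[OF assms] in \<open>auto simp: Gamma_conv_nn_integral_real[symmetric]\<close>)
  also have "(\<lambda>t. indicat_real {0..} t * t powr (s - 1) / exp t) = (\<lambda>t. indicat_real {0<..} t *\<^sub>R (t powr (s - 1) / exp t))"
    by (auto simp: indicator_def fun_eq_iff)
  finally show "set_integrable lborel {0<..} (\<lambda>t. t powr (s - 1) / exp t)"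
    "(LINT t:{0<..}|lborel. t powr (s - 1) / exp t) = Gamma s"
    by (auto simp: has_bochner_integral_iff set_integrable_def set_lebesgue_integral_def)
qed

text \<open>
  Euler's integral in the logarithmic variable, so that it can be shifted in the imaginary direction.
\<close>

lemma Gamma_line_integral:
  fixes x s :: real assumes "x > 0" "s > 0"
  shows "integrable lborel (\<lambda>u. exp (- x * exp u + s * u))"
    "(LINT u|lborel. exp (- x * exp u + s * u)) = Gamma s / x powr s"
proof -
  have img: "range (\<lambda>u. x * exp u) = {0<..}"
  proof (intro set_eqI iffI)
    fix y :: real assume "y \<in> {0<..}"
    then have "y = x * exp (ln (y / x))" using assms by simp
    then show "y \<in> range (\<lambda>u. x * exp u)" by blast
  qed (use assms in auto)
  have inj: "inj (\<lambda>u. x * exp u)" using assms by (auto simp: inj_def)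
  have eq: "\<bar>x * exp u\<bar> * ((x * exp u) powr (s - 1) / exp (x * exp u)) = x powr s * exp (- x * exp u + s * u)" for u
  proof -
    have "(x * exp u) * (x * exp u) powr (s - 1) = (x * exp u) powr s"
      using assms powr_add[of "x * exp u" 1 "s - 1"] by simp
    also have "\<dots> = x powr s * exp (s * u)"
      using assms by (simp add: powr_mult) (simp add: powr_def)
    finally have "(x * exp u) * (x * exp u) powr (s - 1) = x powr s * exp (s * u)" .
    moreover have "exp (- x * exp u + s * u) = exp (s * u) / exp (x * exp u)"
      by (simp add: exp_diff[symmetric])
    moreover have "\<bar>x * exp u\<bar> = x * exp u" using assms by simp
    ultimately show ?thesis by (metis times_divide_eq_right)
  qed
  note sub = set_integral_substitution[where S=UNIV and g="\<lambda>u. x * exp u" and g'="\<lambda>u. x * exp u"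
      and f="\<lambda>t. t powr (s - 1) / exp t", unfolded img eq]
  have "set_integrable lborel UNIV (\<lambda>u. x powr s * exp (- x * exp u + s * u))"
    using Gamma_set_integral[OF assms(2)] by (subst sub(1)[symmetric]) (auto intro!: derivative_eq_intros simp: inj)
  then show "integrable lborel (\<lambda>u. exp (- x * exp u + s * u))"
    using assms by (simp add: set_integrable_def)
  have "(LINT u:UNIV|lborel. x powr s * exp (- x * exp u + s * u)) = Gamma s"
    using Gamma_set_integral[OF assms(2)] by (subst sub(2)) (auto intro!: derivative_eq_intros simp: inj)
  then show "(LINT u|lborel. exp (- x * exp u + s * u)) = Gamma s / x powr s"
    using assms by (simp add: set_lebesgue_integral_def field_simps)
qed

lemma integrable_exp_exp:
  fixes p c s :: real assumes "p > 0" "c > 0" "s > 0"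
  shows "integrable lborel (\<lambda>u. exp (- c * exp (p * u) + s * u))"
  using lborel_integrable_real_affine[OF Gamma_line_integral(1)[of c "s / p"], of p 0] assms by simp


section \<open>The Mainardi function and the one-sided stable density\<close>

text \<open>
  The Mainardi (or M-Wright) function \<open>M\<^sub>\<beta>\<close>: for \<open>0 < \<beta> < 1\<close> it is an entire function, and on the half line
  the density of the first passage time over level \<open>1\<close> of the \<open>\<beta>\<close>-stable subordinator.
\<close>

definition mainardi :: "real \<Rightarrow> real \<Rightarrow> real" where
  "mainardi \<beta> t = (\<Sum>k. (- t) ^ k / fact k * rGamma (1 - \<beta> - \<beta> * real k))"

text \<open>
  The density at \<open>x > 0\<close> of the \<open>\<beta>\<close>-stable subordinator at time \<open>t\<close>, normalised to the Laplace transform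
  \<open>exp (- t q\<^sup>\<beta>)\<close>. Written through the Mainardi function, its scaling in \<open>t\<close> and \<open>x\<close> is visible, and
  facts about one of the two functions are facts about the other.
\<close>

definition stable_density :: "real \<Rightarrow> real \<Rightarrow> real \<Rightarrow> real" where
  "stable_density \<beta> t x = \<beta> * t * x powr (- \<beta> - 1) * mainardi \<beta> (t * x powr (- \<beta>))"

text \<open>
  Reflection bounds \<open>1 / Gamma (1 - z)\<close> by \<open>Gamma z\<close> for \<open>z = \<beta> (k + 1)\<close>.
\<close>

lemma mainardi_coefficient_bound:
  assumes "0 < \<beta>"
  shows "\<bar>rGamma (1 - \<beta> - \<beta> * real k)\<bar> \<le> Gamma (1 + \<beta> * real (Suc k)) / (\<beta> * real (Suc k))"
proof -
  define c where "c = \<beta> * real (Suc k)"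
  have c: "c > 0" using assms by (simp add: c_def)
  then have "c \<notin> \<int>\<^sub>\<le>\<^sub>0" using nonpos_Ints_nonpos by fastforce
  then have "Gamma (1 + c) / c = Gamma c" using Gamma_plus1[of c] c by (simp add: add.commute)
  moreover have "1 - \<beta> - \<beta> * real k = 1 - c" by (simp add: c_def algebra_simps)
  ultimately show ?thesis using abs_rGamma_one_minus_le[OF c] by (simp only: c_def)
qed

lemma mainardi_summable:
  assumes "0 < \<beta>" "\<beta> < 1"
  shows "summable (\<lambda>k. \<bar>t ^ k / fact k * rGamma (1 - \<beta> - \<beta> * real k)\<bar>)"
proof (rule summable_comparison_test')
  show "summable (\<lambda>k. 1 / \<beta> * ((\<bar>t\<bar> + 1) ^ Suc k * Gamma (1 + \<beta> * real (Suc k)) / Gamma (1 + 1 * real (Suc k))))"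
    using summable_Gamma_quotient[of \<beta> 1 "\<bar>t\<bar> + 1"] assms
    by (intro summable_mult) (subst summable_Suc_iff, simp)
  fix k :: nat
  have "\<bar>t\<bar> ^ k \<le> (\<bar>t\<bar> + 1) ^ k" by (intro power_mono) auto
  also have "\<dots> \<le> (\<bar>t\<bar> + 1) ^ Suc k" by (intro power_increasing) auto
  finally have t: "\<bar>t\<bar> ^ k \<le> (\<bar>t\<bar> + 1) ^ Suc k" .
  have G: "Gamma (1 + \<beta> * real (Suc k)) > 0" using assms by (auto intro!: Gamma_real_pos add_pos_nonneg)
  have "\<bar>t ^ k / fact k * rGamma (1 - \<beta> - \<beta> * real k)\<bar> = \<bar>t\<bar> ^ k / fact k * \<bar>rGamma (1 - \<beta> - \<beta> * real k)\<bar>"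
    by (simp add: abs_mult power_abs)
  also have "\<dots> \<le> (\<bar>t\<bar> + 1) ^ Suc k / fact k * (Gamma (1 + \<beta> * real (Suc k)) / (\<beta> * real (Suc k)))"
    using t mainardi_coefficient_bound[OF assms(1), of k] by (intro mult_mono divide_right_mono) auto
  also have "\<dots> = 1 / \<beta> * ((\<bar>t\<bar> + 1) ^ Suc k * Gamma (1 + \<beta> * real (Suc k)) / Gamma (1 + 1 * real (Suc k)))"
    using Gamma_fact[of "Suc k", where 'a=real] by (simp add: field_simps del: of_nat_Suc power_Suc)
  finally show "norm \<bar>t ^ k / fact k * rGamma (1 - \<beta> - \<beta> * real k)\<bar> \<le> 1 / \<beta> *
      ((\<bar>t\<bar> + 1) ^ Suc k * Gamma (1 + \<beta> * real (Suc k)) / Gamma (1 + 1 * real (Suc k)))" by simp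
qed

lemma mainardi_sums:
  assumes "0 < \<beta>" "\<beta> < 1"
  shows "(\<lambda>k. (- t) ^ k / fact k * rGamma (1 - \<beta> - \<beta> * real k)) sums mainardi \<beta> t"
  unfolding mainardi_def using summable_rabs_cancel[OF mainardi_summable[OF assms]] by (rule summable_sums)

text \<open>
  The factor \<open>\<beta> t x\<^bsup>-\<beta>-1\<^esup>\<close> shifts the index of the Mainardi series by one, by the functional equation of
  the Gamma function. The additional term with index \<open>0\<close> vanishes, because \<open>1 / Gamma 0 = 0\<close>.
\<close>

lemma stable_density_sums:
  assumes "0 < \<beta>" "\<beta> < 1" "x > 0"
  shows "(\<lambda>k. 1 / x * ((- (t * x powr (- \<beta>))) ^ k / fact k * rGamma (- (\<beta> * real k)))) sums stable_density \<beta> t x"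
    (is "?d sums _")
proof -
  define y where "y = t * x powr (- \<beta>)"
  have "?d (Suc k) = \<beta> * t * x powr (- \<beta> - 1) * ((- y) ^ k / fact k * rGamma (1 - \<beta> - \<beta> * real k))" for k
  proof -
    have "rGamma (- (\<beta> * real (Suc k))) = - (\<beta> * real (Suc k)) * rGamma (1 - \<beta> - \<beta> * real k)"
      using rGamma_plus1[of "- (\<beta> * real (Suc k))", symmetric] by (simp add: algebra_simps)
    moreover have "\<beta> * t * x powr (- \<beta> - 1) = \<beta> * y / x" using assms by (simp add: y_def powr_diff)
    ultimately show ?thesis unfolding y_def[symmetric] using assms by (simp add: field_simps del: of_nat_Suc)
  qed
  then have "(\<lambda>k. ?d (Suc k)) sums stable_density \<beta> t x"
    unfolding stable_density_def y_def using mainardi_sums[OF assms(1,2)] by (simp only: sums_mult)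
  moreover have "?d 0 = 0" by simp
  ultimately show ?thesis by (simp only: sums_Suc_iff[of ?d] add_0_right)
qed


section \<open>Contour representation of the stable density\<close>

lemma measurable_Complex_line [measurable]: "(\<lambda>u. Complex u y) \<in> borel_measurable borel"
  unfolding Complex_eq by measurable

lemma ray_integrable:
  fixes x s \<theta> :: real
  assumes "x * cos \<theta> < 0" "s > 0"
  shows "integrable lborel (\<lambda>u. exp (of_real x * exp (Complex u \<theta>) + of_real s * Complex u \<theta>))"
    "(LINT u|lborel. norm (exp (of_real x * exp (Complex u \<theta>) + of_real s * Complex u \<theta>))) =
       Gamma s / (- (x * cos \<theta>)) powr s"
proof -
  have n: "norm (exp (of_real x * exp (Complex u \<theta>) + of_real s * Complex u \<theta>)) =
      exp (- (- (x * cos \<theta>)) * exp u + s * u)" for u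
    by (simp add: Re_exp algebra_simps)
  have i: "integrable lborel (\<lambda>u. exp (- (- (x * cos \<theta>)) * exp u + s * u))"
    using Gamma_line_integral(1)[of "- (x * cos \<theta>)" s] assms by simp
  show "integrable lborel (\<lambda>u. exp (of_real x * exp (Complex u \<theta>) + of_real s * Complex u \<theta>))"
    by (rule Bochner_Integration.integrable_bound[OF i]) (measurable, simp only: n, simp)
  show "(LINT u|lborel. norm (exp (of_real x * exp (Complex u \<theta>) + of_real s * Complex u \<theta>))) =
       Gamma s / (- (x * cos \<theta>)) powr s"
    unfolding n using Gamma_line_integral(2)[of "- (x * cos \<theta>)" s] assms by simp
qed

lemma cos_neg_of_gt_half_pi: "pi / 2 < \<theta> \<Longrightarrow> \<theta> \<le> pi \<Longrightarrow> cos \<theta> < 0"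
  using cos_monotone_0_pi[of "pi/2" \<theta>] by simp

text \<open>
  Euler's integral along the ray with angle \<open>\<theta>\<close>. For \<open>\<theta> = \<pi>\<close> the exponential decays along the negative
  real axis and the integral is the real one, up to a phase; for \<open>\<theta> > \<pi> / 2\<close> the integrand still decays, so the
  ray can be rotated.
\<close>

lemma ray_Gamma_integral:
  fixes x s \<theta> :: real
  assumes \<theta>: "pi / 2 < \<theta>" "\<theta> < pi" and "x > 0" "s > 0"
  shows "(LINT u|lborel. exp (of_real x * exp (Complex u \<theta>) + of_real s * Complex u \<theta>)) =
           of_real (Gamma s / x powr s) * cis (pi * s)"
proof -
  define f where "f w = exp (of_real x * exp w + of_real s * w)" for w :: complex
  define c where "c = - (x * cos \<theta>)"
  define B where "B R = exp (- c * exp R + s * R) + exp (- s * R)" for R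
  have c: "c > 0" using cos_neg_of_gt_half_pi \<theta> assms by (simp add: c_def mult_less_0_iff)
  have nf: "norm (f (Complex u y)) = exp (x * cos y * exp u + s * u)" for u y
    by (simp add: f_def Re_exp algebra_simps)
  have "(LINT u|lborel. f (Complex u \<theta>)) - (LINT u|lborel. f (Complex u pi)) =
      2 * of_real pi * \<i> * (\<Sum>p\<in>{}. residue f p)"
  proof (rule strip_integral_difference[where S=UNIV])
    show "f holomorphic_on UNIV - {}" unfolding f_def by (intro holomorphic_intros)
    show "integrable lborel (\<lambda>u. f (Complex u \<theta>))" "integrable lborel (\<lambda>u. f (Complex u pi))"
      unfolding f_def using c assms by (auto intro!: ray_integrable simp: c_def)
    show "(B \<longlongrightarrow> 0) at_top" unfolding B_def using c assms by real_asymp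
    show "\<forall>\<^sub>F R in at_top. \<forall>y\<in>{\<theta>..pi}. norm (f (Complex R y)) \<le> B R \<and> norm (f (Complex (-R) y)) \<le> B R"
    proof (intro always_eventually allI ballI)
      fix R y assume y: "y \<in> {\<theta>..pi}"
      have "cos y \<le> cos \<theta>" using y \<theta> pi_gt_zero by (intro cos_monotone_0_pi_le) auto
      then have "x * cos y \<le> - c" using assms by (simp add: c_def)
      then have *: "x * cos y * exp u \<le> - c * exp u" for u by (intro mult_right_mono) auto
      have "norm (f (Complex R y)) \<le> exp (- c * exp R + s * R)"
        unfolding nf using * by simp
      moreover have "x * cos y * exp (-R) \<le> 0" using *[of "-R"] c
        by (metis exp_ge_zero less_eq_real_def mult_nonneg_nonneg neg_le_0_iff_le mult_minus_left order_trans)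
      then have "norm (f (Complex (-R) y)) \<le> exp (- s * R)"
        unfolding nf by simp
      ultimately show "norm (f (Complex R y)) \<le> B R \<and> norm (f (Complex (-R) y)) \<le> B R"
        unfolding B_def by (smt (verit) exp_gt_zero)
    qed
  qed (use \<theta> in auto)
  then have "(LINT u|lborel. f (Complex u \<theta>)) = (LINT u|lborel. f (Complex u pi))" by simp
  also have "f (Complex u pi) = of_real (exp (- x * exp u + s * u)) * cis (pi * s)" for u
    unfolding f_def by (subst exp_eq_polar) (simp add: Re_exp Im_exp mult.commute)
  then have "(LINT u|lborel. f (Complex u pi)) = of_real (LINT u|lborel. exp (- x * exp u + s * u)) * cis (pi * s)"
    by (simp del: of_real_exp add: integral_complex_of_real)
  finally show ?thesis
    using Gamma_line_integral(2)[of x s] assms by (simp add: f_def)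
qed

text \<open>
  The inverse Laplace integral of \<open>exp (- t z\<^sup>\<beta>)\<close>, with the vertical line folded back to the two rays with
  angles \<open>\<plusminus>\<theta>\<close>. They are complex conjugate, which leaves \<open>1/\<pi>\<close> times an imaginary part. Expanding
  \<open>exp (- t z\<^sup>\<beta>)\<close> and integrating along the ray gives \<open>Gamma (1 + \<beta> k) sin (\<pi> (1 + \<beta> k))\<close> in the \<open>k\<close>-th term,
  which reflection turns into the coefficient \<open>1 / Gamma (- \<beta> k)\<close>.
\<close>

lemma stable_density_contour:
  fixes \<beta> x t \<theta> :: real
  assumes \<beta>: "0 < \<beta>" "\<beta> < 1" and "x > 0" "t > 0" and \<theta>: "pi / 2 < \<theta>" "\<theta> < pi"
  shows "stable_density \<beta> t x =
    Im (LINT u|lborel. exp (of_real x * exp (Complex u \<theta>) - of_real t * exp (of_real \<beta> * Complex u \<theta>) + Complex u \<theta>)) / pi"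
proof -
  define w where "w u = Complex u \<theta>" for u
  define s where "s k = \<beta> * real k + 1" for k :: nat
  define c where "c = - (x * cos \<theta>)"
  define f where "f k u = of_real ((- t) ^ k / fact k) * exp (of_real x * exp (w u) + of_real (s k) * w u)" for k u
  define d where "d k = 1 / x * ((- (t * x powr (- \<beta>))) ^ k / fact k * rGamma (- (\<beta> * real k)))" for k :: nat
  have pw: "y powr s k = (y powr \<beta>) ^ k * y" if "y > 0" for y k
    using that by (simp add: s_def powr_add powr_powr powr_realpow[symmetric])
  have c: "c > 0" using cos_neg_of_gt_half_pi \<theta> assms by (simp add: c_def mult_less_0_iff)
  have s: "s k > 0" for k using \<beta> by (simp add: s_def add_nonneg_pos)
  have int_ray: "integrable lborel (\<lambda>u. exp (of_real x * exp (w u) + of_real (s k) * w u))" for k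
    unfolding w_def using ray_integrable c s by (auto simp: c_def)
  have int: "integrable lborel (f k)" for k
    unfolding f_def using int_ray by (intro integrable_mult_right) auto
  have f_alt: "f k u = exp (of_real x * exp (w u) + w u) * ((- of_real t * exp (of_real \<beta> * w u)) ^ k / fact k)" for k u
  proof -
    have "exp (of_real (s k) * w u) = exp (w u) * exp (of_real \<beta> * w u) ^ k"
      by (simp add: s_def exp_of_nat_mult[symmetric] exp_add[symmetric] algebra_simps)
    then show ?thesis
      unfolding f_def power_mult_distrib[of "- of_real t"] by (simp add: exp_add mult_ac)
  qed
  have f_sums: "(\<lambda>k. f k u) sums exp (of_real x * exp (w u) - of_real t * exp (of_real \<beta> * w u) + w u)" for u
  proof -
    have "(\<lambda>k. (- of_real t * exp (of_real \<beta> * w u)) ^ k / fact k) sums exp (- of_real t * exp (of_real \<beta> * w u))"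
      using exp_converges[of "- of_real t * exp (of_real \<beta> * w u)"]
      by (simp add: scaleR_conv_of_real field_simps)
    from sums_mult[OF this, of "exp (of_real x * exp (w u) + w u)"] show ?thesis
      unfolding f_alt by (simp add: exp_add[symmetric] algebra_simps)
  qed
  have norm_int: "(LINT u|lborel. norm (f k u)) = t ^ k / fact k * (Gamma (s k) / c powr s k)" for k
    unfolding f_def norm_mult
    using ray_integrable(2)[of x \<theta> "s k"] c s assms by (simp add: c_def w_def norm_divide norm_power)
  have "(\<lambda>k. integral\<^sup>L lborel (f k)) sums (LINT u|lborel. (\<Sum>k. f k u))"
  proof (rule sums_integral[OF int])
    show "AE u in lborel. summable (\<lambda>k. norm (f k u))"
    proof (intro always_eventually allI)
      fix u
      have "summable (\<lambda>k. norm ((- of_real t * exp (of_real \<beta> * w u)) ^ k / fact k))"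
        using summable_norm_exp[of "- of_real t * exp (of_real \<beta> * w u)"]
        by (simp add: scaleR_conv_of_real field_simps norm_divide norm_mult)
      then show "summable (\<lambda>k. norm (f k u))"
        unfolding f_alt norm_mult[of "exp (of_real x * exp (w u) + w u)"] by (rule summable_mult)
    qed
    have "summable (\<lambda>k. (1 / c) * ((t / c powr \<beta>) ^ k * Gamma (1 + \<beta> * real k) / Gamma (1 + 1 * real k)))"
      using \<beta> by (intro summable_mult summable_Gamma_quotient) auto
    also have "(\<lambda>k. (1 / c) * ((t / c powr \<beta>) ^ k * Gamma (1 + \<beta> * real k) / Gamma (1 + 1 * real k))) =
       (\<lambda>k. LINT u|lborel. norm (f k u))"
    proof
      fix k
      show "(1 / c) * ((t / c powr \<beta>) ^ k * Gamma (1 + \<beta> * real k) / Gamma (1 + 1 * real k)) =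
          (LINT u|lborel. norm (f k u))"
        unfolding norm_int pw[OF c] using Gamma_fact[of k, where 'a=real]
        by (simp add: s_def power_divide add.commute)
    qed
    finally show "summable (\<lambda>k. LINT u|lborel. norm (f k u))" .
  qed
  moreover have "(\<Sum>k. f k u) = exp (of_real x * exp (w u) - of_real t * exp (of_real \<beta> * w u) + w u)" for u
    using f_sums sums_unique by metis
  ultimately have "(\<lambda>k. Im (integral\<^sup>L lborel (f k)) / pi) sums
      (Im (LINT u|lborel. exp (of_real x * exp (w u) - of_real t * exp (of_real \<beta> * w u) + w u)) / pi)" (is "_ sums ?I")
    by (intro sums_divide sums_Im) simp
  also have "(\<lambda>k. Im (integral\<^sup>L lborel (f k)) / pi) = d"
  proof
    fix k
    have "integral\<^sup>L lborel (f k) = of_real ((- t) ^ k / fact k) * (of_real (Gamma (s k) / x powr s k) * cis (pi * s k))"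
      unfolding f_def w_def by (subst integral_mult_right_zero, subst ray_Gamma_integral) (use assms s in auto)
    then have "Im (integral\<^sup>L lborel (f k)) = (- t) ^ k / fact k * (Gamma (s k) / x powr s k * sin (pi * s k))"
      by (simp only: Im_complex_of_real Re_complex_of_real times_complex.sel cis.sel mult_zero_left mult_zero_right add_0_right diff_0_right add_0)
    moreover have "rGamma (- (\<beta> * real k)) = Gamma (s k) * sin (pi * s k) / pi"
      using rGamma_one_minus[OF s[of k]] by (simp add: s_def)
    moreover have "(- (t * x powr (- \<beta>))) ^ k = (- t) ^ k / (x powr \<beta>) ^ k"
      using \<open>x > 0\<close> by (simp add: powr_minus_divide power_divide[symmetric])
    ultimately show "Im (integral\<^sup>L lborel (f k)) / pi = d k" by (simp add: d_def pw[OF \<open>x > 0\<close>])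
  qed
  finally have "d sums ?I" .
  moreover have "d sums stable_density \<beta> t x"
    using stable_density_sums[OF \<beta> \<open>x > 0\<close>, of t] by (simp add: d_def[abs_def])
  ultimately show ?thesis using sums_unique2 unfolding w_def by blast
qed


section \<open>Laplace transform of the stable density\<close>

lemma Fubini_product_bound:
  fixes F :: "real \<Rightarrow> real \<Rightarrow> 'b::{banach, second_countable_topology}"
  assumes F[measurable]: "(\<lambda>(x, u). F x u) \<in> borel_measurable (lborel \<Otimes>\<^sub>M lborel)"
    and h: "integrable lborel (h :: real \<Rightarrow> real)" and m: "integrable lborel (m :: real \<Rightarrow> real)"
    and bound: "\<And>x u. norm (F x u) \<le> h x * m u"
  shows "(LINT x|lborel. LINT u|lborel. F x u) = (LINT u|lborel. LINT x|lborel. F x u)"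
    and "integrable lborel (\<lambda>x. LINT u|lborel. F x u)"
proof -
  have [measurable]: "h \<in> borel_measurable borel" "m \<in> borel_measurable borel"
    using borel_measurable_integrable[OF h] borel_measurable_integrable[OF m] by auto
  have "integrable (lborel \<Otimes>\<^sub>M lborel) (\<lambda>(x, u). h x * m u)"
  proof (rule lborel_pair.Fubini_integrable)
    show "integrable lborel (\<lambda>x. LINT u|lborel. norm (case (x, u) of (x, u) \<Rightarrow> h x * m u))"
      using integrable_mult_left[OF integrable_norm[OF h], of "LINT u|lborel. \<bar>m u\<bar>"]
      by (simp add: abs_mult)
  qed (use h m in auto)
  then have int: "integrable (lborel \<Otimes>\<^sub>M lborel) (\<lambda>(x, u). F x u)"
    by (rule Bochner_Integration.integrable_bound[OF _ F]) (use bound in \<open>force intro: order_trans[OF _ abs_ge_self]\<close>)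
  from lborel_pair.Fubini_integral[OF this]
  show "(LINT x|lborel. LINT u|lborel. F x u) = (LINT u|lborel. LINT x|lborel. F x u)" by simp
  show "integrable lborel (\<lambda>x. LINT u|lborel. F x u)"
    using lborel_pair.integrable_fst'[OF int] by simp
qed

lemma integral_exp_complex_half_line:
  fixes z :: complex assumes "Re z < 0"
  shows "integrable lborel (\<lambda>x. indicator {0<..} x *\<^sub>R exp (of_real x * z))"
    and "(LINT x|lborel. indicator {0<..} x *\<^sub>R exp (of_real x * z)) = - 1 / z"
proof -
  let ?f = "\<lambda>x::real. indicator {0<..} x *\<^sub>R exp (of_real x * z)"
  have "set_integrable lborel {0<..} (\<lambda>t. t powr (1 - 1) / exp t :: real)"
    by (rule Gamma_set_integral) simp
  then have "integrable lborel (\<lambda>t. indicator {0<..} t * exp (- t) :: real)"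
    unfolding set_integrable_def
    by (rule back_subst[of "integrable lborel"]) (auto simp: indicator_def exp_minus field_simps)
  from lborel_integrable_real_affine[OF this, of "- Re z" 0] assms
  have i: "integrable lborel (\<lambda>x. indicator {0<..} (- Re z * x) * exp (Re z * x) :: real)" by simp
  show int: "integrable lborel ?f"
  proof (rule Bochner_Integration.integrable_bound[OF i])
    show "AE x in lborel. norm (?f x) \<le> norm (indicator {0<..} (- Re z * x) * exp (Re z * x) :: real)"
      using assms by (auto simp: indicator_def mult.commute zero_less_mult_iff mult_less_0_iff)
  qed measurable
  have z: "z \<noteq> 0" using assms by auto
  have fin: "(LINT u:{-R..R}|lborel. ?f u) = (exp (of_real R * z) - 1) / z" if "R > 0" for R
  proof -
    have "has_bochner_integral lborel (\<lambda>x. indicator {0..R} x *\<^sub>R exp (of_real x * z))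
       (exp (of_real R * z) / z - exp (of_real 0 * z) / z)"
    proof (rule has_bochner_integral_FTC_Icc)
      fix x :: real
      have "((\<lambda>y. exp (y * z) / z) has_field_derivative exp (of_real x * z)) (at (of_real x))"
        using z by (auto intro!: derivative_eq_intros)
      then show "((\<lambda>x. exp (of_real x * z) / z) has_vector_derivative exp (of_real x * z)) (at x within {0..R})"
        by (rule has_vector_derivative_real_field)
    qed (use that in \<open>auto intro!: continuous_intros\<close>)
    then have "(LINT x|lborel. indicator {0..R} x *\<^sub>R exp (of_real x * z)) = (exp (of_real R * z) - 1) / z"
      by (simp add: has_bochner_integral_iff diff_divide_distrib)
    moreover have "(LINT u:{-R..R}|lborel. ?f u) = (LINT x|lborel. indicator {0..R} x *\<^sub>R exp (of_real x * z))"
      unfolding set_lebesgue_integral_def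
      by (intro integral_cong_AE, measurable) (use AE_lborel_singleton[of 0] in \<open>auto simp: indicator_def elim!: eventually_mono\<close>)
    ultimately show ?thesis by simp
  qed
  have "((\<lambda>R. exp (- a * R)) \<longlongrightarrow> 0) at_top" if "a > 0" for a :: real
    using that by real_asymp
  from this[of "- Re z"] assms have "((\<lambda>R. norm (exp (of_real R * z))) \<longlongrightarrow> 0) at_top"
    by (simp add: mult.commute)
  then have "((\<lambda>R. exp (of_real R * z)) \<longlongrightarrow> 0) at_top"
    by (rule tendsto_norm_zero_cancel)
  then have "((\<lambda>R. (exp (of_real R * z) - 1) / z) \<longlongrightarrow> (0 - 1) / z) at_top"
    by (intro tendsto_intros z)
  moreover have "\<forall>\<^sub>F R in at_top. (LINT u:{-R..R}|lborel. ?f u) = (exp (of_real R * z) - 1) / z"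
    using eventually_gt_at_top[of 0] by eventually_elim (rule fin)
  ultimately have "((\<lambda>R. LINT u:{-R..R}|lborel. ?f u) \<longlongrightarrow> (0 - 1) / z) at_top"
    by (simp add: filterlim_cong)
  from tendsto_unique[OF _ tendsto_integral_symmetric_interval[OF int] this]
  show "(LINT x|lborel. ?f x) = - 1 / z" by simp
qed

text \<open>
  Cauchy's integral formula for \<open>exp (- t z\<^sup>\<beta>)\<close> at the point \<open>q\<close> of the sector between the rays with angles
  \<open>\<plusminus>\<theta>\<close>. The condition \<open>\<beta> \<theta> < \<pi> / 2\<close> makes \<open>z\<^sup>\<beta>\<close> stay in the right half plane, so that the function
  decays in the whole sector.
\<close>

lemma stable_Cauchy_integral:
  fixes \<beta> t q \<theta> :: real
  assumes \<beta>: "0 < \<beta>" and "t > 0" "q > 0" and \<theta>: "pi / 2 < \<theta>" "\<theta> < pi" "\<beta> * \<theta> < pi / 2"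
  shows "Im (LINT u|lborel. exp (- of_real t * exp (of_real \<beta> * Complex u \<theta>) + Complex u \<theta>) / (of_real q - exp (Complex u \<theta>))) =
      pi * exp (- t * q powr \<beta>)"
proof -
  define N where "N w = exp (- of_real t * exp (of_real \<beta> * w) + w)" for w :: complex
  define F where "F w = N w / (of_real q - exp w)" for w :: complex
  define S where "S = {z. Im z < pi} \<inter> {z. - pi < Im z}"
  define c where "c = t * cos (\<beta> * \<theta>)"
  define p where "p = complex_of_real (ln q)"
  define B where "B R = exp (- c * exp (\<beta> * R)) * (exp R / (exp R - q)) + exp (- R) / (q - exp (- R))" for R
  have c: "c > 0" unfolding c_def using \<theta> assms by (auto intro!: mult_pos_pos cos_gt_zero_pi simp: less_trans[of "-(pi/2)" 0])
  have normN: "norm (N (Complex u y)) = exp (- t * cos (\<beta> * y) * exp (\<beta> * u) + u)" for u y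
    by (simp add: N_def Re_exp algebra_simps)
  have normN_le: "norm (N (Complex u y)) \<le> exp (- c * exp (\<beta> * u) + u)" if "\<bar>y\<bar> \<le> \<theta>" for u y
  proof -
    have "cos (\<beta> * \<theta>) \<le> cos \<bar>\<beta> * y\<bar>"
      using that \<beta> \<theta> pi_gt_zero by (intro cos_monotone_0_pi_le) (auto simp: abs_mult)
    then have "c \<le> t * cos (\<beta> * y)" using assms by (simp add: c_def)
    then have "c * exp (\<beta> * u) \<le> t * cos (\<beta> * y) * exp (\<beta> * u)" by (intro mult_right_mono) auto
    then show ?thesis unfolding normN by simp
  qed
  \<comment> \<open>no two points of the strip differ by a period \<open>2 \<pi> \<i>\<close> of the exponential, so there is only one pole\<close>
  have pole: "w = p" if "w \<in> S" "exp w = of_real q" for w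
  proof -
    have "w = Ln (exp w)" using that by (intro Ln_exp[symmetric]) (auto simp: S_def)
    then show ?thesis using that assms by (simp add: p_def Ln_of_real)
  qed
  have expp: "exp p = of_real q" using assms by (simp add: p_def exp_of_real)
  have pS: "p \<in> S" by (simp add: S_def p_def)
  have S: "open S" "convex S" unfolding S_def
    by (auto intro!: open_Int convex_Int open_halfspace_Im_lt open_halfspace_Im_gt convex_halfspace_Im_lt convex_halfspace_Im_gt)
  have holoN: "N holomorphic_on A" for A unfolding N_def by (intro holomorphic_intros)
  have res: "residue F p = - of_real (exp (- t * q powr \<beta>))"
  proof -
    have "residue (\<lambda>w. N w / (of_real q - exp w)) p = N p / (- exp p)"
    proof (rule residue_simple_pole_deriv[where s=S])
      show "((\<lambda>w. of_real q - exp w) has_field_derivative - exp p) (at p)"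
        by (auto intro!: derivative_eq_intros)
      show "(\<lambda>w. of_real q - exp w) holomorphic_on S" by (intro holomorphic_intros)
      show "N holomorphic_on S" by (rule holoN)
      show "N p \<noteq> 0" by (simp add: N_def)
    qed (use S pS expp assms in \<open>auto simp: convex_connected\<close>)
    also have "exp (of_real \<beta> * p) = of_real (q powr \<beta>)"
      using assms by (simp add: p_def powr_def exp_of_real[symmetric])
    then have "N p = exp (- of_real (t * q powr \<beta>)) * exp p" by (simp add: N_def exp_add exp_diff exp_minus field_simps)
    then have "N p / (- exp p) = - of_real (exp (- t * q powr \<beta>))" by (simp add: exp_of_real[symmetric])
    finally show ?thesis by (simp add: F_def[abs_def])
  qed
  have cosneg: "cos y < 0" if "\<bar>y\<bar> = \<theta>" for y
    using cos_neg_of_gt_half_pi[of \<theta>] \<theta> that by (metis cos_abs_real less_imp_le)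
  have F_int: "integrable lborel (\<lambda>u. F (Complex u y))" if "\<bar>y\<bar> = \<theta>" for y
  proof (rule Bochner_Integration.integrable_bound)
    show "integrable lborel (\<lambda>u. exp (- c * exp (\<beta> * u) + 1 * u) / q)"
      using integrable_exp_exp[of \<beta> c 1] \<beta> c by (intro integrable_divide) simp
    show "AE u in lborel. norm (F (Complex u y)) \<le> norm (exp (- c * exp (\<beta> * u) + 1 * u) / q)"
    proof (intro always_eventually allI)
      fix u
      have "q \<le> Re (of_real q - exp (Complex u y))"
        using cosneg[OF that] by (simp add: Re_exp mult_le_0_iff)
      also have "\<dots> \<le> norm (of_real q - exp (Complex u y))" by (rule complex_Re_le_cmod)
      finally have "q \<le> norm (of_real q - exp (Complex u y))" .
      then show "norm (F (Complex u y)) \<le> norm (exp (- c * exp (\<beta> * u) + 1 * u) / q)"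
        unfolding F_def norm_divide using normN_le[of y u] that assms by (intro frac_le) auto
    qed
    show "(\<lambda>u. F (Complex u y)) \<in> borel_measurable lborel" unfolding F_def N_def by measurable
  qed
  have "(LINT u|lborel. F (Complex u (- \<theta>))) - (LINT u|lborel. F (Complex u \<theta>)) =
     2 * of_real pi * \<i> * (\<Sum>w\<in>{p}. residue F w)"
  proof (rule strip_integral_difference[OF _ S])
    show "F holomorphic_on S - {p}"
      unfolding F_def[abs_def] using pole by (intro holomorphic_intros holoN) auto
    show "(B \<longlongrightarrow> 0) at_top" unfolding B_def using c assms by real_asymp
    have "\<forall>\<^sub>F R in at_top. exp R > q" "\<forall>\<^sub>F R in at_top. exp (- R) < q"
      using \<open>q > 0\<close> by real_asymp+
    then show "\<forall>\<^sub>F R in at_top. \<forall>y\<in>{- \<theta>..\<theta>}. norm (F (Complex R y)) \<le> B R \<and> norm (F (Complex (-R) y)) \<le> B R"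
    proof eventually_elim
      case (elim R)
      show ?case
      proof
        fix y assume "y \<in> {- \<theta>..\<theta>}"
        then have y: "\<bar>y\<bar> \<le> \<theta>" by auto
        have b: "0 \<le> exp (- c * exp (\<beta> * R)) * (exp R / (exp R - q))" "0 \<le> exp (- R) / (q - exp (- R))"
          using elim by auto
        have "exp R - q \<le> norm (of_real q - exp (Complex R y))"
          using norm_triangle_ineq2[of "exp (Complex R y)" "of_real q"] assms by (simp add: norm_minus_commute)
        then have "norm (F (Complex R y)) \<le> exp (- c * exp (\<beta> * R) + R) / (exp R - q)"
          unfolding F_def norm_divide using normN_le[OF y] elim by (intro frac_le) auto
        also have "\<dots> = exp (- c * exp (\<beta> * R)) * (exp R / (exp R - q))" by (simp add: exp_add exp_diff exp_minus field_simps)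
        finally have 1: "norm (F (Complex R y)) \<le> B R" using b by (simp add: B_def)
        have "q - exp (- R) \<le> norm (of_real q - exp (Complex (-R) y))"
          using norm_triangle_ineq2[of "of_real q" "exp (Complex (-R) y)"] assms by simp
        moreover have "norm (N (Complex (-R) y)) \<le> exp (- R)"
          by (rule order_trans[OF normN_le[OF y, of "-R"]]) (simp add: c less_imp_le)
        ultimately have "norm (F (Complex (-R) y)) \<le> exp (- R) / (q - exp (- R))"
          unfolding F_def norm_divide using elim by (intro frac_le) auto
        with 1 b show "norm (F (Complex R y)) \<le> B R \<and> norm (F (Complex (-R) y)) \<le> B R"
          by (simp add: B_def)
      qed
    qed
  qed (use \<theta> F_int pi_gt_zero in \<open>auto simp: S_def p_def\<close>)
  moreover have "F (Complex u (- \<theta>)) = cnj (F (Complex u \<theta>))" for u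
  proof -
    have "Complex u (- \<theta>) = cnj (Complex u \<theta>)" by (simp add: complex_eq_iff)
    then show ?thesis by (simp add: F_def N_def exp_cnj del: complex_cnj)
  qed
  ultimately have "cnj (LINT u|lborel. F (Complex u \<theta>)) - (LINT u|lborel. F (Complex u \<theta>)) =
     - 2 * of_real pi * \<i> * of_real (exp (- t * q powr \<beta>))"
    by (simp add: res)
  from arg_cong[OF this, of Im] show ?thesis by (simp add: F_def N_def)
qed

text \<open>
  Insert the contour integral and exchange the integrals: the inner integral is \<open>1 / (q - z)\<close>, and what
  remains is Cauchy's formula. The angle has to satisfy both \<open>\<theta> > \<pi> / 2\<close>, for convergence in \<open>x\<close>, and
  \<open>\<beta> \<theta> < \<pi> / 2\<close>.
\<close>

lemma stable_density_Laplace: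
  fixes \<beta> t q :: real
  assumes \<beta>: "0 < \<beta>" "\<beta> < 1" and "t > 0" "q > 0"
  shows "set_integrable lborel {0<..} (\<lambda>x. exp (- q * x) * stable_density \<beta> t x)"
    and "(LINT x:{0<..}|lborel. exp (- q * x) * stable_density \<beta> t x) = exp (- t * q powr \<beta>)"
proof -
  \<comment> \<open>both requirements on the angle hold: \<open>\<pi>/2 < \<theta> < \<pi>\<close> and \<open>\<beta> \<theta> < \<pi>/2\<close>\<close>
  define \<theta> where "\<theta> = pi / (1 + \<beta>)"
  have \<theta>: "pi / 2 < \<theta>" "\<theta> < pi" "\<beta> * \<theta> < pi / 2"
    using \<beta> pi_gt_zero by (auto simp: \<theta>_def field_simps)
  define w where "w u = Complex u \<theta>" for u
  define c where "c = t * cos (\<beta> * \<theta>)"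
  define K where "K x u = exp (of_real x * exp (w u) - of_real t * exp (of_real \<beta> * w u) + w u)" for x u
  define F where "F x u = indicator {0<..} x *\<^sub>R (exp (- of_real (q * x)) * K x u)" for x u
  have [measurable]: "w \<in> borel_measurable borel" unfolding w_def[abs_def] by measurable
  have c: "c > 0" unfolding c_def using \<theta> assms by (auto intro!: mult_pos_pos cos_gt_zero_pi simp: less_trans[of "-(pi/2)" 0])
  have cos\<theta>: "cos \<theta> < 0" using cos_neg_of_gt_half_pi \<theta> by simp
  have K_le: "norm (K x u) \<le> exp (- c * exp (\<beta> * u) + 1 * u)" if "x > 0" for x u
    using that cos\<theta> by (simp add: K_def w_def Re_exp c_def mult_le_0_iff zero_le_mult_iff)
  have h: "integrable lborel (\<lambda>x. indicator {0<..} x * exp (- q * x) :: real)"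
    using integrable_norm[OF integral_exp_complex_half_line(1)[of "- of_real q"]] assms
    by (simp add: mult.commute indicator_abs_le_1 abs_mult)
  have m: "integrable lborel (\<lambda>u. exp (- c * exp (\<beta> * u) + 1 * u))"
    using integrable_exp_exp[of \<beta> c 1] \<beta> c by simp
  have meas: "(\<lambda>(x, u). F x u) \<in> borel_measurable (lborel \<Otimes>\<^sub>M lborel)"
    unfolding F_def K_def by measurable
  have bound: "norm (F x u) \<le> (indicator {0<..} x * exp (- q * x)) * exp (- c * exp (\<beta> * u) + 1 * u)" for x u
    using K_le[of x u] by (auto simp: F_def indicator_def norm_mult simp flip: of_real_mult)
  note Fub = Fubini_product_bound[OF meas h m bound]
  have Fx: "indicator {0<..} x *\<^sub>R (exp (- q * x) * stable_density \<beta> t x) = Im (LINT u|lborel. F x u) / pi" for x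
  proof (cases "x > 0")
    case True
    have "(LINT u|lborel. F x u) = of_real (exp (- q * x)) * (LINT u|lborel. K x u)"
      using True by (simp add: F_def exp_of_real[symmetric])
    then show ?thesis
      using True stable_density_contour[OF \<beta> True \<open>t > 0\<close> \<theta>(1,2)] by (simp add: K_def w_def)
  qed (simp add: F_def)
  show "set_integrable lborel {0<..} (\<lambda>x. exp (- q * x) * stable_density \<beta> t x)"
    unfolding set_integrable_def Fx by (intro integrable_divide integrable_Im Fub(2))
  have inner: "(LINT x|lborel. F x u) = exp (- of_real t * exp (of_real \<beta> * w u) + w u) / (of_real q - exp (w u))" for u
  proof -
    have re: "Re (exp (w u) - of_real q) < 0" using cos\<theta> assms
      by (simp add: w_def Re_exp) (smt (verit) exp_gt_zero mult_pos_neg)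
    define E where "E = exp (- of_real t * exp (of_real \<beta> * w u) + w u)"
    have "F x u = E * (indicator {0<..} x *\<^sub>R exp (of_real x * (exp (w u) - of_real q)))" for x
      by (simp add: E_def F_def K_def exp_add[symmetric] scaleR_conv_of_real algebra_simps)
    then have "(LINT x|lborel. F x u) = E * (- 1 / (exp (w u) - of_real q))"
      using integral_exp_complex_half_line(2)[OF re] by (simp only: integral_mult_right_zero)
    also have "- 1 / (exp (w u) - of_real q) = 1 / (of_real q - exp (w u))"
      by (metis minus_diff_eq minus_divide_divide minus_minus)
    finally show ?thesis by (simp add: E_def)
  qed
  have "(LINT x:{0<..}|lborel. exp (- q * x) * stable_density \<beta> t x) = Im (LINT x|lborel. LINT u|lborel. F x u) / pi"
    unfolding set_lebesgue_integral_def Fx using Fub(2) by (simp add: integral_Im)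
  also have "\<dots> = exp (- t * q powr \<beta>)"
    unfolding Fub(1) inner w_def using stable_Cauchy_integral[OF \<beta>(1) \<open>t > 0\<close> \<open>q > 0\<close> \<theta>] by simp
  finally show "(LINT x:{0<..}|lborel. exp (- q * x) * stable_density \<beta> t x) = exp (- t * q powr \<beta>)" .
qed


section \<open>Nonnegativity from complete monotonicity\<close>

text \<open>
  Complete monotonicity on \<open>(0, \<infinity>)\<close> up to order \<open>n\<close>: the derivatives up to order \<open>n\<close> alternate in sign.
  Passing from \<open>f\<close> to \<open>- f'\<close> lowers the order by one, so that closure under products, and the solution of a
  differential equation like \<open>f' = - h f\<close>, are inductions on the order.
\<close>

fun alternating :: "nat \<Rightarrow> (real \<Rightarrow> real) \<Rightarrow> bool" where
  "alternating 0 f \<longleftrightarrow> (\<forall>x>0. 0 \<le> f x)"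
| "alternating (Suc n) f \<longleftrightarrow> (\<forall>x>0. 0 \<le> f x) \<and>
     (\<exists>g. (\<forall>x>0. (f has_real_derivative - g x) (at x)) \<and> alternating n g)"

lemma alternating_nonneg: "alternating n f \<Longrightarrow> x > 0 \<Longrightarrow> 0 \<le> f x"
  by (cases n) auto

lemma alternating_Suc_imp: "alternating (Suc n) f \<Longrightarrow> alternating n f"
proof (induction n arbitrary: f)
  case (Suc n)
  then obtain g where "\<forall>x>0. 0 \<le> f x" "\<forall>x>0. (f has_real_derivative - g x) (at x)" "alternating (Suc n) g"
    by auto
  with Suc.IH[of g] show ?case by auto
qed simp

lemma alternating_cong:
  assumes "\<And>x. x > 0 \<Longrightarrow> f x = g x" "alternating n f" shows "alternating n g"
proof (cases n)
  case 0 then show ?thesis using assms by simp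
next
  case (Suc m)
  then obtain h where h: "\<And>x. x > 0 \<Longrightarrow> (f has_real_derivative - h x) (at x)" "alternating m h"
    using assms by auto
  have "(g has_real_derivative - h x) (at x)" if "x > 0" for x
    using has_field_derivative_transform_within_open[OF h(1)[OF that], of "{0<..}"] that assms(1) by auto
  then show ?thesis using Suc h alternating_nonneg[OF assms(2)] assms(1) by auto
qed

lemma alternating_SucI:
  assumes "\<And>x. x > 0 \<Longrightarrow> 0 \<le> f x" "\<And>x. x > 0 \<Longrightarrow> (f has_real_derivative - g x) (at x)" "alternating n g"
  shows "alternating (Suc n) f"
  using assms by auto

lemma alternating_SucE:
  assumes "alternating (Suc n) f"
  obtains g where "\<And>x. x > 0 \<Longrightarrow> (f has_real_derivative - g x) (at x)" "alternating n g"
  using assms by auto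

lemma alternating_add: "alternating n f \<Longrightarrow> alternating n g \<Longrightarrow> alternating n (\<lambda>x. f x + g x)"
proof (induction n arbitrary: f g)
  case (Suc n)
  obtain f' where f': "\<And>x. x > 0 \<Longrightarrow> (f has_real_derivative - f' x) (at x)" "alternating n f'"
    using Suc.prems(1) by (rule alternating_SucE) blast
  obtain g' where g': "\<And>x. x > 0 \<Longrightarrow> (g has_real_derivative - g' x) (at x)" "alternating n g'"
    using Suc.prems(2) by (rule alternating_SucE) blast
  show ?case
  proof (rule alternating_SucI)
    show "alternating n (\<lambda>x. f' x + g' x)" using Suc.IH f' g' by blast
    show "((\<lambda>x. f x + g x) has_real_derivative - (f' x + g' x)) (at x)" if "x > 0" for x
      using DERIV_add[OF f'(1)[OF that] g'(1)[OF that]] by simp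
  qed (use Suc.prems in auto)
qed auto

lemma alternating_mult: "alternating n f \<Longrightarrow> alternating n g \<Longrightarrow> alternating n (\<lambda>x. f x * g x)"
proof (induction n arbitrary: f g)
  case (Suc n)
  obtain f' where f': "\<And>x. x > 0 \<Longrightarrow> (f has_real_derivative - f' x) (at x)" "alternating n f'"
    using Suc.prems(1) by (rule alternating_SucE) blast
  obtain g' where g': "\<And>x. x > 0 \<Longrightarrow> (g has_real_derivative - g' x) (at x)" "alternating n g'"
    using Suc.prems(2) by (rule alternating_SucE) blast
  have "alternating n f" "alternating n g" using Suc.prems alternating_Suc_imp by blast+
  show ?case
  proof (rule alternating_SucI)
    show "alternating n (\<lambda>x. f' x * g x + g' x * f x)"
      using Suc.IH f' g' \<open>alternating n f\<close> \<open>alternating n g\<close> by (intro alternating_add) blast+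
    show "((\<lambda>x. f x * g x) has_real_derivative - (f' x * g x + g' x * f x)) (at x)" if "x > 0" for x
      using DERIV_mult[OF f'(1)[OF that] g'(1)[OF that]] by simp
  qed (use Suc.prems in auto)
qed auto

lemma alternating_powr: "0 \<le> c \<Longrightarrow> 0 \<le> p \<Longrightarrow> alternating n (\<lambda>x. c * x powr (- p))"
proof (induction n arbitrary: c p)
  case (Suc n)
  have "- p - 1 = - (p + 1)" by simp
  then have "((\<lambda>x. c * x powr (- p)) has_real_derivative - ((c * p) * x powr (- (p + 1)))) (at x)" if "x > 0" for x
    using that DERIV_cmult[OF has_real_derivative_powr[OF that, of "- p"], of c] by (simp add: mult.assoc)
  moreover have "alternating n (\<lambda>x. (c * p) * x powr (- (p + 1)))"
    using Suc.prems by (intro Suc.IH) auto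
  ultimately show ?case using Suc.prems by (intro alternating_SucI[where g="\<lambda>x. (c * p) * x powr (- (p + 1))"]) simp_all
qed auto

text \<open>
  The negative derivative is the function itself times \<open>\<beta> x\<^bsup>\<beta>-1\<^esup>\<close>, and this factor alternates because
  \<open>\<beta> \<le> 1\<close>. So alternation up to order \<open>n\<close> gives alternation up to order \<open>n + 1\<close>.
\<close>

lemma alternating_exp_powr:
  assumes "0 < \<beta>" "\<beta> \<le> 1" shows "alternating n (\<lambda>x. exp (- (x powr \<beta>)))"
proof (induction n)
  case (Suc n)
  show ?case
  proof (rule alternating_SucI)
    show "alternating n (\<lambda>x. \<beta> * x powr (- (1 - \<beta>)) * exp (- (x powr \<beta>)))"
      using assms Suc by (intro alternating_mult alternating_powr) auto
  qed (auto intro!: derivative_eq_intros)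
qed auto

lemma alternating_Suc_decreasing:
  assumes "alternating (Suc n) f" "0 \<le> h" "x > 0" shows "f (x + h) \<le> f x"
proof -
  obtain g where g: "\<And>x. x > 0 \<Longrightarrow> (f has_real_derivative - g x) (at x)" "alternating n g"
    using assms(1) by (rule alternating_SucE) blast
  show ?thesis
  proof (rule DERIV_nonpos_imp_nonincreasing[of x "x + h" f])
    fix y assume "x \<le> y" "y \<le> x + h"
    then have "y > 0" using assms by simp
    then show "\<exists>d. (f has_real_derivative d) (at y) \<and> d \<le> 0"
      using g alternating_nonneg by (intro exI[of _ "- g y"]) auto
  qed (use assms in simp)
qed

lemma alternating_diff:
  assumes "0 \<le> h" shows "alternating (Suc n) f \<Longrightarrow> alternating n (\<lambda>x. f x - f (x + h))"
proof (induction n arbitrary: f)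
  case 0
  then show ?case using alternating_Suc_decreasing[OF 0 assms] by simp
next
  case (Suc n)
  obtain g where g: "\<And>x. x > 0 \<Longrightarrow> (f has_real_derivative - g x) (at x)" "alternating (Suc n) g"
    using Suc.prems by (rule alternating_SucE) blast
  show ?case
  proof (rule alternating_SucI)
    show "alternating n (\<lambda>x. g x - g (x + h))" by (rule Suc.IH[OF g(2)])
    show "((\<lambda>x. f x - f (x + h)) has_real_derivative - (g x - g (x + h))) (at x)" if "x > 0" for x
    proof -
      have "((\<lambda>x. f (x + h)) has_real_derivative - g (x + h)) (at x)"
        using g(1)[of "x + h"] that assms by (simp add: DERIV_shift)
      from DERIV_diff[OF g(1)[OF that] this] show ?thesis by simp
    qed
  qed (use alternating_Suc_decreasing[OF Suc.prems assms] in simp)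
qed

text \<open>
  The part of Bernstein's theorem that is needed here. Taking the difference of the Laplace transform at
  \<open>a\<close> and \<open>a + 1\<close> multiplies the integrand by \<open>1 - exp (- x)\<close>; iterated differences of an alternating
  function are nonnegative. Hence \<open>f x exp (- x)\<close> has a nonnegative integral against every Bernstein
  polynomial in \<open>y = exp (- x)\<close>, and by approximation against every nonnegative continuous function of \<open>y\<close>.
  A bump function near a point where \<open>f\<close> is negative gives a contradiction.
\<close>

lemma nonneg_if_Laplace_alternating:
  fixes f :: "real \<Rightarrow> real"
  assumes cont: "continuous_on {0<..} f"
    and int: "\<And>a. a > 0 \<Longrightarrow> set_integrable lborel {0<..} (\<lambda>x. exp (- a * x) * f x)"
    and alt: "\<And>n. alternating n (\<lambda>a. LINT x:{0<..}|lborel. exp (- a * x) * f x)"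
    and "x0 > 0"
  shows "0 \<le> f x0"
proof (rule ccontr)
  assume neg: "\<not> 0 \<le> f x0"
  define g where "g x = indicator {0<..} x * (exp (- x) * f x)" for x :: real
  define P where "P q x = g x * q (exp (- x))" for q :: "real \<Rightarrow> real" and x :: real
  define L where "L a = (LINT x:{0<..}|lborel. exp (- a * x) * f x)" for a
  define D where "D m = ((\<lambda>h a. h a - h (a + 1)) ^^ m) L" for m :: nat
  have D_alt: "alternating n (D m)" for n m
  proof (induction m arbitrary: n)
    case 0 then show ?case using alt by (simp add: D_def L_def[abs_def])
  next
    case (Suc m) then show ?case using alternating_diff[of 1 n "D m"] by (simp add: D_def)
  qed
  have g_int: "integrable lborel g"
    using int[of 1] unfolding set_integrable_def g_def[abs_def] by simp
  have P_int: "integrable lborel (P q)" if q: "continuous_on UNIV q" for q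
  proof -
    have [measurable]: "q \<in> borel_measurable borel" using q by (rule borel_measurable_continuous_onI)
    have [measurable]: "g \<in> borel_measurable borel" using borel_measurable_integrable[OF g_int] by simp
    have "compact (q ` {0..1})" using q by (intro compact_continuous_image continuous_on_subset[OF q]) auto
    then obtain M where M: "\<And>y. y \<in> {0..1} \<Longrightarrow> \<bar>q y\<bar> \<le> M"
      using compact_imp_bounded by (fastforce simp: bounded_iff)
    show ?thesis
    proof (rule Bochner_Integration.integrable_bound[OF integrable_mult_left[OF g_int, of M]])
      show "P q \<in> borel_measurable lborel" unfolding P_def[abs_def] by measurable
      show "AE x in lborel. norm (P q x) \<le> norm (g x * M)"
      proof (intro always_eventually allI)
        fix x
        have "\<bar>q (exp (- x))\<bar> \<le> \<bar>M\<bar>" if "x > 0" using M[of "exp (- x)"] that by simp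
        then show "norm (P q x) \<le> norm (g x * M)"
          by (cases "x > 0") (auto simp: P_def g_def abs_mult intro!: mult_left_mono)
      qed
    qed
  qed
  have mono: "integral\<^sup>L lborel (P (\<lambda>y. y ^ k * (1 - y) ^ m)) = D m (real (k + 1))" for k m
  proof (induction m arbitrary: k)
    case 0
    have "P (\<lambda>y. y ^ k * (1 - y) ^ 0) = (\<lambda>x. indicator {0<..} x *\<^sub>R (exp (- real (k + 1) * x) * f x))"
    proof
      fix x
      have "exp (- real (k + 1) * x) = exp (- x) * exp (- x) ^ k"
        by (simp add: exp_of_nat_mult[symmetric] exp_add[symmetric] algebra_simps)
      then show "P (\<lambda>y. y ^ k * (1 - y) ^ 0) x = indicator {0<..} x *\<^sub>R (exp (- real (k + 1) * x) * f x)"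
        by (simp only: P_def g_def power_0 mult_1_right real_scaleR_def mult_ac)
    qed
    then show ?case by (simp only: D_def L_def set_lebesgue_integral_def funpow_0)
  next
    case (Suc m)
    have "P (\<lambda>y. y ^ k * (1 - y) ^ Suc m) = (\<lambda>x. P (\<lambda>y. y ^ k * (1 - y) ^ m) x - P (\<lambda>y. y ^ Suc k * (1 - y) ^ m) x)"
      by (simp add: P_def fun_eq_iff algebra_simps)
    moreover have "integrable lborel (P (\<lambda>y. y ^ j * (1 - y) ^ m))" for j by (intro P_int continuous_intros)
    ultimately have "integral\<^sup>L lborel (P (\<lambda>y. y ^ k * (1 - y) ^ Suc m)) = D m (real (k + 1)) - D m (real (Suc k + 1))"
      using Suc.IH by (simp only: Bochner_Integration.integral_diff)
    also have "\<dots> = D (Suc m) (real (k + 1))" by (simp add: D_def add_ac)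
    finally show ?case .
  qed
  have bern: "0 \<le> integral\<^sup>L lborel (P (Bernstein n k))" for n k
  proof -
    have "P (Bernstein n k) = (\<lambda>x. real (n choose k) * P (\<lambda>y. y ^ k * (1 - y) ^ (n - k)) x)"
      by (simp add: P_def Bernstein_def fun_eq_iff)
    moreover have "0 \<le> D (n - k) (real (k + 1))" using D_alt[of 0] by simp
    ultimately show ?thesis by (simp only: integral_mult_right_zero mono) simp
  qed
  have pos: "0 \<le> integral\<^sup>L lborel (P q)" if q: "continuous_on UNIV q" "\<And>y. 0 \<le> q y" for q
  proof (rule ccontr)
    assume neg: "\<not> 0 \<le> integral\<^sup>L lborel (P q)"
    define C where "C = (LINT x|lborel. \<bar>g x\<bar>)"
    \<comment> \<open>small enough that \<open>e C\<close> stays below minus the supposedly negative integral\<close>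
    define e where "e = - integral\<^sup>L lborel (P q) / (2 * (C + 1))"
    have "0 \<le> C" by (simp add: C_def)
    then have e: "e > 0" "e * (C + 1) = - integral\<^sup>L lborel (P q) / 2"
      using neg by (auto simp: e_def field_simps)
    obtain n where n: "\<And>x. x \<in> {0..1} \<Longrightarrow> \<bar>q x - (\<Sum>k\<le>n. q (real k / real n) * Bernstein n k x)\<bar> < e"
      using Bernstein_Weierstrass[OF continuous_on_subset[OF q(1)] e(1)] by blast
    let ?b = "\<lambda>x. \<Sum>k\<le>n. q (real k / real n) * Bernstein n k x"
    have cb: "continuous_on UNIV (Bernstein n k)" for k
      unfolding Bernstein_def[abs_def] by (intro continuous_intros)
    have ib: "integrable lborel (P ?b)" by (intro P_int continuous_intros cb)
    have "P ?b = (\<lambda>x. \<Sum>k\<le>n. q (real k / real n) * P (Bernstein n k) x)"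
      by (simp add: P_def fun_eq_iff sum_distrib_left mult_ac)
    then have "integral\<^sup>L lborel (P ?b) = (\<Sum>k\<le>n. q (real k / real n) * integral\<^sup>L lborel (P (Bernstein n k)))"
      using P_int[OF cb] by simp
    also have "\<dots> \<ge> 0" using bern q(2) by (intro sum_nonneg mult_nonneg_nonneg)
    finally have b0: "0 \<le> integral\<^sup>L lborel (P ?b)" .
    have "integral\<^sup>L lborel (P ?b) - integral\<^sup>L lborel (P q) = (LINT x|lborel. P ?b x - P q x)"
      using ib P_int[OF q(1)] by simp
    also have "\<dots> \<le> (LINT x|lborel. e * \<bar>g x\<bar>)"
    proof (rule integral_mono)
      fix x
      have "P ?b x - P q x \<le> \<bar>g x\<bar> * \<bar>q (exp (- x)) - ?b (exp (- x))\<bar>"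
        unfolding P_def abs_mult[symmetric] by (rule order_trans[OF _ abs_ge_minus_self]) (simp add: algebra_simps)
      also have "\<dots> \<le> \<bar>g x\<bar> * e"
        using n[of "exp (- x)"] by (cases "x > 0") (auto intro!: mult_left_mono simp: g_def less_imp_le)
      finally show "P ?b x - P q x \<le> e * \<bar>g x\<bar>" by (simp add: mult.commute)
    qed (use ib P_int[OF q(1)] g_int in auto)
    also have "\<dots> = e * C" by (simp add: C_def)
    also have "\<dots> \<le> e * (C + 1)" using e(1) by simp
    finally show False using b0 e(2) neg by linarith
  qed
  have contx: "isCont f x0" using cont \<open>x0 > 0\<close> by (simp add: continuous_on_eq_continuous_at)
  then have "\<forall>\<^sub>F x in at x0. f x < 0"
    using neg by (intro order_tendstoD(2)[of f "f x0"]) (auto simp: isCont_def)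
  then obtain d where d: "d > 0" "\<And>x. \<bar>x - x0\<bar> < d \<Longrightarrow> f x < 0"
  proof -
    obtain d where "d > 0" "\<forall>x. x \<noteq> x0 \<and> \<bar>x - x0\<bar> < d \<longrightarrow> f x < 0"
      using \<open>\<forall>\<^sub>F x in at x0. f x < 0\<close> by (auto simp: eventually_at dist_real_def)
    then show thesis using neg that[of d] by (metis not_le)
  qed
  \<comment> \<open>width of the bump in the variable \<open>y = exp (- x)\<close>, such that its support lies in the \<open>d\<close>-neighbourhood of \<open>x0\<close>\<close>
  define r where "r = min (exp (- x0) - exp (- (x0 + d))) (exp (- (x0 - d)) - exp (- x0))"
  have r: "r > 0" using d by (simp add: r_def)
  have near: "\<bar>x - x0\<bar> < d" if "\<bar>exp (- x) - exp (- x0)\<bar> < r" for x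
  proof -
    have "exp (- x) < exp (- (x0 - d))" "exp (- (x0 + d)) < exp (- x)"
      using that unfolding r_def by linarith+
    then show ?thesis by auto
  qed
  define q where "q y = max 0 (r - \<bar>y - exp (- x0)\<bar>)" for y
  have P_le: "P q x \<le> 0" for x
  proof (cases "x > 0 \<and> \<bar>exp (- x) - exp (- x0)\<bar> < r")
    case True
    then have "exp (- x) * f x \<le> 0" "q (exp (- x)) \<ge> 0" using near d(2) by (auto simp: q_def mult_le_0_iff less_imp_le)
    then show ?thesis using True by (simp add: P_def g_def mult_nonpos_nonneg)
  qed (auto simp: P_def g_def q_def)
  have "P q x0 < 0" using neg r \<open>x0 > 0\<close> by (simp add: P_def g_def q_def mult_pos_neg mult_neg_pos)
  have "isCont (\<lambda>x. exp (- x) * f x * q (exp (- x))) x0"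
    unfolding q_def using contx by (intro continuous_intros)
  moreover have "\<forall>\<^sub>F x in nhds x0. P q x = exp (- x) * f x * q (exp (- x))"
    using \<open>x0 > 0\<close> by (intro eventually_nhds_in_open[of "{0<..}", THEN eventually_mono]) (auto simp: P_def g_def)
  ultimately have "isCont (P q) x0"
    using isCont_cong[of "P q" "\<lambda>x. exp (- x) * f x * q (exp (- x))" x0] by simp
  then have "\<forall>\<^sub>F x in at x0. P q x < P q x0 / 2"
    using \<open>P q x0 < 0\<close> by (intro order_tendstoD(2)[of "P q" "P q x0"]) (auto simp: isCont_def)
  then obtain s where s: "s > 0" "\<And>x. \<bar>x - x0\<bar> < s \<Longrightarrow> P q x < P q x0 / 2"
  proof -
    obtain s where "s > 0" "\<forall>x. x \<noteq> x0 \<and> \<bar>x - x0\<bar> < s \<longrightarrow> P q x < P q x0 / 2"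
      using \<open>\<forall>\<^sub>F x in at x0. P q x < P q x0 / 2\<close> by (auto simp: eventually_at dist_real_def)
    moreover have "P q x0 < P q x0 / 2" using \<open>P q x0 < 0\<close> by simp
    ultimately show thesis using that[of s] by metis
  qed
  have cq: "continuous_on UNIV q" unfolding q_def[abs_def] by (intro continuous_intros)
  have "integral\<^sup>L lborel (P q) \<le> (LINT x|lborel. indicator {x0 - s<..<x0 + s} x * (P q x0 / 2))"
  proof (rule integral_mono[OF P_int[OF cq]])
    show "P q x \<le> indicator {x0 - s<..<x0 + s} x * (P q x0 / 2)" for x
      using s(2)[of x] P_le[of x] by (cases "\<bar>x - x0\<bar> < s") (auto simp: indicator_def)
    show "integrable lborel (\<lambda>x. indicator {x0 - s<..<x0 + s} x * (P q x0 / 2))"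
      using s(1) by (intro integrable_mult_left integrable_real_indicator) auto
  qed
  also have "\<dots> = (2 * s) * (P q x0 / 2)" using s by simp
  also have "\<dots> < 0" using s \<open>P q x0 < 0\<close> by (simp add: mult_pos_neg)
  finally show False using pos[OF cq] by (simp add: q_def[abs_def])
qed

lemma mainardi_isCont:
  assumes "0 < \<beta>" "\<beta> < 1" shows "isCont (mainardi \<beta>) t"
proof -
  let ?c = "\<lambda>k. rGamma (1 - \<beta> - \<beta> * real k) / fact k"
  have "summable (\<lambda>k. ?c k * y ^ k)" for y
    using summable_rabs_cancel[OF mainardi_summable[OF assms, of y]] by (simp add: field_simps)
  then have "isCont (\<lambda>x. \<Sum>k. ?c k * x ^ k) (- t)" by (rule isCont_powser_converges_everywhere)
  then have "isCont (\<lambda>t. \<Sum>k. ?c k * (- t) ^ k) t"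
    by (rule isCont_o2[where f = uminus, rotated]) simp
  moreover have "(\<lambda>t. \<Sum>k. ?c k * (- t) ^ k) = mainardi \<beta>"
    by (simp add: mainardi_def[abs_def] field_simps)
  ultimately show ?thesis by simp
qed

lemma measurable_mainardi [measurable]: "mainardi \<beta> \<in> borel_measurable borel"
  unfolding mainardi_def[abs_def] by measurable

lemma measurable_stable_density [measurable]:
  assumes [measurable]: "f \<in> borel_measurable M" "g \<in> borel_measurable M"
  shows "(\<lambda>x. stable_density \<beta> (f x) (g x)) \<in> borel_measurable M"
  unfolding stable_density_def by measurable

lemma stable_density_isCont:
  assumes "0 < \<beta>" "\<beta> < 1" "x > 0" shows "isCont (stable_density \<beta> t) x"
proof -
  have "isCont (\<lambda>x. t * x powr (- \<beta>)) x" using assms by (intro continuous_intros) auto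
  from isCont_o2[OF this mainardi_isCont[OF assms(1,2)]]
  show ?thesis unfolding stable_density_def[abs_def] using assms by (intro continuous_intros) auto
qed

text \<open>
  Every \<open>t > 0\<close> is \<open>x\<^bsup>-\<beta>\<^esup>\<close> for some \<open>x\<close>, where \<open>M\<^sub>\<beta> t\<close> is a positive multiple of the stable density at time \<open>1\<close>.
  That density is nonnegative because its Laplace transform \<open>exp (- q\<^sup>\<beta>)\<close> is completely monotone.
\<close>

lemma mainardi_nonneg:
  assumes \<beta>: "0 < \<beta>" "\<beta> < 1" and "t > 0" shows "0 \<le> mainardi \<beta> t"
proof -
  define x where "x = t powr (- 1 / \<beta>)"
  have x: "x > 0" "x powr (- \<beta>) = t" using assms by (auto simp: x_def powr_powr)
  have "0 \<le> stable_density \<beta> 1 x"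
  proof (rule nonneg_if_Laplace_alternating[OF _ _ _ x(1)])
    show "continuous_on {0<..} (stable_density \<beta> 1)"
      using stable_density_isCont[OF \<beta>] by (intro continuous_at_imp_continuous_on) auto
    show "set_integrable lborel {0<..} (\<lambda>x. exp (- a * x) * stable_density \<beta> 1 x)" if "a > 0" for a
      using stable_density_Laplace(1)[OF \<beta> _ that, of 1] by simp
    show "alternating n (\<lambda>a. LINT x:{0<..}|lborel. exp (- a * x) * stable_density \<beta> 1 x)" for n
      by (rule alternating_cong[OF _ alternating_exp_powr[of \<beta>]])
        (use stable_density_Laplace(2)[OF \<beta>, of 1] \<beta> in auto)
  qed
  then have "0 \<le> (\<beta> * x powr (- \<beta> - 1)) * mainardi \<beta> t" by (simp add: stable_density_def x(2))
  moreover have "\<beta> * x powr (- \<beta> - 1) > 0" using \<beta> x by simp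
  ultimately show ?thesis by (simp only: zero_le_mult_iff) linarith
qed

lemma stable_density_nonneg:
  assumes "0 < \<beta>" "\<beta> < 1" "t > 0" "x > 0" shows "0 \<le> stable_density \<beta> t x"
  unfolding stable_density_def using assms by (auto intro!: mult_nonneg_nonneg mainardi_nonneg)


section \<open>Lebesgue measure on the half line\<close>

text \<open>
  A density, and not a restriction to the subspace: its measurable sets are all Borel sets of the line, so
  measurability carries over, and positivity of the argument is an almost everywhere property.
\<close>

definition half_line :: "real measure" where
  "half_line = density lborel (\<lambda>x. ennreal (indicator {0<..} x))"

lemma sets_half_line [simp, measurable_cong]: "sets half_line = sets borel"
  by (simp add: half_line_def)

lemma space_half_line [simp]: "space half_line = UNIV"
  by (simp add: half_line_def)

lemma AE_half_lineI: "(\<And>x. x > 0 \<Longrightarrow> P x) \<Longrightarrow> AE x in half_line. P x"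
  unfolding half_line_def by (subst AE_density) (auto simp: indicator_def)

lemma nn_integral_half_line_cong:
  "(\<And>x. x > 0 \<Longrightarrow> f x = g x) \<Longrightarrow> (\<integral>\<^sup>+x. f x \<partial>half_line) = (\<integral>\<^sup>+x. g x \<partial>half_line)"
  by (intro nn_integral_cong_AE AE_half_lineI)

lemma nn_integral_half_line:
  "f \<in> borel_measurable borel \<Longrightarrow> (\<integral>\<^sup>+x. f x \<partial>half_line) = (\<integral>\<^sup>+x. ennreal (indicator {0<..} x) * f x \<partial>lborel)"
  unfolding half_line_def by (subst nn_integral_density) auto

lemma integral_half_line:
  fixes f :: "real \<Rightarrow> 'b::{banach, second_countable_topology}"
  assumes "f \<in> borel_measurable borel"
  shows "(LINT x|half_line. f x) = (LINT x:{0<..}|lborel. f x)"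
  unfolding half_line_def set_lebesgue_integral_def using assms by (subst integral_density) auto

lemma integrable_half_line:
  fixes f :: "real \<Rightarrow> 'b::{banach, second_countable_topology}"
  assumes "f \<in> borel_measurable borel"
  shows "integrable half_line f \<longleftrightarrow> set_integrable lborel {0<..} f"
  unfolding half_line_def set_integrable_def using assms by (subst integrable_density) auto

interpretation half_line: sigma_finite_measure half_line
  unfolding half_line_def
  by (subst sigma_finite_measure.sigma_finite_iff_density_finite[OF lborel.sigma_finite_measure_axioms]) auto

interpretation half_line_pair: pair_sigma_finite half_line half_line
  by unfold_locales

lemma nn_integral_half_line_scale:
  assumes [measurable]: "f \<in> borel_measurable borel" and "c > 0"
  shows "(\<integral>\<^sup>+x. f x \<partial>half_line) = ennreal c * (\<integral>\<^sup>+x. f (c * x) \<partial>half_line)"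
proof -
  have "(\<integral>\<^sup>+x. f x \<partial>half_line) = (\<integral>\<^sup>+x. ennreal (indicator {0<..} x) * f x \<partial>lborel)"
    by (rule nn_integral_half_line) measurable
  also have "\<dots> = \<bar>c\<bar> * (\<integral>\<^sup>+x. ennreal (indicator {0<..} (0 + c * x)) * f (0 + c * x) \<partial>lborel)"
    using assms by (intro nn_integral_real_affine) auto
  also have "\<dots> = ennreal c * (\<integral>\<^sup>+x. ennreal (indicator {0<..} x) * f (c * x) \<partial>lborel)"
  proof -
    have "indicator {0<..} (0 + c * x) = (indicator {0<..} x :: real)" for x
      using assms by (auto simp: indicator_def zero_less_mult_iff)
    then show ?thesis using assms by simp
  qed
  finally show ?thesis by (simp add: nn_integral_half_line)
qed

lemma nn_integral_eq_integral_half_line: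
  assumes "set_integrable lborel {0<..} f" "f \<in> borel_measurable borel" "\<And>x. x > 0 \<Longrightarrow> 0 \<le> f x"
  shows "(\<integral>\<^sup>+x. ennreal (f x) \<partial>half_line) = ennreal (LINT x:{0<..}|lborel. f x)"
  using assms integrable_half_line[of f] integral_half_line[of f]
  by (subst nn_integral_eq_integral) (auto intro: AE_half_lineI)

lemma Gamma_nn_integral:
  assumes "s > 0"
  shows "(\<integral>\<^sup>+t. ennreal (t powr (s - 1) * exp (- t)) \<partial>half_line) = ennreal (Gamma s)"
proof -
  have "t powr (s - 1) / exp t = t powr (s - 1) * exp (- t)" for t by (simp add: exp_minus field_simps)
  then show ?thesis
    using Gamma_set_integral[OF assms] nn_integral_eq_integral_half_line[of "\<lambda>t. t powr (s - 1) * exp (- t)"]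
    by simp
qed


section \<open>Moments and Laplace transform of the Mainardi function\<close>

lemma stable_density_nn_Laplace_pos:
  assumes \<beta>: "0 < \<beta>" "\<beta> < 1" and "t > 0" "q > 0"
  shows "(\<integral>\<^sup>+x. ennreal (exp (- q * x) * stable_density \<beta> t x) \<partial>half_line) = ennreal (exp (- t * q powr \<beta>))"
  using stable_density_Laplace[OF \<beta> \<open>t > 0\<close> \<open>q > 0\<close>] stable_density_nonneg[OF \<beta> \<open>t > 0\<close>]
    nn_integral_eq_integral_half_line[of "\<lambda>x. exp (- q * x) * stable_density \<beta> t x"] by simp

text \<open>
  At \<open>q = 0\<close> the statement says that the total mass is \<open>1\<close>; it follows from \<open>q > 0\<close> by monotone
  convergence.
\<close>

lemma stable_density_nn_Laplace:
  assumes \<beta>: "0 < \<beta>" "\<beta> < 1" and "t > 0" "q \<ge> 0"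
  shows "(\<integral>\<^sup>+x. ennreal (exp (- q * x) * stable_density \<beta> t x) \<partial>half_line) = ennreal (exp (- t * q powr \<beta>))"
proof (cases "q = 0")
  case True
  \<comment> \<open>\<open>max x 0\<close> makes the sequence increasing on the whole line and not only on the half line\<close>
  define F where "F n x = ennreal (exp (- (1 / real (Suc n)) * (max x 0)) * stable_density \<beta> t x)" for n x
  have lim: "(\<lambda>n. exp (- (1 / real (Suc n)) * c)) \<longlonglongrightarrow> 1" for c :: real
    by real_asymp
  have "(\<lambda>n. \<integral>\<^sup>+x. F n x \<partial>half_line) \<longlonglongrightarrow> (\<integral>\<^sup>+x. ennreal (stable_density \<beta> t x) \<partial>half_line)"
  proof (rule nn_integral_LIMSEQ)
    show "incseq F"
    proof (rule incseq_SucI, rule le_funI)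
      fix n x
      have "1 / real (Suc (Suc n)) * max x 0 \<le> 1 / real (Suc n) * max x 0"
        by (intro mult_right_mono frac_le) auto
      then have e: "exp (- (1 / real (Suc n)) * max x 0) \<le> exp (- (1 / real (Suc (Suc n))) * max x 0)"
        by simp
      show "F n x \<le> F (Suc n) x"
      proof (cases "stable_density \<beta> t x \<ge> 0")
        case True
        then show ?thesis unfolding F_def using e by (intro ennreal_leI mult_right_mono)
      next
        case False
        then show ?thesis unfolding F_def by (simp add: ennreal_neg mult_pos_neg less_imp_le)
      qed
    qed
    show "(\<lambda>n. F n x) \<longlonglongrightarrow> ennreal (stable_density \<beta> t x)" for x
      unfolding F_def using tendsto_mult_right[OF lim[of "max x 0"], of "stable_density \<beta> t x"]
      by (intro tendsto_ennrealI) simp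
  qed (auto simp: F_def)
  moreover have "(\<integral>\<^sup>+x. F n x \<partial>half_line) = ennreal (exp (- t * (1 / real (Suc n)) powr \<beta>))" for n
  proof -
    have "(\<integral>\<^sup>+x. F n x \<partial>half_line) = (\<integral>\<^sup>+x. ennreal (exp (- (1 / real (Suc n)) * x) * stable_density \<beta> t x) \<partial>half_line)"
      by (intro nn_integral_half_line_cong) (simp add: F_def max_def)
    also have "\<dots> = ennreal (exp (- t * (1 / real (Suc n)) powr \<beta>))"
      by (rule stable_density_nn_Laplace_pos[OF \<beta> \<open>t > 0\<close>]) simp
    finally show ?thesis .
  qed
  moreover have "(\<lambda>n. ennreal (exp (- t * (1 / real (Suc n)) powr \<beta>))) \<longlonglongrightarrow> ennreal 1"
    using \<beta> by (intro tendsto_ennrealI) real_asymp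
  ultimately have "(\<integral>\<^sup>+x. ennreal (stable_density \<beta> t x) \<partial>half_line) = ennreal 1"
    using LIMSEQ_unique by simp
  then show ?thesis using True \<beta> by simp
qed (use assms stable_density_nn_Laplace_pos in auto)

lemma stable_density_time_moment:
  assumes \<beta>: "0 < \<beta>" "\<beta> < 1" and "x > 0"
  shows "(\<integral>\<^sup>+t. ennreal (t ^ j * stable_density \<beta> t x) \<partial>half_line) =
    ennreal (\<beta> * x powr (\<beta> * real (Suc j) - 1)) * (\<integral>\<^sup>+t. ennreal (t ^ Suc j * mainardi \<beta> t) \<partial>half_line)"
proof -
  have p: "x powr \<beta> > 0" using assms by simp
  have "(\<integral>\<^sup>+t. ennreal (t ^ j * stable_density \<beta> t x) \<partial>half_line) =
      ennreal (x powr \<beta>) * (\<integral>\<^sup>+t. ennreal ((x powr \<beta> * t) ^ j * stable_density \<beta> (x powr \<beta> * t) x) \<partial>half_line)"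
    using p by (intro nn_integral_half_line_scale) auto
  also have "(\<integral>\<^sup>+t. ennreal ((x powr \<beta> * t) ^ j * stable_density \<beta> (x powr \<beta> * t) x) \<partial>half_line) =
      (\<integral>\<^sup>+t. ennreal (\<beta> * x powr (- \<beta> - 1) * (x powr \<beta>) ^ Suc j) * ennreal (t ^ Suc j * mainardi \<beta> t) \<partial>half_line)"
  proof (rule nn_integral_half_line_cong)
    fix t :: real assume t: "t > 0"
    have "x powr \<beta> * t * x powr (- \<beta>) = t" using assms by (simp add: powr_minus field_simps)
    then have "stable_density \<beta> (x powr \<beta> * t) x = \<beta> * (x powr \<beta> * t) * x powr (- \<beta> - 1) * mainardi \<beta> t"
      by (simp only: stable_density_def)
    then have "(x powr \<beta> * t) ^ j * stable_density \<beta> (x powr \<beta> * t) x =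
        (\<beta> * x powr (- \<beta> - 1) * (x powr \<beta>) ^ Suc j) * (t ^ Suc j * mainardi \<beta> t)"
      by (simp add: power_mult_distrib mult_ac)
    then show "ennreal ((x powr \<beta> * t) ^ j * stable_density \<beta> (x powr \<beta> * t) x) =
        ennreal (\<beta> * x powr (- \<beta> - 1) * (x powr \<beta>) ^ Suc j) * ennreal (t ^ Suc j * mainardi \<beta> t)"
      using \<beta> mainardi_nonneg[OF \<beta> t] t by (simp add: ennreal_mult)
  qed
  also have "\<dots> = ennreal (\<beta> * x powr (- \<beta> - 1) * (x powr \<beta>) ^ Suc j) * (\<integral>\<^sup>+t. ennreal (t ^ Suc j * mainardi \<beta> t) \<partial>half_line)"
    by (rule nn_integral_cmult) measurable
  also have "ennreal (x powr \<beta>) * (ennreal (\<beta> * x powr (- \<beta> - 1) * (x powr \<beta>) ^ Suc j) * (\<integral>\<^sup>+t. ennreal (t ^ Suc j * mainardi \<beta> t) \<partial>half_line))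
     = ennreal (x powr \<beta> * (\<beta> * x powr (- \<beta> - 1) * (x powr \<beta>) ^ Suc j)) * (\<integral>\<^sup>+t. ennreal (t ^ Suc j * mainardi \<beta> t) \<partial>half_line)"
    using \<beta> by (subst ennreal_mult) (auto simp: mult.assoc)
  also have "x powr \<beta> * (\<beta> * x powr (- \<beta> - 1) * (x powr \<beta>) ^ Suc j) = \<beta> * x powr (\<beta> * real (Suc j) - 1)"
  proof -
    have "(x powr \<beta>) ^ Suc j = x powr (\<beta> * real (Suc j))"
      using p by (subst powr_realpow[symmetric]) (simp_all only: powr_powr)
    moreover have "x powr \<beta> * x powr (- \<beta> - 1) * x powr (\<beta> * real (Suc j)) = x powr (\<beta> * real (Suc j) - 1)"
      by (subst powr_add[symmetric])+ (simp add: algebra_simps)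
    ultimately show ?thesis by (metis mult.assoc mult.left_commute)
  qed
  finally show ?thesis .
qed

text \<open>
  Integrate \<open>t\<^sup>j exp (- x)\<close> against the stable density over \<open>t\<close> and \<open>x\<close>. Integrating over \<open>x\<close> first gives
  \<open>\<integral> t\<^sup>j exp (- t) dt = j!\<close>, by the Laplace transform at \<open>1\<close>; integrating over \<open>t\<close> first gives the moment
  times \<open>\<beta> \<integral> x\<^bsup>\<beta>(j+1)-1\<^esup> exp (- x) dx = \<beta> Gamma (\<beta> (j + 1))\<close>. By nonnegativity the orders agree.
\<close>

lemma mainardi_nn_moment_Suc:
  assumes \<beta>: "0 < \<beta>" "\<beta> < 1"
  shows "(\<integral>\<^sup>+t. ennreal (t ^ Suc j * mainardi \<beta> t) \<partial>half_line) = ennreal (fact (Suc j) / Gamma (1 + \<beta> * real (Suc j)))"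
proof -
  define C where "C = (\<integral>\<^sup>+t. ennreal (t ^ Suc j * mainardi \<beta> t) \<partial>half_line)"
  define b where "b = \<beta> * real (Suc j)"
  have b: "b > 0" using \<beta> by (simp add: b_def)
  have "ennreal (fact j) = (\<integral>\<^sup>+t. ennreal (t powr (real (Suc j) - 1) * exp (- t)) \<partial>half_line)"
    using Gamma_fact[of j, where 'a=real] by (subst Gamma_nn_integral) (auto simp: add.commute)
  also have "\<dots> = (\<integral>\<^sup>+t. \<integral>\<^sup>+x. ennreal (t ^ j * (exp (- x) * stable_density \<beta> t x)) \<partial>half_line \<partial>half_line)"
  proof (rule nn_integral_half_line_cong)
    fix t :: real assume t: "t > 0"
    have "(\<integral>\<^sup>+x. ennreal (t ^ j * (exp (- x) * stable_density \<beta> t x)) \<partial>half_line) =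
        (\<integral>\<^sup>+x. ennreal (t ^ j) * ennreal (exp (- 1 * x) * stable_density \<beta> t x) \<partial>half_line)"
      using t stable_density_nonneg[OF \<beta> t] by (intro nn_integral_half_line_cong) (simp add: ennreal_mult)
    also have "\<dots> = ennreal (t ^ j) * ennreal (exp (- t * 1 powr \<beta>))"
      using t stable_density_nn_Laplace[OF \<beta> t, of 1] by (subst nn_integral_cmult) auto
    also have "\<dots> = ennreal (t powr (real (Suc j) - 1) * exp (- t))"
      using t by (simp add: ennreal_mult powr_realpow)
    finally show "ennreal (t powr (real (Suc j) - 1) * exp (- t)) =
      (\<integral>\<^sup>+x. ennreal (t ^ j * (exp (- x) * stable_density \<beta> t x)) \<partial>half_line)" ..
  qed
  also have "\<dots> = (\<integral>\<^sup>+x. \<integral>\<^sup>+t. ennreal (t ^ j * (exp (- x) * stable_density \<beta> t x)) \<partial>half_line \<partial>half_line)"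
    by (rule half_line_pair.Fubini'[symmetric]) measurable
  also have "\<dots> = (\<integral>\<^sup>+x. (ennreal \<beta> * C) * ennreal (x powr (b - 1) * exp (- x)) \<partial>half_line)"
  proof (rule nn_integral_half_line_cong)
    fix x :: real assume x: "x > 0"
    have "(\<integral>\<^sup>+t. ennreal (t ^ j * (exp (- x) * stable_density \<beta> t x)) \<partial>half_line) =
      (\<integral>\<^sup>+t. ennreal (exp (- x)) * ennreal (t ^ j * stable_density \<beta> t x) \<partial>half_line)"
      using x stable_density_nonneg[OF \<beta> _ x] by (intro nn_integral_half_line_cong) (simp add: ennreal_mult[symmetric] mult_ac)
    also have "\<dots> = ennreal (exp (- x)) * (ennreal (\<beta> * x powr (b - 1)) * C)"
      unfolding C_def b_def by (subst nn_integral_cmult) (auto simp: stable_density_time_moment[OF \<beta> x])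
    also have "\<dots> = (ennreal \<beta> * C) * ennreal (x powr (b - 1) * exp (- x))"
      using \<beta> by (simp add: ennreal_mult mult_ac)
    finally show "(\<integral>\<^sup>+t. ennreal (t ^ j * (exp (- x) * stable_density \<beta> t x)) \<partial>half_line) = \<dots>" .
  qed
  also have "\<dots> = (ennreal \<beta> * C) * ennreal (Gamma b)"
    using b by (subst nn_integral_cmult) (auto simp: Gamma_nn_integral)
  finally have eq: "ennreal (fact j) = ennreal (\<beta> * Gamma b) * C"
    using \<beta> Gamma_real_pos[OF b] by (simp add: ennreal_mult mult_ac)
  have pos: "\<beta> * Gamma b > 0" using \<beta> Gamma_real_pos[OF b] by simp
  then have "C \<noteq> \<top>" using eq by (cases "\<beta> = 0 \<or> Gamma b = 0") (auto simp: ennreal_mult_top)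
  then obtain c where c: "C = ennreal c" "c \<ge> 0" by (cases C) auto
  have "fact j = \<beta> * Gamma b * c"
    using eq c pos by (simp add: ennreal_mult[symmetric] less_imp_le)
  moreover have "Gamma (1 + b) = b * Gamma b"
  proof -
    have "b \<notin> \<int>\<^sub>\<le>\<^sub>0" using b nonpos_Ints_nonpos by fastforce
    then show ?thesis using Gamma_plus1[of b] by (simp add: add.commute)
  qed
  moreover have "fact (Suc j) = real (Suc j) * fact j" by simp
  ultimately have "fact (Suc j) = Gamma (1 + b) * c" by (simp only: b_def mult_ac)
  moreover have "Gamma (1 + b) > 0" using b by (intro Gamma_real_pos) simp
  ultimately have "c = fact (Suc j) / Gamma (1 + b)" by (metis nonzero_mult_div_cancel_left less_irrefl)
  then show ?thesis using c by (simp add: C_def b_def)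
qed

text \<open>
  The substitution \<open>t = x\<^bsup>-\<beta>\<^esup>\<close> turns the integral into the total mass of the stable density at time \<open>1\<close>.
\<close>

lemma mainardi_nn_moment_0:
  assumes \<beta>: "0 < \<beta>" "\<beta> < 1"
  shows "(\<integral>\<^sup>+t. ennreal (mainardi \<beta> t) \<partial>half_line) = 1"
proof -
  have img: "(\<lambda>x. x powr (- \<beta>)) ` {0<..} = {0<..}"
  proof (intro set_eqI iffI)
    fix y :: real assume "y \<in> {0<..}"
    then have "y = (y powr (- 1 / \<beta>)) powr (- \<beta>)" "y powr (- 1 / \<beta>) > 0" using \<beta> by (auto simp: powr_powr)
    then show "y \<in> (\<lambda>x. x powr (- \<beta>)) ` {0<..}" by blast
  qed auto
  have inj: "inj_on (\<lambda>x. x powr (- \<beta>)) {0<..}"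
  proof (rule inj_onI)
    fix x y :: real assume "x \<in> {0<..}" "y \<in> {0<..}" "x powr (- \<beta>) = y powr (- \<beta>)"
    then have "(x powr (- \<beta>)) powr (- 1 / \<beta>) = (y powr (- \<beta>)) powr (- 1 / \<beta>)" by simp
    then show "x = y" using \<beta> \<open>x \<in> {0<..}\<close> \<open>y \<in> {0<..}\<close> by (simp add: powr_powr)
  qed
  have eq: "\<bar>- \<beta> * x powr (- \<beta> - 1)\<bar> * mainardi \<beta> (x powr (- \<beta>)) = stable_density \<beta> 1 x" for x
    using \<beta> by (simp add: stable_density_def abs_mult)
  note sub = set_integral_substitution[where S="{0<..}" and g="\<lambda>x. x powr (- \<beta>)" and g'="\<lambda>x. - \<beta> * x powr (- \<beta> - 1)"
      and f="mainardi \<beta>", unfolded img eq]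
  have one: "(\<integral>\<^sup>+x. ennreal (stable_density \<beta> 1 x) \<partial>half_line) = ennreal 1"
    using stable_density_nn_Laplace[OF \<beta>, of 1 0] \<beta> by simp
  have "integrable half_line (stable_density \<beta> 1)"
    using one stable_density_nonneg[OF \<beta>, of 1] by (intro integrableI_nonneg AE_half_lineI) auto
  then have i: "set_integrable lborel {0<..} (stable_density \<beta> 1)" by (subst (asm) integrable_half_line) auto
  have v: "(LINT x:{0<..}|lborel. stable_density \<beta> 1 x) = 1"
    using nn_integral_eq_integral_half_line[OF i] one stable_density_nonneg[OF \<beta>, of 1]
    by (simp add: set_lebesgue_integral_def)
  have i': "set_integrable lborel {0<..} (mainardi \<beta>)"
    using i inj by (subst sub(1)) (auto simp: eq intro!: derivative_eq_intros)
  moreover have "(LINT x:{0<..}|lborel. mainardi \<beta> x) = 1"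
    using i' inj v by (subst sub(2)[symmetric]) (auto simp: eq intro!: derivative_eq_intros)
  ultimately show ?thesis
    using nn_integral_eq_integral_half_line[of "mainardi \<beta>"] mainardi_nonneg[OF \<beta>] by simp
qed

lemma mainardi_moments:
  assumes \<beta>: "0 < \<beta>" "\<beta> < 1"
  shows "integrable half_line (\<lambda>t. t ^ k * mainardi \<beta> t)"
    and "(LINT t|half_line. t ^ k * mainardi \<beta> t) = fact k / Gamma (1 + \<beta> * real k)"
proof -
  have nn: "(\<integral>\<^sup>+t. ennreal (t ^ k * mainardi \<beta> t) \<partial>half_line) = ennreal (fact k / Gamma (1 + \<beta> * real k))"
    using mainardi_nn_moment_0[OF \<beta>] mainardi_nn_moment_Suc[OF \<beta>] by (cases k) auto
  have G: "Gamma (1 + \<beta> * real k) > 0" using \<beta> by (auto intro!: Gamma_real_pos add_pos_nonneg)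
  have pos: "AE t in half_line. 0 \<le> t ^ k * mainardi \<beta> t"
    using mainardi_nonneg[OF \<beta>] by (intro AE_half_lineI) auto
  have "has_bochner_integral half_line (\<lambda>t. t ^ k * mainardi \<beta> t) (fact k / Gamma (1 + \<beta> * real k))"
    using nn pos G by (intro has_bochner_integral_nn_integral) auto
  then show "integrable half_line (\<lambda>t. t ^ k * mainardi \<beta> t)"
    "(LINT t|half_line. t ^ k * mainardi \<beta> t) = fact k / Gamma (1 + \<beta> * real k)"
    by (auto simp: has_bochner_integral_iff)
qed

text \<open>
  Termwise integration against a density with known moments. Used with the exponential series, with the
  stable density as a power series in time, and with the Mainardi series.
\<close>

lemma integral_power_series_times_density:
  fixes p q :: "real \<Rightarrow> real"
  assumes p: "\<And>t. t > 0 \<Longrightarrow> 0 \<le> p t"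
    and m: "\<And>k. integrable half_line (\<lambda>t. t ^ k * p t)" "\<And>k. (LINT t|half_line. t ^ k * p t) = m k"
    and q: "\<And>t. (\<lambda>k. a k * t ^ k) sums q t" and am: "summable (\<lambda>k. \<bar>a k\<bar> * m k)"
  shows "integrable half_line (\<lambda>t. q t * p t)" "(\<lambda>k. a k * m k) sums (LINT t|half_line. q t * p t)"
proof -
  define f where "f k t = a k * (t ^ k * p t)" for k t
  have i: "integrable half_line (f k)" for k unfolding f_def using m(1) by (rule integrable_mult_right)
  have "AE t in half_line. \<bar>f k t\<bar> = \<bar>a k\<bar> * (t ^ k * p t)" for k
    using p by (intro AE_half_lineI) (simp add: f_def abs_mult)
  then have "(LINT t|half_line. \<bar>f k t\<bar>) = (LINT t|half_line. \<bar>a k\<bar> * (t ^ k * p t))" for k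
    using i[of k] m(1)[of k] by (intro integral_cong_AE) auto
  then have n: "summable (\<lambda>k. LINT t|half_line. norm (f k t))" using am m by simp
  have "summable (\<lambda>k. norm (a k * t ^ k))" for t
    by (rule powser_insidea[OF sums_summable[OF q[of "\<bar>t\<bar> + 1"]]]) simp
  from summable_mult2[OF this] have "summable (\<lambda>k. norm (a k * t ^ k) * norm (p t))" for t .
  moreover have "norm (f k t) = norm (a k * t ^ k) * norm (p t)" for k t by (simp add: f_def abs_mult)
  ultimately have ae: "AE t in half_line. summable (\<lambda>k. norm (f k t))" by (intro AE_half_lineI) simp
  have fs: "(\<lambda>k. f k t) sums (q t * p t)" for t using sums_mult2[OF q, of t "p t"] by (simp add: f_def mult.assoc)
  have eq: "(\<lambda>t. \<Sum>k. f k t) = (\<lambda>t. q t * p t)" by (simp add: sums_unique[OF fs, symmetric])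
  show "integrable half_line (\<lambda>t. q t * p t)" using integrable_suminf[OF i ae n] unfolding eq .
  show "(\<lambda>k. a k * m k) sums (LINT t|half_line. q t * p t)"
    using sums_integral[OF i ae n] m unfolding eq by (simp add: f_def)
qed

text \<open>
  The moments \<open>k! / Gamma (1 + \<beta> k)\<close> turn the exponential series into the Mittag-Leffler series.
\<close>

lemma mainardi_Laplace:
  assumes \<beta>: "0 < \<beta>" "\<beta> < 1" and "x \<ge> 0"
  shows "(\<integral>\<^sup>+t. ennreal (exp (- t * x) * mainardi \<beta> t) \<partial>half_line) = ennreal (mittag_leffler \<beta> (- x))"
    and "0 \<le> mittag_leffler \<beta> (- x)"
proof -
  have q: "(\<lambda>k. (- x) ^ k / fact k * t ^ k) sums exp (- t * x)" for t
  proof -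
    have "(- x) ^ k / fact k * t ^ k = (- t * x) ^ k /\<^sub>R fact k" for k
    proof -
      have "(- t * x) ^ k = (- x) ^ k * t ^ k" by (simp flip: power_mult_distrib) (simp add: mult.commute)
      then show ?thesis by (simp add: divide_inverse)
    qed
    then show ?thesis using exp_converges[of "- t * x"] by simp
  qed
  have "summable (\<lambda>k. \<bar>(- x) ^ k / fact k\<bar> * (fact k / Gamma (1 + \<beta> * real k)))"
    using summable_power_over_Gamma[OF \<beta>(1), of x] \<open>x \<ge> 0\<close> by (simp add: abs_mult power_abs)
  note L = integral_power_series_times_density[OF mainardi_nonneg[OF \<beta>] mainardi_moments[OF \<beta>] q this]
  have val: "(LINT t|half_line. exp (- t * x) * mainardi \<beta> t) = mittag_leffler \<beta> (- x)"
    using sums_unique[OF L(2)] by (simp add: mittag_leffler_def)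
  have pos: "AE t in half_line. 0 \<le> exp (- t * x) * mainardi \<beta> t"
    using mainardi_nonneg[OF \<beta>] by (intro AE_half_lineI) auto
  show "(\<integral>\<^sup>+t. ennreal (exp (- t * x) * mainardi \<beta> t) \<partial>half_line) = ennreal (mittag_leffler \<beta> (- x))"
    unfolding val[symmetric] by (rule nn_integral_eq_integral[OF L(1) pos])
  show "0 \<le> mittag_leffler \<beta> (- x)"
    unfolding val[symmetric] using pos by (rule integral_nonneg_AE)
qed


section \<open>The subordination density as a mixture of stable densities\<close>

lemma summable_Gamma_quotient_boundary:
  assumes "0 \<le> a" "a < b \<or> a = b \<and> \<bar>x\<bar> < 1"
  shows "summable (\<lambda>k. x ^ k * Gamma (1 + a * real k) / Gamma (1 + b * real k))"
proof (cases "a < b")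
  case False
  then have ab: "a = b" "\<bar>x\<bar> < 1" using assms by auto
  have "Gamma (1 + b * real k) \<noteq> 0" for k
  proof -
    have "1 + b * real k > 0" using assms ab by (intro add_pos_nonneg) auto
    then show ?thesis using Gamma_real_pos by (metis less_irrefl)
  qed
  then show ?thesis using ab by (simp add: summable_geometric)
qed (use assms summable_Gamma_quotient in auto)

text \<open>
  Expand the stable density in powers of \<open>t\<close> and integrate against \<open>M\<^sub>\<beta>\<close>, whose moments are known. The
  series is controlled by \<open>Gamma (1 + \<gamma> k) / Gamma (1 + \<beta> k)\<close> times powers of \<open>x\<^bsup>-\<gamma>\<^esup>\<close>: it converges
  everywhere if \<open>\<gamma> < \<beta>\<close>, and is dominated by the geometric series in \<open>x\<^bsup>-\<gamma>\<^esup>\<close> if \<open>\<gamma> = \<beta>\<close>.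
\<close>

lemma stable_mixture_large:
  assumes \<gamma>: "0 < \<gamma>" "\<gamma> < 1" and \<beta>: "0 < \<beta>" "\<beta> < 1" and "x > 0"
    and cs: "\<gamma> < \<beta> \<or> \<gamma> = \<beta> \<and> x > 1"
  shows "integrable half_line (\<lambda>t. stable_density \<gamma> t x * mainardi \<beta> t)"
    and "(\<lambda>k. 1 / x * ((- (x powr (- \<gamma>))) ^ k * rGamma (1 + \<beta> * real k) * rGamma (- (\<gamma> * real k)))) sums
           (LINT t|half_line. stable_density \<gamma> t x * mainardi \<beta> t)"
proof -
  define a where "a k = (- 1) ^ k / fact k * rGamma (- (\<gamma> * real k)) * (1 / x * (x powr (- \<gamma>)) ^ k)" for k :: nat
  define B where "B k = 1 / x * ((x powr (- \<gamma>)) ^ k * Gamma (1 + \<gamma> * real k) / Gamma (1 + \<beta> * real k))" for k :: nat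
  have sgn: "(- y) ^ k = (- 1) ^ k * y ^ k" for k and y :: real by (metis mult_minus1 power_mult_distrib)
  have G: "Gamma (1 + \<beta> * real k) > 0" for k using \<beta> by (auto intro!: Gamma_real_pos add_pos_nonneg)
  have q: "(\<lambda>k. a k * t ^ k) sums stable_density \<gamma> t x" for t
  proof -
    have "1 / x * ((- (t * x powr (- \<gamma>))) ^ k / fact k * rGamma (- (\<gamma> * real k))) = a k * t ^ k" for k
      by (simp add: a_def sgn[of "t * _"] power_mult_distrib mult_ac)
    then show ?thesis using stable_density_sums[OF \<gamma> \<open>x > 0\<close>, of t] by simp
  qed
  have "summable (\<lambda>k. \<bar>a k\<bar> * (fact k / Gamma (1 + \<beta> * real k)))"
  proof (rule summable_comparison_test')
    have "\<bar>x powr (- \<gamma>)\<bar> < 1" if "x > 1" using that \<gamma> powr_less_mono[of "- \<gamma>" 0 x] by simp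
    then show "summable B" unfolding B_def using \<gamma> cs by (intro summable_mult summable_Gamma_quotient_boundary) auto
    fix k :: nat
    have "\<bar>rGamma (1 - (1 + \<gamma> * real k))\<bar> \<le> Gamma (1 + \<gamma> * real k)"
      using \<gamma> by (intro abs_rGamma_one_minus_le) (simp add: add_pos_nonneg)
    then have "1 / x * (x powr (- \<gamma>)) ^ k / Gamma (1 + \<beta> * real k) * \<bar>rGamma (- (\<gamma> * real k))\<bar>
        \<le> 1 / x * (x powr (- \<gamma>)) ^ k / Gamma (1 + \<beta> * real k) * Gamma (1 + \<gamma> * real k)"
      using G[of k] \<open>x > 0\<close> by (intro mult_left_mono) auto
    moreover have "\<bar>a k\<bar> * (fact k / Gamma (1 + \<beta> * real k)) =
        1 / x * (x powr (- \<gamma>)) ^ k / Gamma (1 + \<beta> * real k) * \<bar>rGamma (- (\<gamma> * real k))\<bar>"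
      using \<open>x > 0\<close> by (simp add: a_def abs_mult power_abs)
    moreover have "B k = 1 / x * (x powr (- \<gamma>)) ^ k / Gamma (1 + \<beta> * real k) * Gamma (1 + \<gamma> * real k)"
      by (simp add: B_def)
    moreover have "0 \<le> \<bar>a k\<bar> * (fact k / Gamma (1 + \<beta> * real k))" using G[of k] by simp
    ultimately show "norm (\<bar>a k\<bar> * (fact k / Gamma (1 + \<beta> * real k))) \<le> B k"
      by (simp only: real_norm_def abs_of_nonneg)
  qed
  note L = integral_power_series_times_density[OF mainardi_nonneg[OF \<beta>] mainardi_moments[OF \<beta>] q this]
  show "integrable half_line (\<lambda>t. stable_density \<gamma> t x * mainardi \<beta> t)" by (rule L(1))
  have "a k * (fact k / Gamma (1 + \<beta> * real k)) =
      1 / x * ((- (x powr (- \<gamma>))) ^ k * rGamma (1 + \<beta> * real k) * rGamma (- (\<gamma> * real k)))" for k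
    unfolding a_def sgn[of "x powr (- \<gamma>)"] by (simp add: rGamma_inverse_Gamma divide_inverse)
  then show "(\<lambda>k. 1 / x * ((- (x powr (- \<gamma>))) ^ k * rGamma (1 + \<beta> * real k) * rGamma (- (\<gamma> * real k)))) sums
           (LINT t|half_line. stable_density \<gamma> t x * mainardi \<beta> t)"
    using L(2) by simp
qed

lemma stable_density_time_moments:
  assumes \<gamma>: "0 < \<gamma>" "\<gamma> < 1" and "x > 0"
  shows "integrable half_line (\<lambda>t. t ^ k * stable_density \<gamma> t x)"
    and "(LINT t|half_line. t ^ k * stable_density \<gamma> t x) =
      x powr (\<gamma> - 1) * (x powr \<gamma>) ^ k * fact k * (\<gamma> * real (Suc k) / Gamma (1 + \<gamma> * real (Suc k)))"
proof -
  have G: "Gamma (1 + \<gamma> * real (Suc k)) > 0" using \<gamma> by (auto intro!: Gamma_real_pos add_pos_nonneg)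
  have pw: "x powr (\<gamma> * real (Suc k) - 1) = x powr (\<gamma> - 1) * (x powr \<gamma>) ^ k"
  proof -
    have "(x powr \<gamma>) ^ k = x powr (\<gamma> * real k)"
      using \<open>x > 0\<close> by (subst powr_realpow[symmetric]) (simp_all add: powr_powr)
    then show ?thesis by (simp add: powr_add[symmetric] algebra_simps)
  qed
  have "(\<integral>\<^sup>+t. ennreal (t ^ k * stable_density \<gamma> t x) \<partial>half_line) =
      ennreal (\<gamma> * (x powr (\<gamma> - 1) * (x powr \<gamma>) ^ k) * (fact (Suc k) / Gamma (1 + \<gamma> * real (Suc k))))"
    unfolding stable_density_time_moment[OF assms] mainardi_nn_moment_Suc[OF \<gamma>] pw
    using \<gamma> G by (intro ennreal_mult[symmetric]) auto
  moreover have "AE t in half_line. 0 \<le> t ^ k * stable_density \<gamma> t x"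
    using stable_density_nonneg[OF \<gamma> _ \<open>x > 0\<close>] by (intro AE_half_lineI) auto
  ultimately have "has_bochner_integral half_line (\<lambda>t. t ^ k * stable_density \<gamma> t x)
      (\<gamma> * (x powr (\<gamma> - 1) * (x powr \<gamma>) ^ k) * (fact (Suc k) / Gamma (1 + \<gamma> * real (Suc k))))"
    using G \<gamma> by (intro has_bochner_integral_nn_integral) auto
  moreover have "\<gamma> * (x powr (\<gamma> - 1) * (x powr \<gamma>) ^ k) * (fact (Suc k) / Gamma (1 + \<gamma> * real (Suc k))) =
      x powr (\<gamma> - 1) * (x powr \<gamma>) ^ k * fact k * (\<gamma> * real (Suc k) / Gamma (1 + \<gamma> * real (Suc k)))"
    by (simp del: of_nat_Suc add: fact_Suc)
  ultimately show "integrable half_line (\<lambda>t. t ^ k * stable_density \<gamma> t x)"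
    "(LINT t|half_line. t ^ k * stable_density \<gamma> t x) =
      x powr (\<gamma> - 1) * (x powr \<gamma>) ^ k * fact k * (\<gamma> * real (Suc k) / Gamma (1 + \<gamma> * real (Suc k)))"
    by (auto simp only: has_bochner_integral_iff)
qed

text \<open>
  The same integral with the roles exchanged: expand \<open>M\<^sub>\<beta>\<close> and integrate against the stable density as a
  function of time, whose moments come from those of \<open>M\<^sub>\<gamma>\<close> by scaling. Now the Gamma quotient is inverted and
  the powers are those of \<open>x\<^sup>\<gamma>\<close>, which covers the remaining cases.
\<close>

lemma stable_mixture_small:
  assumes \<gamma>: "0 < \<gamma>" "\<gamma> < 1" and \<beta>: "0 < \<beta>" "\<beta> < 1" and "x > 0"
    and cs: "\<beta> < \<gamma> \<or> \<beta> = \<gamma> \<and> x < 1"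
  shows "integrable half_line (\<lambda>t. stable_density \<gamma> t x * mainardi \<beta> t)"
    and "(\<lambda>k. x powr (\<gamma> - 1) * ((- (x powr \<gamma>)) ^ k * rGamma (1 - \<beta> - \<beta> * real k) * rGamma (\<gamma> + \<gamma> * real k))) sums
           (LINT t|half_line. stable_density \<gamma> t x * mainardi \<beta> t)"
proof -
  define a where "a k = (- 1) ^ k / fact k * rGamma (1 - \<beta> - \<beta> * real k)" for k :: nat
  define m where "m k = x powr (\<gamma> - 1) * (x powr \<gamma>) ^ k * fact k * (\<gamma> * real (Suc k) / Gamma (1 + \<gamma> * real (Suc k)))" for k
  define B where "B k = \<gamma> / \<beta> / x * ((x powr \<gamma>) ^ Suc k * Gamma (1 + \<beta> * real (Suc k)) / Gamma (1 + \<gamma> * real (Suc k)))" for k :: nat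
  note mom = stable_density_time_moments[OF \<gamma> \<open>x > 0\<close>, folded m_def]
  have G: "Gamma (1 + \<gamma> * real (Suc k)) > 0" for k using \<gamma> by (auto intro!: Gamma_real_pos add_pos_nonneg)
  have m: "0 \<le> m k" for k using G[of k] \<gamma> by (auto simp: m_def)
  have sgn: "(- y) ^ k = (- 1) ^ k * y ^ k" for k and y :: real by (metis mult_minus1 power_mult_distrib)
  have q: "(\<lambda>k. a k * t ^ k) sums mainardi \<beta> t" for t
    using mainardi_sums[OF \<beta>, of t] by (simp add: a_def sgn[of t] mult_ac)
  have "summable (\<lambda>k. \<bar>a k\<bar> * m k)"
  proof (rule summable_comparison_test')
    have "\<bar>x powr \<gamma>\<bar> < 1" if "x < 1" using that \<gamma> \<open>x > 0\<close> powr_less_mono2[of \<gamma> x 1] by simp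
    then have "summable (\<lambda>k. (x powr \<gamma>) ^ k * Gamma (1 + \<beta> * real k) / Gamma (1 + \<gamma> * real k))"
      using \<beta> cs by (intro summable_Gamma_quotient_boundary) auto
    then show "summable B" unfolding B_def by (intro summable_mult) (subst summable_Suc_iff)
    fix k :: nat
    have "\<bar>a k\<bar> * m k = 1 / fact k * \<bar>rGamma (1 - \<beta> - \<beta> * real k)\<bar> * m k" by (simp add: a_def abs_mult power_abs)
    also have "\<dots> \<le> 1 / fact k * (Gamma (1 + \<beta> * real (Suc k)) / (\<beta> * real (Suc k))) * m k"
      by (intro mult_right_mono mult_left_mono m mainardi_coefficient_bound[OF \<beta>(1)]) simp
    also have "\<dots> = B k"
    proof -
      have "x powr (\<gamma> - 1) * (x powr \<gamma>) ^ k = (x powr \<gamma>) ^ Suc k / x"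
        using \<open>x > 0\<close> by (simp add: powr_diff)
      then show ?thesis using \<beta> by (simp add: B_def m_def mult_ac del: of_nat_Suc power_Suc)
    qed
    finally show "norm (\<bar>a k\<bar> * m k) \<le> B k" using m[of k] by simp
  qed
  note L = integral_power_series_times_density[OF stable_density_nonneg[OF \<gamma> _ \<open>x > 0\<close>] mom q this,
      unfolded mult.commute[of "mainardi \<beta> _"]]
  show "integrable half_line (\<lambda>t. stable_density \<gamma> t x * mainardi \<beta> t)" by (rule L(1))
  have "a k * m k = x powr (\<gamma> - 1) * ((- (x powr \<gamma>)) ^ k * rGamma (1 - \<beta> - \<beta> * real k) * rGamma (\<gamma> + \<gamma> * real k))" for k
  proof -
    have "\<gamma> + \<gamma> * real k = \<gamma> * real (Suc k)" by (simp add: algebra_simps)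
    then have "rGamma (\<gamma> + \<gamma> * real k) = \<gamma> * real (Suc k) / Gamma (1 + \<gamma> * real (Suc k))"
      using rGamma_plus1[of "\<gamma> * real (Suc k)", symmetric]
      by (simp add: rGamma_inverse_Gamma divide_inverse add.commute del: of_nat_Suc)
    then show ?thesis by (simp add: a_def m_def sgn[of "x powr \<gamma>"] del: of_nat_Suc)
  qed
  then show "(\<lambda>k. x powr (\<gamma> - 1) * ((- (x powr \<gamma>)) ^ k * rGamma (1 - \<beta> - \<beta> * real k) * rGamma (\<gamma> + \<gamma> * real k))) sums
           (LINT t|half_line. stable_density \<gamma> t x * mainardi \<beta> t)"
    using L(2) by simp
qed

lemma mult_suminf_eq_of_sums:
  fixes f :: "nat \<Rightarrow> real"
  assumes "(\<lambda>k. c * f k) sums S" "c \<noteq> 0" shows "c * (\<Sum>k. f k) = S"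
  using sums_mult_D[OF assms] sums_unique assms(2) by (metis nonzero_mult_div_cancel_left times_divide_eq_right)

text \<open>
  The case distinction in the definition of \<open>Phi\<close> records which of the two expansions of the mixture
  converges. For \<open>\<gamma> = \<beta>\<close> the two reciprocal Gamma factors combine to a sine by reflection, and both expansions
  fail at \<open>x = 1\<close>.
\<close>

lemma Phi_eq_mixture:
  assumes \<gamma>: "0 < \<gamma>" "\<gamma> < 1" and \<beta>: "0 < \<beta>" "\<beta> < 1" and "x > 0" and "\<gamma> \<noteq> \<beta> \<or> x \<noteq> 1"
  shows "integrable half_line (\<lambda>t. stable_density \<gamma> t x * mainardi \<beta> t)"
    and "Phi (2 * \<gamma>) \<beta> x = (LINT t|half_line. stable_density \<gamma> t x * mainardi \<beta> t)"
proof -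
  let ?I = "LINT t|half_line. stable_density \<gamma> t x * mainardi \<beta> t"
  have cmp: "\<beta> / (2 * \<gamma>) < 1 / 2 \<longleftrightarrow> \<beta> < \<gamma>" "\<beta> / (2 * \<gamma>) > 1 / 2 \<longleftrightarrow> \<gamma> < \<beta>"
    using \<gamma> by (auto simp: field_simps)
  have P: "Phi (2 * \<gamma>) \<beta> x =
     (if \<beta> < \<gamma> then x powr (\<gamma> - 1) * wright4 (1 - \<beta>) (- \<beta>) \<gamma> \<gamma> (- (x powr \<gamma>))
      else if \<gamma> < \<beta> then 1 / x * wright4 1 \<beta> 0 (- \<gamma>) (- (x powr (- \<gamma>)))
      else if x < 1 then x powr (\<gamma> - 1) / pi * (\<Sum>k. sin (pi * \<gamma> * (real k + 1)) * (- (x powr \<gamma>)) ^ k)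
      else if x > 1 then - (1 / x / pi) * (\<Sum>k. sin (pi * \<gamma> * real k) * (- (x powr (- \<gamma>))) ^ k)
      else 0)"
    unfolding Phi_def cmp by simp
  have nz: "x powr (\<gamma> - 1) \<noteq> 0" "1 / x \<noteq> 0" using \<open>x > 0\<close> by auto
  consider "\<beta> < \<gamma> \<or> \<beta> = \<gamma> \<and> x < 1" | "\<gamma> < \<beta> \<or> \<gamma> = \<beta> \<and> x > 1" using assms by linarith
  then have "integrable half_line (\<lambda>t. stable_density \<gamma> t x * mainardi \<beta> t) \<and> Phi (2 * \<gamma>) \<beta> x = ?I"
  proof cases
    case 1
    note E = stable_mixture_small[OF \<gamma> \<beta> \<open>x > 0\<close> 1]
    have v: "x powr (\<gamma> - 1) * (\<Sum>k. (- (x powr \<gamma>)) ^ k * rGamma (1 - \<beta> - \<beta> * real k) * rGamma (\<gamma> + \<gamma> * real k)) = ?I"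
      by (rule mult_suminf_eq_of_sums[OF E(2) nz(1)])
    have "Phi (2 * \<gamma>) \<beta> x = ?I"
    proof (cases "\<beta> < \<gamma>")
      case True
      then show ?thesis unfolding P using v by (simp add: wright4_def)
    next
      case False
      then have eq: "\<beta> = \<gamma>" "x < 1" using 1 by auto
      have "rGamma (1 - \<gamma> - \<gamma> * real k) * rGamma (\<gamma> + \<gamma> * real k) = sin (pi * \<gamma> * (real k + 1)) / pi" for k
        using rGamma_reflection_real[of "\<gamma> + \<gamma> * real k"] by (simp add: algebra_simps)
      then have "(- (x powr \<gamma>)) ^ k * rGamma (1 - \<beta> - \<beta> * real k) * rGamma (\<gamma> + \<gamma> * real k) =
         1 / pi * (sin (pi * \<gamma> * (real k + 1)) * (- (x powr \<gamma>)) ^ k)" for k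
        unfolding eq by (simp add: mult.assoc)
      with E(2) have "(\<lambda>k. x powr (\<gamma> - 1) / pi * (sin (pi * \<gamma> * (real k + 1)) * (- (x powr \<gamma>)) ^ k)) sums ?I"
        by (simp add: mult_ac)
      from mult_suminf_eq_of_sums[OF this] nz eq
      show ?thesis unfolding P by simp
    qed
    then show ?thesis using E(1) by blast
  next
    case 2
    note E = stable_mixture_large[OF \<gamma> \<beta> \<open>x > 0\<close> 2]
    have v: "1 / x * (\<Sum>k. (- (x powr (- \<gamma>))) ^ k * rGamma (1 + \<beta> * real k) * rGamma (- (\<gamma> * real k))) = ?I"
      by (rule mult_suminf_eq_of_sums[OF E(2) nz(2)])
    have "Phi (2 * \<gamma>) \<beta> x = ?I"
    proof (cases "\<gamma> < \<beta>")
      case True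
      then show ?thesis unfolding P using v by (simp add: wright4_def)
    next
      case False
      then have eq: "\<beta> = \<gamma>" "x > 1" using 2 by auto
      have "rGamma (1 + \<gamma> * real k) * rGamma (- (\<gamma> * real k)) = - sin (pi * \<gamma> * real k) / pi" for k
        using rGamma_reflection_real[of "1 + \<gamma> * real k"] by (simp add: algebra_simps sin_add)
      then have "(- (x powr (- \<gamma>))) ^ k * rGamma (1 + \<beta> * real k) * rGamma (- (\<gamma> * real k)) =
         - 1 / pi * (sin (pi * \<gamma> * real k) * (- (x powr (- \<gamma>))) ^ k)" for k
        unfolding eq by (simp add: mult.assoc)
      with E(2) have "(\<lambda>k. - (1 / x / pi) * (sin (pi * \<gamma> * real k) * (- (x powr (- \<gamma>))) ^ k)) sums ?I"
        by (simp add: mult_ac)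
      from mult_suminf_eq_of_sums[OF this] nz eq
      show ?thesis unfolding P by simp
    qed
    then show ?thesis using E(1) by blast
  qed
  then show "integrable half_line (\<lambda>t. stable_density \<gamma> t x * mainardi \<beta> t)" "Phi (2 * \<gamma>) \<beta> x = ?I"
    by auto
qed

text \<open>
  For \<open>\<alpha> = 2\<close> the outer subordinator is the deterministic drift, and only the random time remains.
\<close>

lemma Phi_eq_mainardi:
  assumes "0 < \<beta>" "\<beta> < 1" "x > 0" shows "Phi 2 \<beta> x = mainardi \<beta> x"
proof -
  have r: "rGamma (1 + real k) = 1 / fact k" for k
    using Gamma_fact[of k, where 'a=real] by (simp add: rGamma_inverse_Gamma divide_inverse)
  have "Phi 2 \<beta> x = wright4 (1 - \<beta>) (- \<beta>) 1 1 (- x)" using assms by (simp add: Phi_def)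
  also have "\<dots> = mainardi \<beta> x"
    unfolding wright4_def mainardi_def by (intro suminf_cong) (simp add: r)
  finally show ?thesis .
qed

text \<open>
  For \<open>\<beta> = 1\<close> the random time is the constant \<open>1\<close>.
\<close>

lemma Phi_eq_stable_density:
  assumes \<gamma>: "0 < \<gamma>" "\<gamma> < 1" and "x > 0" shows "Phi (2 * \<gamma>) 1 x = stable_density \<gamma> 1 x"
proof -
  have r: "rGamma (1 + real k) = 1 / fact k" for k
    using Gamma_fact[of k, where 'a=real] by (simp add: rGamma_inverse_Gamma divide_inverse)
  have "(\<lambda>k. 1 / x * ((- (x powr (- \<gamma>))) ^ k * rGamma (1 + real k) * rGamma (- (\<gamma> * real k)))) sums stable_density \<gamma> 1 x"
    using stable_density_sums[OF assms, of 1] by (simp add: r)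
  from mult_suminf_eq_of_sums[OF this] show ?thesis
    using assms by (simp add: Phi_def wright4_def field_simps)
qed

lemma measurable_Phi [measurable]: "Phi \<alpha> \<beta> \<in> borel_measurable borel"
  unfolding Phi_def[abs_def] wright4_def by measurable

lemma mittag_leffler_one: "mittag_leffler 1 z = exp (z :: 'a :: {real_normed_field, banach})"
proof -
  have "of_real (Gamma (1 + 1 * real k)) = (fact k :: 'a)" for k
    using Gamma_fact[of k, where 'a=real] by (simp add: of_real_fact)
  then show ?thesis unfolding mittag_leffler_def exp_def
    by (simp add: scaleR_conv_of_real divide_inverse mult.commute)
qed

lemma Phi_nonneg:
  assumes "0 < \<beta>" "\<beta> \<le> 1" "0 < \<gamma>" "\<gamma> \<le> 1" "\<beta> + \<gamma> < 2" "x > 0"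
  shows "0 \<le> Phi (2 * \<gamma>) \<beta> x"
proof -
  consider "\<gamma> = 1" "\<beta> < 1" | "\<beta> = 1" "\<gamma> < 1" | "\<gamma> = \<beta>" "x = 1" "\<beta> < 1" | "\<gamma> < 1" "\<beta> < 1" "\<gamma> \<noteq> \<beta> \<or> x \<noteq> 1"
    using assms by linarith
  then show ?thesis
  proof cases
    case 1 then show ?thesis using assms mainardi_nonneg by (simp add: Phi_eq_mainardi)
  next
    case 2 then show ?thesis using assms stable_density_nonneg by (simp add: Phi_eq_stable_density)
  next
    case 3 then show ?thesis using assms by (simp add: Phi_def)
  next
    case 4
    have "0 \<le> (LINT t|half_line. stable_density \<gamma> t x * mainardi \<beta> t)"
      using assms 4 mainardi_nonneg[of \<beta>] stable_density_nonneg[of \<gamma> _ x]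
      by (intro integral_nonneg_AE AE_half_lineI) auto
    then show ?thesis using Phi_eq_mixture(2)[of \<gamma> \<beta> x] 4 assms by linarith
  qed
qed

text \<open>
  Given the time \<open>t\<close>, the stable density has Laplace transform \<open>exp (- t q\<^sup>\<gamma>)\<close>. Integrating this over \<open>t\<close>
  against \<open>M\<^sub>\<beta>\<close> is the Laplace transform of \<open>M\<^sub>\<beta>\<close> at \<open>q\<^sup>\<gamma>\<close>, that is \<open>E\<^sub>\<beta>(- q\<^sup>\<gamma>)\<close>.
\<close>

lemma Phi_Laplace:
  assumes "0 < \<beta>" "\<beta> \<le> 1" "0 < \<gamma>" "\<gamma> \<le> 1" "\<beta> + \<gamma> < 2" "q \<ge> 0"
  shows "(\<integral>\<^sup>+x. ennreal (exp (- q * x) * Phi (2 * \<gamma>) \<beta> x) \<partial>half_line) = ennreal (mittag_leffler \<beta> (- (q powr \<gamma>)))"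
    (is "?L = ?R") and "0 \<le> mittag_leffler \<beta> (- (q powr \<gamma>))"
proof -
  show "0 \<le> mittag_leffler \<beta> (- (q powr \<gamma>))"
  proof (cases "\<beta> = 1")
    case True
    then show ?thesis by (simp only: mittag_leffler_one exp_ge_zero)
  next
    case False
    then show ?thesis using assms by (intro mainardi_Laplace(2)) auto
  qed
  consider "\<gamma> = 1" "\<beta> < 1" | "\<beta> = 1" "\<gamma> < 1" | "\<gamma> < 1" "\<beta> < 1"
    using assms by linarith
  then show "?L = ?R"
  proof cases
    case 1
    have "?L =
        (\<integral>\<^sup>+x. ennreal (exp (- x * q) * mainardi \<beta> x) \<partial>half_line)"
      using 1 assms by (intro nn_integral_half_line_cong) (simp add: Phi_eq_mainardi mult.commute)
    then show ?thesis using mainardi_Laplace(1)[of \<beta> q] 1 assms by simp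
  next
    case 2
    have "?L =
        (\<integral>\<^sup>+x. ennreal (exp (- q * x) * stable_density \<gamma> 1 x) \<partial>half_line)"
      using 2 assms by (intro nn_integral_half_line_cong) (simp add: Phi_eq_stable_density)
    then show ?thesis using stable_density_nn_Laplace[of \<gamma> 1 q] 2 assms by (simp add: mittag_leffler_one)
  next
    case 3
    note M = mainardi_nonneg[of \<beta>] and S = stable_density_nonneg[of \<gamma>]
    have "AE x in half_line. x \<noteq> 1"
      unfolding half_line_def using AE_lborel_singleton[of 1] by (subst AE_density) auto
    moreover have "AE x in half_line. x > 0" by (rule AE_half_lineI)
    ultimately have "AE x in half_line. ennreal (exp (- q * x) * Phi (2 * \<gamma>) \<beta> x) =
        (\<integral>\<^sup>+t. ennreal (exp (- q * x) * (stable_density \<gamma> t x * mainardi \<beta> t)) \<partial>half_line)"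
    proof eventually_elim
      case (elim x)
      have i: "integrable half_line (\<lambda>t. stable_density \<gamma> t x * mainardi \<beta> t)"
        and v: "Phi (2 * \<gamma>) \<beta> x = (LINT t|half_line. stable_density \<gamma> t x * mainardi \<beta> t)"
        using Phi_eq_mixture[of \<gamma> \<beta> x] 3 assms elim by auto
      have "(\<integral>\<^sup>+t. ennreal (exp (- q * x) * (stable_density \<gamma> t x * mainardi \<beta> t)) \<partial>half_line) =
         ennreal (LINT t|half_line. exp (- q * x) * (stable_density \<gamma> t x * mainardi \<beta> t))"
        using i 3 assms elim M S by (intro nn_integral_eq_integral AE_half_lineI) auto
      then show ?case using i by (simp add: v)
    qed
    then have "?L =
       (\<integral>\<^sup>+x. (\<integral>\<^sup>+t. ennreal (exp (- q * x) * (stable_density \<gamma> t x * mainardi \<beta> t)) \<partial>half_line) \<partial>half_line)"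
      by (rule nn_integral_cong_AE)
    also have "\<dots> = (\<integral>\<^sup>+t. (\<integral>\<^sup>+x. ennreal (exp (- q * x) * (stable_density \<gamma> t x * mainardi \<beta> t)) \<partial>half_line) \<partial>half_line)"
      by (rule half_line_pair.Fubini'[symmetric]) measurable
    also have "\<dots> = (\<integral>\<^sup>+t. ennreal (exp (- t * (q powr \<gamma>)) * mainardi \<beta> t) \<partial>half_line)"
    proof (rule nn_integral_half_line_cong)
      fix t :: real assume t: "t > 0"
      have "(\<integral>\<^sup>+x. ennreal (exp (- q * x) * (stable_density \<gamma> t x * mainardi \<beta> t)) \<partial>half_line) =
        (\<integral>\<^sup>+x. ennreal (mainardi \<beta> t) * ennreal (exp (- q * x) * stable_density \<gamma> t x) \<partial>half_line)"
        using t 3 assms M S by (intro nn_integral_half_line_cong) (simp add: ennreal_mult[symmetric] mult_ac)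
      also have "\<dots> = ennreal (mainardi \<beta> t) * ennreal (exp (- t * q powr \<gamma>))"
        using stable_density_nn_Laplace[of \<gamma> t q] t 3 assms by (subst nn_integral_cmult) auto
      also have "\<dots> = ennreal (exp (- t * (q powr \<gamma>)) * mainardi \<beta> t)"
        using M t 3 assms by (simp add: ennreal_mult mult.commute)
      finally show "(\<integral>\<^sup>+x. ennreal (exp (- q * x) * (stable_density \<gamma> t x * mainardi \<beta> t)) \<partial>half_line) = \<dots>" .
    qed
    also have "\<dots> = ennreal (mittag_leffler \<beta> (- (q powr \<gamma>)))"
      using mainardi_Laplace(1)[of \<beta> "q powr \<gamma>"] 3 assms by simp
    finally show ?thesis .
  qed
qed


section \<open>Gaussian integrals and the heat kernel\<close>

lemma lborel_product_integral:
  fixes f :: "'a::euclidean_space \<Rightarrow> real \<Rightarrow> 'c::{real_normed_field, banach, second_countable_topology}"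
  assumes f: "\<And>b. b \<in> Basis \<Longrightarrow> integrable lborel (f b)"
  shows "integrable lborel (\<lambda>x. \<Prod>b\<in>Basis. f b (x \<bullet> b))"
    and "(LINT x|lborel. (\<Prod>b\<in>Basis. f b (x \<bullet> b))) = (\<Prod>b\<in>Basis. LINT x|lborel. f b x)"
proof -
  interpret product_sigma_finite "\<lambda>_::'a. lborel :: real measure" by standard
  have [measurable]: "f b \<in> borel_measurable borel" if "b \<in> Basis" for b
    using borel_measurable_integrable[OF f[OF that]] by simp
  have m: "(\<lambda>x::'a. \<Prod>b\<in>Basis. f b (x \<bullet> b)) \<in> borel_measurable borel" by measurable
  have d: "(\<lambda>g. \<Sum>b\<in>Basis. g b *\<^sub>R b) \<in> measurable (\<Pi>\<^sub>M b\<in>Basis. lborel) (borel :: 'a measure)" by measurable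
  have eq: "(\<Prod>b\<in>Basis. f b ((\<Sum>b\<in>Basis. g b *\<^sub>R b) \<bullet> b)) = (\<Prod>b\<in>Basis. f b (g b))" for g :: "'a \<Rightarrow> real"
    by (intro prod.cong refl) simp
  show "integrable lborel (\<lambda>x. \<Prod>b\<in>Basis. f b (x \<bullet> b))"
    unfolding lborel_eq[where 'a='a] integrable_distr_eq[OF d m] eq using f by (intro product_integrable_prod) auto
  show "(LINT x|lborel. (\<Prod>b\<in>Basis. f b (x \<bullet> b))) = (\<Prod>b\<in>Basis. LINT x|lborel. f b x)"
    unfolding lborel_eq[where 'a='a] integral_distr[OF d m] eq using f by (intro product_integral_prod) auto
qed

lemma gaussian_fourier_real:
  fixes a k :: real assumes "a > 0"
  shows "integrable lborel (\<lambda>x. exp (\<i> * of_real (k * x)) * of_real (exp (- a * x\<^sup>2)))"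
    and "(LINT x|lborel. exp (\<i> * of_real (k * x)) * of_real (exp (- a * x\<^sup>2))) =
           of_real (sqrt (pi / a) * exp (- k\<^sup>2 / (4 * a)))"
proof -
  define c where "c = sqrt (2 * a)"
  have c: "c > 0" "c\<^sup>2 = 2 * a" using assms by (auto simp: c_def)
  define f where "f x = exp (\<i> * of_real (k / c * x)) * of_real (std_normal_density x)" for x
  have i: "integrable lborel f"
  proof (rule Bochner_Integration.integrable_bound)
    show "integrable lborel std_normal_density" using integrable_std_normal_moment[of 0] by simp
    show "f \<in> borel_measurable lborel" unfolding f_def[abs_def] by measurable
  qed (auto simp: f_def norm_mult)
  have "char std_normal_distribution (k / c) = (LINT x|lborel. f x)"
    unfolding char_def f_def by (subst integral_density) (auto simp: scaleR_conv_of_real mult.commute)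
  then have v: "(LINT x|lborel. f x) = of_real (exp (- (k / c)\<^sup>2 / 2))"
    by (simp add: char_std_normal_distribution)
  have fc: "f (0 + c * x) = of_real (1 / sqrt (2 * pi)) * (exp (\<i> * of_real (k * x)) * of_real (exp (- a * x\<^sup>2)))" for x
    using c by (simp add: f_def std_normal_density_def power_mult_distrib)
  have "integrable lborel (\<lambda>x. of_real (1 / sqrt (2 * pi)) * (exp (\<i> * of_real (k * x)) * of_real (exp (- a * x\<^sup>2))) :: complex)"
    using lborel_integrable_real_affine[OF i, of c 0] c unfolding fc by simp
  from integrable_mult_right[OF this, of "of_real (sqrt (2 * pi))"]
  have "integrable lborel (\<lambda>x. of_real (sqrt (2 * pi) * (1 / sqrt (2 * pi))) * (exp (\<i> * of_real (k * x)) * of_real (exp (- a * x\<^sup>2))) :: complex)"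
    by (simp only: of_real_mult mult.assoc)
  then show "integrable lborel (\<lambda>x. exp (\<i> * of_real (k * x)) * of_real (exp (- a * x\<^sup>2)))"
    by simp
  have "(LINT x|lborel. f x) = \<bar>c\<bar> *\<^sub>R (LINT x|lborel. f (0 + c * x))"
    using c by (intro lborel_integral_real_affine) simp
  then have "(LINT x|lborel. exp (\<i> * of_real (k * x)) * of_real (exp (- a * x\<^sup>2))) =
      of_real (sqrt (2 * pi) / c) * of_real (exp (- (k / c)\<^sup>2 / 2))"
    unfolding v fc using c by (simp add: scaleR_conv_of_real field_simps)
  also have "sqrt (2 * pi) / c = sqrt (pi / a)"
    using assms by (simp add: c_def real_sqrt_divide[symmetric])
  also have "- (k / c)\<^sup>2 / 2 = - k\<^sup>2 / (4 * a)" using c by (simp add: power_divide)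
  finally show "(LINT x|lborel. exp (\<i> * of_real (k * x)) * of_real (exp (- a * x\<^sup>2))) =
           of_real (sqrt (pi / a) * exp (- k\<^sup>2 / (4 * a)))" by (simp only: of_real_mult)
qed

lemma gaussian_fourier:
  fixes k :: "'a::euclidean_space" and a :: real assumes "a > 0"
  shows "integrable lborel (\<lambda>x. exp (\<i> * of_real (k \<bullet> x)) * of_real (exp (- a * (norm x)\<^sup>2)))"
    and "(LINT x|lborel. exp (\<i> * of_real (k \<bullet> x)) * of_real (exp (- a * (norm x)\<^sup>2))) =
           of_real (sqrt (pi / a) ^ DIM('a) * exp (- (norm k)\<^sup>2 / (4 * a)))"
proof -
  define f where "f b y = exp (\<i> * of_real ((k \<bullet> b) * y)) * complex_of_real (exp (- a * y\<^sup>2))" for b :: 'a and y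
  have n2: "(norm x)\<^sup>2 = (\<Sum>b\<in>Basis. (x \<bullet> b)\<^sup>2)" for x :: 'a
    by (subst power2_norm_eq_inner, subst euclidean_inner) (simp add: power2_eq_square)
  have eq: "exp (\<i> * of_real (k \<bullet> x)) * of_real (exp (- a * (norm x)\<^sup>2)) = (\<Prod>b\<in>Basis. f b (x \<bullet> b))" for x
    unfolding f_def prod.distrib n2
    by (subst euclidean_inner) (simp add: exp_sum[symmetric] sum_distrib_left of_real_prod[symmetric] del: of_real_exp)
  have i: "integrable lborel (f b)" for b unfolding f_def by (rule gaussian_fourier_real[OF assms])
  show "integrable lborel (\<lambda>x. exp (\<i> * of_real (k \<bullet> x)) * of_real (exp (- a * (norm x)\<^sup>2)))"
    unfolding eq using i by (rule lborel_product_integral(1))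
  have "(LINT x|lborel. (\<Prod>b\<in>Basis. f b (x \<bullet> b))) = (\<Prod>b\<in>Basis. LINT y|lborel. f b y)"
    using i by (rule lborel_product_integral(2))
  also have "\<dots> = (\<Prod>b\<in>(Basis::'a set). of_real (sqrt (pi / a) * exp (- (k \<bullet> b)\<^sup>2 / (4 * a))))"
    unfolding f_def using gaussian_fourier_real(2)[OF assms] by (intro prod.cong refl) simp
  also have "\<dots> = of_real (sqrt (pi / a) ^ DIM('a) * exp (\<Sum>b\<in>(Basis::'a set). - (k \<bullet> b)\<^sup>2 / (4 * a)))"
    unfolding of_real_prod[symmetric] prod.distrib by (simp add: exp_sum[symmetric] del: of_real_exp)
  also have "(\<Sum>b\<in>(Basis::'a set). - (k \<bullet> b)\<^sup>2 / (4 * a)) = - (norm k)\<^sup>2 / (4 * a)"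
    unfolding n2 by (simp add: sum_divide_distrib[symmetric] sum_negf)
  finally have *: "(LINT x|lborel. (\<Prod>b\<in>Basis. f b (x \<bullet> b))) =
      of_real (sqrt (pi / a) ^ DIM('a) * exp (- (norm k)\<^sup>2 / (4 * a)))" .
  show "(LINT x|lborel. exp (\<i> * of_real (k \<bullet> x)) * of_real (exp (- a * (norm x)\<^sup>2))) =
           of_real (sqrt (pi / a) ^ DIM('a) * exp (- (norm k)\<^sup>2 / (4 * a)))"
    by (simp only: eq *)
qed

lemma heat_kernel_fourier:
  fixes k :: "real ^ 'n::finite" assumes "t > 0"
  shows "integrable lborel (\<lambda>x::real ^ 'n. heat_kernel x t)"
    and "(LINT x|lborel. exp (\<i> * of_real (k \<bullet> x)) * of_real (heat_kernel x t)) = of_real (exp (- t * (norm k)\<^sup>2))"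
proof -
  have a: "1 / (4 * t) > 0" using assms by simp
  have h: "heat_kernel x t = 1 / sqrt (4 * pi * t) ^ CARD('n) * exp (- (1 / (4 * t)) * (norm x)\<^sup>2)" for x :: "real ^ 'n"
    by (simp add: heat_kernel_def)
  have "integrable lborel (\<lambda>x::real ^ 'n. exp (- (1 / (4 * t)) * (norm x)\<^sup>2))"
    using integrable_norm[OF gaussian_fourier(1)[OF a, of "0 :: real ^ 'n"]] by (simp add: norm_mult)
  then show "integrable lborel (\<lambda>x::real ^ 'n. heat_kernel x t)" unfolding h by (rule integrable_mult_right)
  have "(LINT x|lborel. exp (\<i> * of_real (k \<bullet> x)) * of_real (heat_kernel x t)) =
    of_real (1 / sqrt (4 * pi * t) ^ CARD('n)) * (LINT x|lborel. exp (\<i> * of_real (k \<bullet> x)) * of_real (exp (- (1 / (4 * t)) * (norm x)\<^sup>2)))"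
    unfolding h by (subst integral_mult_right_zero[symmetric]) (simp add: mult_ac)
  also have "\<dots> = of_real (1 / sqrt (4 * pi * t) ^ CARD('n) * (sqrt (4 * pi * t) ^ CARD('n) * exp (- t * (norm k)\<^sup>2)))"
    unfolding gaussian_fourier(2)[OF a] of_real_mult[symmetric] using assms by (simp add: field_simps)
  also have "\<dots> = of_real (exp (- t * (norm k)\<^sup>2))" using assms by simp
  finally show "(LINT x|lborel. exp (\<i> * of_real (k \<bullet> x)) * of_real (heat_kernel x t)) = of_real (exp (- t * (norm k)\<^sup>2))" .
qed

lemma heat_kernel_integral: "t > 0 \<Longrightarrow> (LINT x|lborel. heat_kernel (x :: real ^ 'n::finite) t) = 1"
proof -
  assume "t > 0"
  have "(LINT x|lborel. complex_of_real (heat_kernel (x :: real ^ 'n) t)) = 1"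
    using heat_kernel_fourier(2)[OF \<open>t > 0\<close>, of "0 :: real ^ 'n"] by (simp del: integral_complex_of_real)
  then have "complex_of_real (LINT x|lborel. heat_kernel (x :: real ^ 'n) t) = of_real 1"
    unfolding integral_complex_of_real by simp
  then show ?thesis by (simp only: of_real_eq_iff)
qed

lemma integrable_inverse_one_plus_square: "integrable lborel (\<lambda>x::real. 1 / (1 + x\<^sup>2))"
  using integrable_inverse_1_plus_square by (simp add: set_integrable_def inverse_eq_divide)


section \<open>Schwartz functions\<close>

lemma schwartz_continuous: "schwartz \<phi> \<Longrightarrow> continuous_on UNIV \<phi>"
proof -
  assume "schwartz \<phi>"
  then have "\<phi> differentiable (at x)" for x
    unfolding schwartz_def by (metis pderivs.simps(1))
  then show ?thesis using differentiable_imp_continuous_within continuous_at_imp_continuous_on by blast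
qed

lemma schwartz_measurable [measurable_dest]: "schwartz \<phi> \<Longrightarrow> \<phi> \<in> borel_measurable borel"
  by (intro borel_measurable_continuous_onI schwartz_continuous)

lemma schwartz_bound: "schwartz \<phi> \<Longrightarrow> \<exists>C. \<forall>x. norm x ^ m * norm (\<phi> x) \<le> C"
proof -
  assume "schwartz \<phi>"
  then have "bounded (range (\<lambda>x. norm x ^ m *\<^sub>R \<phi> x))"
    unfolding schwartz_def by (metis pderivs.simps(1))
  then obtain C where "\<forall>y\<in>range (\<lambda>x. norm x ^ m *\<^sub>R \<phi> x). norm y \<le> C" unfolding bounded_iff by blast
  then show ?thesis by (intro exI[of _ C]) auto
qed

text \<open>
  Bounds on \<open>|\<phi>|\<close> and \<open>|x|\<^bsup>2n\<^esup> |\<phi>|\<close> bound \<open>\<phi>\<close> by a multiple of \<open>\<Prod> 1 / (1 + x\<^sub>b\<^sup>2)\<close>, which is integrable as a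
  product.
\<close>

lemma schwartz_integrable:
  fixes \<phi> :: "real ^ 'n::finite \<Rightarrow> complex"
  assumes "schwartz \<phi>" shows "integrable lborel \<phi>"
proof -
  define N where "N = DIM(real ^ 'n)"
  obtain C where C: "\<And>x. norm x ^ 0 * norm (\<phi> x) \<le> C" using schwartz_bound[OF assms] by blast
  obtain D where D: "\<And>x. norm x ^ (2 * N) * norm (\<phi> x) \<le> D" using schwartz_bound[OF assms] by blast
  have "integrable lborel (\<lambda>x::real ^ 'n. 2 ^ N * (C + D) * (\<Prod>b\<in>Basis. 1 / (1 + (x \<bullet> b)\<^sup>2)))"
    by (intro integrable_mult_right lborel_product_integral(1) integrable_inverse_one_plus_square)
  then show ?thesis
  proof (rule Bochner_Integration.integrable_bound)
    show "\<phi> \<in> borel_measurable lborel" using schwartz_measurable[OF assms] by simp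
    show "AE x in lborel. norm (\<phi> x) \<le> norm (2 ^ N * (C + D) * (\<Prod>b\<in>Basis. 1 / (1 + (x \<bullet> b)\<^sup>2)))"
    proof (intro always_eventually allI)
      fix x :: "real ^ 'n"
      define P where "P = (\<Prod>b\<in>Basis. 1 + (x \<bullet> b)\<^sup>2)"
      have "P > 0" unfolding P_def by (intro prod_pos) (auto intro: add_pos_nonneg)
      have "P \<le> (\<Prod>b\<in>(Basis :: (real ^ 'n) set). 1 + (norm x)\<^sup>2)"
        unfolding P_def using Basis_le_norm[of _ x] by (intro prod_mono) (auto simp: abs_le_square_iff[symmetric])
      also have "\<dots> = (1 + (norm x)\<^sup>2) ^ N" by (simp add: N_def)
      also have "\<dots> \<le> 2 ^ N * (1 + norm x ^ (2 * N))"
      proof -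
        have "(1 + (norm x)\<^sup>2) ^ N \<le> (2 * max 1 ((norm x)\<^sup>2)) ^ N" by (intro power_mono) auto
        also have "\<dots> = 2 ^ N * max 1 ((norm x)\<^sup>2) ^ N" by (rule power_mult_distrib)
        also have "max 1 ((norm x)\<^sup>2) ^ N \<le> 1 + norm x ^ (2 * N)"
          by (auto simp: max_def power_mult)
        finally show ?thesis by simp
      qed
      finally have P: "P \<le> 2 ^ N * (1 + norm x ^ (2 * N))" .
      have "P * norm (\<phi> x) \<le> 2 ^ N * (1 + norm x ^ (2 * N)) * norm (\<phi> x)"
        using P by (intro mult_right_mono) auto
      also have "\<dots> = 2 ^ N * (norm x ^ 0 * norm (\<phi> x) + norm x ^ (2 * N) * norm (\<phi> x))"
        by (simp add: algebra_simps)
      also have "\<dots> \<le> 2 ^ N * (C + D)" using C[of x] D[of x] by (intro mult_left_mono add_mono) auto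
      finally have "norm (\<phi> x) \<le> 2 ^ N * (C + D) / P" using \<open>P > 0\<close> by (simp add: field_simps)
      also have "\<dots> = 2 ^ N * (C + D) * (\<Prod>b\<in>Basis. 1 / (1 + (x \<bullet> b)\<^sup>2))"
        by (simp add: P_def prod_dividef)
      finally show "norm (\<phi> x) \<le> norm (2 ^ N * (C + D) * (\<Prod>b\<in>Basis. 1 / (1 + (x \<bullet> b)\<^sup>2)))" by simp
    qed
  qed
qed

lemma tempered_of_bounded:
  fixes f :: "real ^ 'n::finite \<Rightarrow> complex"
  assumes [measurable]: "f \<in> borel_measurable borel" and "\<And>x. norm (f x) \<le> C"
  shows "tempered f"
  unfolding tempered_def
proof (intro allI impI)
  fix \<phi> :: "real ^ 'n \<Rightarrow> complex" assume \<phi>: "schwartz \<phi>"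
  note [measurable] = schwartz_measurable[OF \<phi>]
  have "integrable lborel (\<lambda>x. of_real C * \<phi> x)" using schwartz_integrable[OF \<phi>] by simp
  then show "integrable lborel (\<lambda>x. f x * \<phi> x)"
  proof (rule Bochner_Integration.integrable_bound)
    show "AE x in lborel. norm (f x * \<phi> x) \<le> norm (of_real C * \<phi> x)"
      using assms(2) by (auto simp: norm_mult intro!: mult_right_mono order_trans[OF _ abs_ge_self])
  qed measurable
qed

lemma heat_kernel_continuous: "continuous_on UNIV (\<lambda>x :: real ^ 'n::finite. heat_kernel x t)"
proof -
  have "heat_kernel x t = 1 / sqrt (4 * pi * t) ^ CARD('n) * exp (- (1 / (4 * t)) * (norm x)\<^sup>2)" for x :: "real ^ 'n"
    by (simp add: heat_kernel_def)
  then show ?thesis by (simp only:) (intro continuous_intros)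
qed

lemma heat_kernel_nonneg: "t > 0 \<Longrightarrow> 0 \<le> heat_kernel x t"
  by (simp add: heat_kernel_def)

lemma heat_kernel_le:
  fixes x :: "real ^ 'n::finite" assumes "t > 0"
  shows "heat_kernel x t \<le> 1 / sqrt (4 * pi * t) ^ CARD('n)"
proof -
  have "exp (- (norm x)\<^sup>2 / (4 * t)) \<le> 1" using assms by simp
  then have "1 / sqrt (4 * pi * t) ^ CARD('n) * exp (- (norm x)\<^sup>2 / (4 * t)) \<le> 1 / sqrt (4 * pi * t) ^ CARD('n) * 1"
    using assms by (intro mult_left_mono) auto
  then show ?thesis by (simp add: heat_kernel_def)
qed

text \<open>
  Since \<open>E\<^sub>1 = exp\<close>, this is the Fourier transform of a Gaussian, moved to the test function by Fubini's
  theorem.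
\<close>

lemma heat_kernel_fundamental_solution:
  "first_fundamental_solution 2 1 (heat_kernel :: real ^ 'n::finite \<Rightarrow> real \<Rightarrow> real)"
  unfolding first_fundamental_solution_def has_tempered_fourier_def
proof (intro allI impI conjI)
  fix t :: real assume t: "t > 0"
  let ?h = "\<lambda>x :: real ^ 'n. heat_kernel x t"
  have [measurable]: "?h \<in> borel_measurable borel" by (intro borel_measurable_continuous_onI heat_kernel_continuous)
  show "continuous_on (- {0}) ?h" using heat_kernel_continuous continuous_on_subset by blast
  have ml: "mittag_leffler 1 (- complex_of_real (norm k powr 2 * t powr 1)) = of_real (exp (- t * (norm k)\<^sup>2))"
    for k :: "real ^ 'n"
    using t by (simp add: mittag_leffler_one mult.commute exp_of_real[symmetric])
  show "tempered (\<lambda>x. complex_of_real (?h x))"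
  proof (rule tempered_of_bounded)
    show "norm (complex_of_real (?h x)) \<le> 1 / sqrt (4 * pi * t) ^ CARD('n)" for x
      using heat_kernel_le[OF t, of x] heat_kernel_nonneg[OF t, of x] by (simp only: norm_of_real abs_of_nonneg)
  qed measurable
  show "tempered (\<lambda>k :: real ^ 'n. mittag_leffler 1 (- complex_of_real (norm k powr 2 * t powr 1)))"
    unfolding ml by (rule tempered_of_bounded[where C=1]) (use t in auto)
  fix \<phi> :: "real ^ 'n \<Rightarrow> complex" assume \<phi>: "schwartz \<phi>"
  note [measurable] = schwartz_measurable[OF \<phi>]
  define F where "F x k = complex_of_real (?h x) * (exp (\<i> * of_real (x \<bullet> k)) * \<phi> k)" for x k
  have nF: "norm (F x k) = ?h x * norm (\<phi> k)" for x k
    using heat_kernel_nonneg[OF t, of x] by (simp add: F_def norm_mult)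
  have int: "integrable (lborel \<Otimes>\<^sub>M lborel) (case_prod F)"
  proof (rule lborel_pair.Fubini_integrable)
    show "case_prod F \<in> borel_measurable (lborel \<Otimes>\<^sub>M lborel)" unfolding F_def by measurable
    show "integrable lborel (\<lambda>x. LINT k|lborel. norm (case (x, k) of (x, k) \<Rightarrow> F x k))"
      using heat_kernel_fourier(1)[OF t, where 'n='n] by (simp add: nF)
    show "AE x in lborel. integrable lborel (\<lambda>k. case (x, k) of (x, k) \<Rightarrow> F x k)"
    proof (intro always_eventually allI)
      fix x
      show "integrable lborel (\<lambda>k. case (x, k) of (x, k) \<Rightarrow> F x k)"
      proof (rule Bochner_Integration.integrable_bound[of _ "\<lambda>k. ?h x * norm (\<phi> k)"])
        show "integrable lborel (\<lambda>k. ?h x * norm (\<phi> k))" using schwartz_integrable[OF \<phi>] by simp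
        show "(\<lambda>k. case (x, k) of (x, k) \<Rightarrow> F x k) \<in> borel_measurable lborel" unfolding F_def by simp
      qed (simp add: nF)
    qed
  qed
  have "(LINT x|lborel. complex_of_real (?h x) * fourier \<phi> x) = (LINT x|lborel. LINT k|lborel. F x k)"
    unfolding F_def fourier_def by simp
  also have "\<dots> = (LINT k|lborel. LINT x|lborel. F x k)" using lborel_pair.Fubini_integral[OF int] by simp
  also have "(LINT x|lborel. F x k) = of_real (exp (- t * (norm k)\<^sup>2)) * \<phi> k" for k
  proof -
    have "F x k = (exp (\<i> * of_real (k \<bullet> x)) * of_real (?h x)) * \<phi> k" for x
      by (simp add: F_def inner_commute mult_ac)
    then show ?thesis using heat_kernel_fourier(2)[OF t, of k] by simp
  qed
  then have "(LINT k|lborel. LINT x|lborel. F x k) =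
     (LINT k|lborel. mittag_leffler 1 (- complex_of_real (norm k powr 2 * t powr 1)) * \<phi> k)" unfolding ml by simp
  finally show "(LINT x|lborel. complex_of_real (?h x) * fourier \<phi> x) =
     (LINT k|lborel. mittag_leffler 1 (- complex_of_real (norm k powr 2 * t powr 1)) * \<phi> k)" .
qed


section \<open>Gaussians as test functions\<close>

text \<open>
  Polynomial functions with complex coefficients. All partial derivatives of a Gaussian, possibly shifted
  and modulated, are such functions times the Gaussian.
\<close>

inductive polyfun :: "(real ^ 'n::finite \<Rightarrow> complex) \<Rightarrow> bool" where
  const: "polyfun (\<lambda>x. c)"
| coord: "polyfun (\<lambda>x. of_real (vec_nth x i))"
| add: "polyfun P \<Longrightarrow> polyfun Q \<Longrightarrow> polyfun (\<lambda>x. P x + Q x)"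
| mult: "polyfun P \<Longrightarrow> polyfun Q \<Longrightarrow> polyfun (\<lambda>x. P x * Q x)"

lemma polyfun_derivative:
  fixes P :: "real ^ 'n::finite \<Rightarrow> complex"
  shows "polyfun P \<Longrightarrow> \<exists>P'. (\<forall>x. (P has_derivative P' x) (at x)) \<and> (\<forall>i. polyfun (\<lambda>x. P' x (axis i 1)))"
proof (induction rule: polyfun.induct)
  case (const c)
  show ?case by (rule exI[of _ "\<lambda>x h. 0"]) (auto intro: polyfun.const)
next
  case (coord j)
  have "bounded_linear (\<lambda>h :: real ^ 'n. complex_of_real (vec_nth h j))"
    using bounded_linear_compose[OF bounded_linear_of_real bounded_linear_vec_nth] .
  then show ?case
    by (intro exI[of _ "\<lambda>x h. of_real (vec_nth h j)"]) (auto intro: bounded_linear_imp_has_derivative polyfun.const)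
next
  case (add P Q)
  then obtain P' Q' where d: "\<And>x. (P has_derivative P' x) (at x)" "\<And>x. (Q has_derivative Q' x) (at x)"
    and p: "\<And>i. polyfun (\<lambda>x. P' x (axis i 1))" "\<And>i. polyfun (\<lambda>x. Q' x (axis i 1))" by blast
  show ?case
    by (rule exI[of _ "\<lambda>x h. P' x h + Q' x h"]) (auto intro: d p polyfun.add has_derivative_add)
next
  case (mult P Q)
  then obtain P' Q' where d: "\<And>x. (P has_derivative P' x) (at x)" "\<And>x. (Q has_derivative Q' x) (at x)"
    and p: "\<And>i. polyfun (\<lambda>x. P' x (axis i 1))" "\<And>i. polyfun (\<lambda>x. Q' x (axis i 1))" by blast
  show ?case
    by (rule exI[of _ "\<lambda>x h. P x * Q' x h + P' x h * Q x"])
      (use mult.hyps in \<open>auto intro!: d p polyfun.add polyfun.mult has_derivative_mult\<close>)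
qed

lemma polyfun_growth:
  fixes P :: "real ^ 'n::finite \<Rightarrow> complex"
  shows "polyfun P \<Longrightarrow> \<exists>C d. \<forall>x. norm (P x) \<le> C * (1 + norm x) ^ d"
proof (induction rule: polyfun.induct)
  case (const c)
  show ?case by (rule exI[of _ "norm c"], rule exI[of _ 0]) simp
next
  case (coord j)
  have "\<bar>vec_nth x j\<bar> \<le> 1 + norm x" for x :: "real ^ 'n" using component_le_norm_cart[of x j] by simp
  then show ?case by (intro exI[of _ 1]) simp
next
  case (add P Q)
  then obtain C d D e where b: "\<And>x. norm (P x) \<le> C * (1 + norm x) ^ d" "\<And>x. norm (Q x) \<le> D * (1 + norm x) ^ e" by blast
  have "0 \<le> C" "0 \<le> D" using b(1)[of 0] b(2)[of 0] order_trans[OF norm_ge_zero] by fastforce+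
  have "norm (P x + Q x) \<le> (C + D) * (1 + norm x) ^ (d + e)" for x
  proof -
    have "(1 + norm x) ^ d \<le> (1 + norm x) ^ (d + e)" "(1 + norm x) ^ e \<le> (1 + norm x) ^ (d + e)"
      by (intro power_increasing; simp)+
    then have "C * (1 + norm x) ^ d \<le> C * (1 + norm x) ^ (d + e)" "D * (1 + norm x) ^ e \<le> D * (1 + norm x) ^ (d + e)"
      using \<open>0 \<le> C\<close> \<open>0 \<le> D\<close> by (auto intro: mult_left_mono)
    then show ?thesis using b(1)[of x] b(2)[of x] norm_triangle_ineq[of "P x" "Q x"] unfolding distrib_right by linarith
  qed
  then show ?case by blast
next
  case (mult P Q)
  then obtain C d D e where b: "\<And>x. norm (P x) \<le> C * (1 + norm x) ^ d" "\<And>x. norm (Q x) \<le> D * (1 + norm x) ^ e" by blast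
  have "norm (P x * Q x) \<le> (C * D) * (1 + norm x) ^ (d + e)" for x
  proof -
    have "norm (P x * Q x) \<le> (C * (1 + norm x) ^ d) * (D * (1 + norm x) ^ e)"
      unfolding norm_mult using b(1)[of x] b(2)[of x] order_trans[OF norm_ge_zero] by (intro mult_mono) blast+
    then show ?thesis by (simp add: power_add mult_ac)
  qed
  then show ?case by blast
qed

lemma power_le_fact_exp: "0 \<le> y \<Longrightarrow> y ^ N \<le> fact N * exp (y :: real)"
proof -
  assume y: "0 \<le> y"
  have "(\<Sum>k\<in>{N}. y ^ k /\<^sub>R fact k) \<le> exp y"
    unfolding exp_def using y summable_exp_generic[of y] by (intro sum_le_suminf) auto
  then show ?thesis by (simp add: field_simps)
qed

text \<open>
  A complex linear functional \<open>L\<close> in the exponent covers both Gaussians with a shifted centre (\<open>L\<close> real) and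
  Gaussians modulated by a plane wave (\<open>L\<close> imaginary).
\<close>

lemma schwartz_gaussian:
  fixes L :: "real ^ 'n::finite \<Rightarrow> complex"
  assumes e: "e > 0" and L: "bounded_linear L"
  shows "schwartz (\<lambda>x. c * exp (of_real (- e * (norm x)\<^sup>2) + L x))"
proof -
  define E where "E x = exp (of_real (- e * (norm x)\<^sup>2) + L x)" for x
  obtain K where K: "\<And>x. norm (L x) \<le> norm x * K" "K > 0" using bounded_linear.pos_bounded[OF L] by blast
  have dE: "(E has_derivative (\<lambda>h. E x * (of_real (- 2 * e * (x \<bullet> h)) + L h))) (at x)" for x
  proof -
    have "((\<lambda>x. complex_of_real (- e * (x \<bullet> x)) + L x) has_derivative (\<lambda>h. of_real (- 2 * e * (x \<bullet> h)) + L h)) (at x)"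
      by (auto intro!: derivative_eq_intros bounded_linear_imp_has_derivative[OF L] simp: inner_commute algebra_simps)
    from has_derivative_compose[OF this DERIV_exp[THEN has_field_derivative_imp_has_derivative]]
    show ?thesis unfolding E_def[abs_def] power2_norm_eq_inner .
  qed
  have step: "\<exists>Q. polyfun Q \<and> (\<forall>x. (\<lambda>x. P x * E x) differentiable (at x)) \<and>
      (\<lambda>x. frechet_derivative (\<lambda>x. P x * E x) (at x) (axis i 1)) = (\<lambda>x. Q x * E x)" if "polyfun P" for P i
  proof -
    obtain P' where P': "\<And>x. (P has_derivative P' x) (at x)" "\<And>i. polyfun (\<lambda>x. P' x (axis i 1))"
      using polyfun_derivative[OF \<open>polyfun P\<close>] by blast
    have d: "((\<lambda>x. P x * E x) has_derivative (\<lambda>h. P x * (E x * (of_real (- 2 * e * (x \<bullet> h)) + L h)) + P' x h * E x)) (at x)" for x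
      by (rule has_derivative_mult[OF P'(1) dE])
    define Q where "Q x = P x * (of_real (- 2 * e) * of_real (vec_nth x i) + L (axis i 1)) + P' x (axis i 1)" for x
    have "polyfun Q" unfolding Q_def[abs_def] by (intro polyfun.intros that P'(2))
    moreover have "frechet_derivative (\<lambda>x. P x * E x) (at x) (axis i 1) = Q x * E x" for x
      unfolding frechet_derivative_at[OF d, symmetric] by (simp add: Q_def inner_axis algebra_simps)
    ultimately show ?thesis using d differentiableI by blast
  qed
  have form: "\<exists>P. polyfun P \<and> pderivs is (\<lambda>x. c * E x) = (\<lambda>x. P x * E x)" for "is"
  proof (induction "is")
    case Nil
    show ?case by (intro exI[of _ "\<lambda>x. c"]) (simp add: polyfun.const)
  next
    case (Cons i "is")
    then obtain P where "polyfun P" "pderivs is (\<lambda>x. c * E x) = (\<lambda>x. P x * E x)" by blast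
    then show ?case using step[of P i] by auto
  qed
  have bnd: "bounded (range (\<lambda>x. norm x ^ m *\<^sub>R (P x * E x)))" if P: "polyfun P" for P m
  proof -
    obtain C d where C: "\<And>x. norm (P x) \<le> C * (1 + norm x) ^ d" using polyfun_growth[OF P] by blast
    have "0 \<le> C" using C[of 0] order_trans[OF norm_ge_zero] by fastforce
    have "norm (norm x ^ m *\<^sub>R (P x * E x)) \<le> C * (fact (m + d) * exp (1 + (K + 1)\<^sup>2 / (4 * e)))" for x
    proof -
      define r where "r = norm x"
      have r: "r \<ge> 0" by (simp add: r_def)
      have "norm (E x) = exp (- e * r\<^sup>2 + Re (L x))" by (simp add: E_def r_def)
      also have "\<dots> \<le> exp (- e * r\<^sup>2 + K * r)"
        using complex_Re_le_cmod[of "L x"] K(1)[of x] by (simp add: r_def mult.commute)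
      finally have nE: "norm (E x) \<le> exp (- e * r\<^sup>2 + K * r)" .
      have "norm (norm x ^ m *\<^sub>R (P x * E x)) = r ^ m * (norm (P x) * norm (E x))" by (simp add: norm_mult r_def)
      also have "\<dots> \<le> (1 + r) ^ m * ((C * (1 + r) ^ d) * exp (- e * r\<^sup>2 + K * r))"
        using C[of x] nE r \<open>0 \<le> C\<close> by (intro mult_mono power_mono mult_nonneg_nonneg) (auto simp: r_def)
      also have "\<dots> = C * ((1 + r) ^ (m + d) * exp (- e * r\<^sup>2 + K * r))" by (simp add: power_add mult_ac)
      also have "\<dots> \<le> C * ((fact (m + d) * exp (1 + r)) * exp (- e * r\<^sup>2 + K * r))"
        using r \<open>0 \<le> C\<close> by (intro mult_left_mono mult_right_mono power_le_fact_exp) auto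
      also have "\<dots> = C * (fact (m + d) * exp (1 + (K + 1) * r - e * r\<^sup>2))"
        by (simp add: exp_add[symmetric] mult.assoc) (simp add: algebra_simps)
      also have "\<dots> \<le> C * (fact (m + d) * exp (1 + (K + 1)\<^sup>2 / (4 * e)))"
      proof -
        \<comment> \<open>completing the square\<close>
        have "0 \<le> e * (r - (K + 1) / (2 * e))\<^sup>2" using e by simp
        also have "\<dots> = e * r\<^sup>2 - (K + 1) * r + (K + 1)\<^sup>2 / (4 * e)"
          using e by (simp add: power2_eq_square field_simps)
        finally have "(K + 1) * r - e * r\<^sup>2 \<le> (K + 1)\<^sup>2 / (4 * e)" by linarith
        then show ?thesis using \<open>0 \<le> C\<close> by (intro mult_left_mono) auto
      qed
      finally show ?thesis .
    qed
    then show ?thesis unfolding bounded_iff by blast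
  qed
  have "schwartz (\<lambda>x. c * E x)"
    unfolding schwartz_def
  proof (intro allI conjI)
    fix "is" :: "'n list" and x and m :: nat
    obtain P where P: "polyfun P" "pderivs is (\<lambda>x. c * E x) = (\<lambda>x. P x * E x)" using form by blast
    show "pderivs is (\<lambda>x. c * E x) differentiable at x" unfolding P(2) using step[OF P(1)] by blast
    show "bounded (range (\<lambda>x. norm x ^ m *\<^sub>R pderivs is (\<lambda>x. c * E x) x))" unfolding P(2) by (rule bnd[OF P(1)])
  qed
  then show ?thesis by (simp only: E_def)
qed

lemma schwartz_shifted_gaussian:
  fixes y :: "real ^ 'n::finite" assumes "a > 0"
  shows "schwartz (\<lambda>x. of_real (c * exp (- a * (norm (x - y))\<^sup>2)))"
proof -
  have "bounded_linear (\<lambda>x. complex_of_real (2 * a * (x \<bullet> y)))"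
    by (intro bounded_linear_compose[OF bounded_linear_of_real] bounded_linear_mult_right[THEN bounded_linear_compose] bounded_linear_inner_left)
  from schwartz_gaussian[OF assms this, of "of_real (c * exp (- a * (norm y)\<^sup>2))"]
  have "schwartz (\<lambda>x. of_real (c * exp (- a * (norm y)\<^sup>2)) * exp (complex_of_real (- a * (norm x)\<^sup>2) + complex_of_real (2 * a * (x \<bullet> y))))" .
  note sch = this
  have eq: "of_real (c * exp (- a * (norm y)\<^sup>2)) * exp (complex_of_real (- a * (norm x)\<^sup>2) + complex_of_real (2 * a * (x \<bullet> y)))
     = complex_of_real (c * exp (- a * (norm (x - y))\<^sup>2))" for x
  proof -
    have "(norm (x - y))\<^sup>2 = (norm x)\<^sup>2 + (norm y)\<^sup>2 - 2 * (x \<bullet> y)"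
      by (simp add: power2_norm_eq_inner inner_diff inner_commute)
    then have "- a * (norm (x - y))\<^sup>2 = - a * ((norm x)\<^sup>2 + (norm y)\<^sup>2 - 2 * (x \<bullet> y))" by (rule arg_cong)
    then have "- a * (norm (x - y))\<^sup>2 = - a * (norm y)\<^sup>2 + (- a * (norm x)\<^sup>2 + 2 * a * (x \<bullet> y))"
      by (simp only: algebra_simps)
    then show ?thesis by (simp only: exp_add of_real_mult of_real_add exp_of_real[symmetric] mult.assoc)
  qed
  show ?thesis using sch unfolding eq .
qed

text \<open>
  Scaled and modulated such that the Fourier transform is the heat kernel centred at \<open>y\<close> at time \<open>e\<close>.
\<close>

definition test_gaussian :: "real ^ 'n::finite \<Rightarrow> real \<Rightarrow> real ^ 'n \<Rightarrow> complex" where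
  "test_gaussian y e k = of_real (1 / (2 * pi) ^ CARD('n)) * exp (of_real (- e * (norm k)\<^sup>2) + (- \<i> * of_real (k \<bullet> y)))"

lemma schwartz_test_gaussian: "e > 0 \<Longrightarrow> schwartz (test_gaussian y e)"
  unfolding test_gaussian_def[abs_def]
  by (rule schwartz_gaussian)
    (auto intro!: bounded_linear_minus bounded_linear_compose[OF bounded_linear_mult_right]
      bounded_linear_compose[OF bounded_linear_of_real] bounded_linear_inner_left simp: bounded_linear_minus)

lemma fourier_test_gaussian:
  fixes y :: "real ^ 'n::finite" assumes "e > 0"
  shows "fourier (test_gaussian y e) x = of_real (heat_kernel (x - y) e)"
proof -
  have "exp (\<i> * of_real (x \<bullet> k)) * test_gaussian y e k =
     of_real (1 / (2 * pi) ^ CARD('n)) * (exp (\<i> * of_real ((x - y) \<bullet> k)) * of_real (exp (- e * (norm k)\<^sup>2)))" for k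
    by (simp add: test_gaussian_def exp_add[symmetric] exp_of_real[symmetric] inner_diff inner_commute algebra_simps)
  then have "fourier (test_gaussian y e) x =
      of_real (1 / (2 * pi) ^ CARD('n)) * of_real (sqrt (pi / e) ^ CARD('n) * exp (- (norm (x - y))\<^sup>2 / (4 * e)))"
    unfolding fourier_def using gaussian_fourier(2)[OF assms, of "x - y"] by (simp only: integral_mult_right_zero) simp
  also have "\<dots> = of_real ((sqrt (pi / e) / (2 * pi)) ^ CARD('n) * exp (- (norm (x - y))\<^sup>2 / (4 * e)))"
    by (simp add: power_divide)
  also have "sqrt (pi / e) / (2 * pi) = 1 / sqrt (4 * pi * e)"
  proof -
    have "sqrt (pi / e) * sqrt (4 * pi * e) = sqrt ((2 * pi)\<^sup>2)"
      unfolding real_sqrt_mult[symmetric] using assms by (simp add: power2_eq_square)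
    also have "\<dots> = 2 * pi" by (rule real_sqrt_abs[THEN trans]) simp
    finally show ?thesis using assms by (simp add: field_simps)
  qed
  finally show ?thesis by (simp add: heat_kernel_def power_divide)
qed


section \<open>Recovering a function from its Fourier transform\<close>

text \<open>
  Half of the exponential absorbs the power of \<open>1 / s\<close>, and the other half is left. This shows both that the
  heat kernel at a point other than \<open>0\<close> is bounded in time and that it vanishes as time goes to \<open>0\<close>.
\<close>

lemma heat_factor_bound:
  assumes "a > 0" "s > 0"
  shows "exp (- a / s) / sqrt (4 * pi * s) ^ n \<le> (fact n * (2 / a) ^ n * exp (a / 2)) * exp (- a / (2 * s))"
proof -
  define z where "z = 1 / s"
  have z: "z > 0" using assms by (simp add: z_def)
  have "1 / sqrt (4 * pi * s) \<le> 1 + z"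
  proof -
    have "1 / (4 * pi * s) \<le> z" using assms pi_ge_two by (simp add: z_def field_simps)
    also have "\<dots> \<le> (1 + z)\<^sup>2" using z by (simp add: power2_eq_square algebra_simps)
    finally have "sqrt (1 / (4 * pi * s)) \<le> 1 + z" using z by (intro real_le_lsqrt) auto
    then show ?thesis by (simp add: real_sqrt_divide)
  qed
  then have "(1 / sqrt (4 * pi * s)) ^ n \<le> (1 + z) ^ n" using assms by (intro power_mono) auto
  also have "\<dots> = (2 / a) ^ n * (a / 2 * (1 + z)) ^ n"
  proof -
    have "1 + z = 2 / a * (a / 2 * (1 + z))" using assms by simp
    then show ?thesis by (metis power_mult_distrib)
  qed
  also have "\<dots> \<le> (2 / a) ^ n * (fact n * exp (a / 2 * (1 + z)))"
    using assms z by (intro mult_left_mono power_le_fact_exp) auto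
  finally have "(1 / sqrt (4 * pi * s)) ^ n * exp (- a * z) \<le> (2 / a) ^ n * (fact n * exp (a / 2 * (1 + z))) * exp (- a * z)"
    by (intro mult_right_mono) auto
  also have "exp (a / 2 * (1 + z)) = exp (a / 2) * exp (a * z / 2)" by (simp add: exp_add[symmetric] algebra_simps)
  also have "(2 / a) ^ n * (fact n * (exp (a / 2) * exp (a * z / 2))) * exp (- a * z) =
     (fact n * (2 / a) ^ n * exp (a / 2)) * (exp (a * z / 2) * exp (- a * z))" by simp
  also have "exp (a * z / 2) * exp (- a * z) = exp (- a / (2 * s))" by (simp add: exp_add[symmetric] z_def)
  finally show ?thesis by (simp add: z_def power_divide mult.commute)
qed

lemma heat_kernel_bounded:
  fixes x :: "real ^ 'n::finite" assumes "x \<noteq> 0"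
  obtains B where "\<And>s. s > 0 \<Longrightarrow> heat_kernel x s \<le> B"
proof -
  define a where "a = (norm x)\<^sup>2 / 4"
  have a: "a > 0" using assms by (simp add: a_def)
  have "heat_kernel x s \<le> fact CARD('n) * (2 / a) ^ CARD('n) * exp (a / 2)" if "s > 0" for s
  proof -
    have "heat_kernel x s = exp (- a / s) / sqrt (4 * pi * s) ^ CARD('n)" by (simp add: heat_kernel_def a_def)
    also have "\<dots> \<le> (fact CARD('n) * (2 / a) ^ CARD('n) * exp (a / 2)) * exp (- a / (2 * s))"
      by (rule heat_factor_bound[OF a that])
    also have "\<dots> \<le> (fact CARD('n) * (2 / a) ^ CARD('n) * exp (a / 2)) * 1"
      using a that by (intro mult_left_mono) auto
    finally show ?thesis by simp
  qed
  then show ?thesis using that by blast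
qed

lemma heat_kernel_shift_integral:
  fixes y :: "real ^ 'n::finite" assumes "e > 0"
  shows "integrable lborel (\<lambda>x. heat_kernel (x - y) e)" "(LINT x|lborel. heat_kernel (x - y) e) = 1"
proof -
  have [measurable]: "(\<lambda>x :: real ^ 'n. heat_kernel x e) \<in> borel_measurable borel"
    by (intro borel_measurable_continuous_onI heat_kernel_continuous)
  have d: "lborel = distr lborel borel (\<lambda>x. - y + x)" by (rule lborel_distr_plus[symmetric])
  have "integrable (distr lborel borel (\<lambda>x. - y + x)) (\<lambda>x. heat_kernel x e)"
    using heat_kernel_fourier(1)[OF assms, where 'n='n] unfolding d[symmetric] .
  then show "integrable lborel (\<lambda>x. heat_kernel (x - y) e)" by (subst (asm) integrable_distr_eq) auto
  have "(LINT x|distr lborel borel (\<lambda>x. - y + x). heat_kernel x e) = 1"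
    using heat_kernel_integral[OF assms, where 'n='n] unfolding d[symmetric] .
  then show "(LINT x|lborel. heat_kernel (x - y) e) = 1" by (subst (asm) integral_distr) auto
qed

lemma heat_kernel_shift_eq:
  "heat_kernel (x - y) e = 1 / sqrt (4 * pi * e) ^ CARD('n) * exp (- (1 / (4 * e)) * (norm (x - y :: real ^ 'n::finite))\<^sup>2)"
  by (simp add: heat_kernel_def)

text \<open>
  A tempered function need not be integrable or bounded, so the part of the integral away from \<open>y\<close> is
  compared with the fixed Gaussian \<open>exp (- |x - y|\<^sup>2)\<close>, against which every tempered function is integrable.
  For \<open>e < 1/8\<close> half of the exponent of the heat kernel yields that Gaussian and the other half the small
  factor \<open>A e\<close>.
\<close>

lemma heat_kernel_approximate_identity:
  fixes f :: "real ^ 'n::finite \<Rightarrow> complex"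
  assumes temp: "tempered f" and cont: "isCont f y"
  shows "((\<lambda>e. LINT x|lborel. f x * of_real (heat_kernel (x - y) e)) \<longlongrightarrow> f y) (at_right 0)"
proof (rule tendstoI)
  fix \<eta> :: real assume \<eta>: "\<eta> > 0"
  have "(f \<longlongrightarrow> f y) (at y)" using cont by (simp add: isCont_def)
  then have "\<forall>\<^sub>F x in at y. dist (f x) (f y) < \<eta> / 2" using \<eta> by (intro tendstoD) auto
  then obtain \<delta> where \<delta>: "\<delta> > 0" "\<And>x. x \<noteq> y \<Longrightarrow> dist x y < \<delta> \<Longrightarrow> dist (f x) (f y) < \<eta> / 2"
    unfolding eventually_at by auto
  have near: "norm (f x - f y) \<le> \<eta> / 2" if "norm (x - y) < \<delta>" for x
    using \<delta>(2)[of x] that \<eta> by (cases "x = y") (auto simp: dist_norm)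
  define M where "M = (LINT x|lborel. norm ((f x - f y) * of_real (exp (- (norm (x - y))\<^sup>2))))"
  define A where "A e = exp (- (\<delta>\<^sup>2 / 8) / e) / sqrt (4 * pi * e) ^ CARD('n)" for e
  have int_sch: "integrable lborel (\<lambda>x. (f x - f y) * \<phi> x)" if "schwartz \<phi>" for \<phi>
  proof -
    have "integrable lborel (\<lambda>x. f x * \<phi> x)" using temp that unfolding tempered_def by blast
    moreover have "integrable lborel (\<lambda>x. f y * \<phi> x)" using schwartz_integrable[OF that] by simp
    ultimately show ?thesis unfolding left_diff_distrib by (rule Bochner_Integration.integrable_diff)
  qed
  have g1: "integrable lborel (\<lambda>x. (f x - f y) * of_real (exp (- (norm (x - y))\<^sup>2)))"
    using int_sch[OF schwartz_shifted_gaussian[of 1 1 y]] by simp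
  have sh: "schwartz (\<lambda>x. complex_of_real (heat_kernel (x - y) e))" if "e > 0" for e
    unfolding heat_kernel_shift_eq using that by (intro schwartz_shifted_gaussian) simp
  have est: "dist (LINT x|lborel. f x * of_real (heat_kernel (x - y) e)) (f y) \<le> \<eta> / 2 + A e * M"
    if e: "0 < e" "e < 1 / 8" for e
  proof -
    let ?h = "\<lambda>x. heat_kernel (x - y) e"
    note h = heat_kernel_shift_integral[OF e(1), of y]
    have i: "integrable lborel (\<lambda>x. (f x - f y) * of_real (?h x))" by (rule int_sch[OF sh[OF e(1)]])
    have i0: "integrable lborel (\<lambda>x. f x * of_real (?h x))" using temp sh[OF e(1)] unfolding tempered_def by blast
    have "(LINT x|lborel. (f x - f y) * of_real (?h x)) =
       (LINT x|lborel. f x * of_real (?h x)) - (LINT x|lborel. f y * of_real (?h x))"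
      unfolding left_diff_distrib using i0 h(1) by (intro Bochner_Integration.integral_diff) auto
    also have "(LINT x|lborel. f y * of_real (?h x)) = f y" using h(2) by simp
    finally have "dist (LINT x|lborel. f x * of_real (?h x)) (f y) = norm (LINT x|lborel. (f x - f y) * of_real (?h x))"
      by (simp add: dist_norm)
    also have "\<dots> \<le> (LINT x|lborel. norm ((f x - f y) * of_real (?h x)))" by (rule integral_norm_bound)
    also have "\<dots> \<le> (LINT x|lborel. \<eta> / 2 * ?h x + A e * norm ((f x - f y) * of_real (exp (- (norm (x - y))\<^sup>2))))"
    proof (rule integral_mono)
      show "integrable lborel (\<lambda>x. norm ((f x - f y) * of_real (?h x)))" using i by (rule integrable_norm)
      show "integrable lborel (\<lambda>x. \<eta> / 2 * ?h x + A e * norm ((f x - f y) * of_real (exp (- (norm (x - y))\<^sup>2))))"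
        using h(1) integrable_norm[OF g1] by (intro Bochner_Integration.integrable_add integrable_mult_right)
      fix x
      have h0: "0 \<le> ?h x" using e by (intro heat_kernel_nonneg)
      have A0: "0 \<le> A e" using e by (simp add: A_def)
      have n1: "norm ((f x - f y) * of_real (?h x)) = norm (f x - f y) * ?h x" using h0 by (simp add: norm_mult)
      have e': "norm ((f x - f y) * of_real (exp (- (norm (x - y))\<^sup>2))) = norm (f x - f y) * exp (- (norm (x - y))\<^sup>2)"
        by (simp add: norm_mult del: of_real_exp)
      show "norm ((f x - f y) * of_real (?h x)) \<le>
         \<eta> / 2 * ?h x + A e * norm ((f x - f y) * of_real (exp (- (norm (x - y))\<^sup>2)))"
      proof (cases "norm (x - y) < \<delta>")
        case True
        have "norm (f x - f y) * ?h x \<le> \<eta> / 2 * ?h x" using near[OF True] h0 by (rule mult_right_mono)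
        moreover have "0 \<le> A e * (norm (f x - f y) * exp (- (norm (x - y))\<^sup>2))" using A0 by simp
        ultimately show ?thesis unfolding n1 e' by linarith
      next
        case False
        define r where "r = (norm (x - y))\<^sup>2"
        have r: "\<delta>\<^sup>2 \<le> r" using False \<delta>(1) by (simp add: r_def power_mono)
        have "r / (4 * e) = r / (8 * e) + r / (8 * e)" using e by (simp add: field_simps)
        moreover have "\<delta>\<^sup>2 / (8 * e) \<le> r / (8 * e)" using r e by (intro divide_right_mono) auto
        moreover have "r * 1 \<le> r * (1 / (8 * e))" using e by (intro mult_left_mono) (auto simp: r_def)
        ultimately have "\<delta>\<^sup>2 / (8 * e) + r \<le> r / (4 * e)" by simp
        then have "exp (- (1 / (4 * e)) * r) \<le> exp (- (\<delta>\<^sup>2 / 8) / e + - r)" by simp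
        then have "?h x \<le> 1 / sqrt (4 * pi * e) ^ CARD('n) * (exp (- (\<delta>\<^sup>2 / 8) / e) * exp (- r))"
          unfolding heat_kernel_shift_eq r_def exp_add using e by (intro mult_left_mono) auto
        then have "?h x \<le> A e * exp (- r)" by (simp add: A_def)
        then have "norm (f x - f y) * ?h x \<le> norm (f x - f y) * (A e * exp (- r))" by (intro mult_left_mono) auto
        moreover have "0 \<le> \<eta> / 2 * ?h x" using h0 \<eta> by simp
        moreover have "A e * (norm (f x - f y) * exp (- r)) = norm (f x - f y) * (A e * exp (- r))" by simp
        ultimately show ?thesis unfolding n1 e'[folded r_def] r_def[symmetric] by linarith
      qed
    qed
    also have "\<dots> = \<eta> / 2 * (LINT x|lborel. ?h x) + A e * M"
      unfolding M_def using h(1) integrable_norm[OF g1]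
      by (subst Bochner_Integration.integral_add) (auto simp del: of_real_exp)
    finally show ?thesis using h(2) by simp
  qed
  have "(A \<longlongrightarrow> 0) (at_right 0)"
  proof (rule tendsto_sandwich[OF _ _ tendsto_const])
    define a where "a = \<delta>\<^sup>2 / 8"
    define C where "C = fact CARD('n) * (2 / a) ^ CARD('n) * exp (a / 2)"
    have a: "a > 0" using \<delta> by (simp add: a_def)
    have "((\<lambda>e. exp (- a / (2 * e))) \<longlongrightarrow> 0) (at_right (0 :: real))" using a by real_asymp
    then show "((\<lambda>e. C * exp (- a / (2 * e))) \<longlongrightarrow> 0) (at_right (0 :: real))" by (rule tendsto_mult_right_zero)
    show "\<forall>\<^sub>F e in at_right 0. A e \<le> C * exp (- a / (2 * e))"
      using eventually_at_right_less[of 0]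
    proof eventually_elim
      case (elim e)
      show ?case using heat_factor_bound[OF a elim, of "CARD('n)"] by (simp add: A_def C_def a_def)
    qed
    show "\<forall>\<^sub>F e in at_right 0. 0 \<le> A e"
      using eventually_at_right_less[of "0::real"] by eventually_elim (simp add: A_def)
  qed
  then have "((\<lambda>e. \<eta> / 2 + A e * M) \<longlongrightarrow> \<eta> / 2 + 0 * M) (at_right 0)" by (intro tendsto_intros)
  from order_tendstoD(2)[OF this, of \<eta>] \<eta>
  have "\<forall>\<^sub>F e in at_right 0. \<eta> / 2 + A e * M < \<eta>" by simp
  moreover have "\<forall>\<^sub>F e in at_right 0. 0 < e \<and> e < (1 / 8 :: real)"
    by (auto simp: eventually_at_right[of 0 1] intro!: exI[of _ "1 / 8"])
  ultimately show "\<forall>\<^sub>F e in at_right 0. dist (LINT x|lborel. f x * of_real (heat_kernel (x - y) e)) (f y) < \<eta>"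
    by eventually_elim (use est in force)
qed

lemma mittag_leffler_of_real:
  assumes "0 < \<beta>" shows "mittag_leffler \<beta> (complex_of_real x) = of_real (mittag_leffler \<beta> x)"
  unfolding mittag_leffler_def
  using suminf_of_real[OF summable_power_over_Gamma[OF assms, of x], where 'a=complex] by simp

lemma heat_kernel_measurable [measurable]:
  assumes [measurable]: "f \<in> borel_measurable M" "g \<in> borel_measurable M"
  shows "(\<lambda>w. heat_kernel (f w :: real ^ 'n::finite) (g w)) \<in> borel_measurable M"
  unfolding heat_kernel_def by measurable

lemma test_gaussian_measurable [measurable]:
  "test_gaussian y e \<in> borel_measurable borel"
  unfolding test_gaussian_def[abs_def] by measurable

text \<open>
  The factor \<open>exp (- s |k|\<^sup>2)\<close> changes the test function of width \<open>e\<close> into the one of width \<open>s + e\<close>. Its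
  integral is its Fourier transform at \<open>0\<close>, a value of the heat kernel.
\<close>

lemma gaussian_mixture_pairing:
  fixes y :: "real ^ 'n::finite" and \<mu> :: "real measure"
  assumes "finite_measure \<mu>" and [measurable_cong]: "sets \<mu> = sets borel" and pos: "AE s in \<mu>. s > 0" and "e > 0"
  shows "(LINT k|lborel. of_real (LINT s|\<mu>. exp (- s * (norm k)\<^sup>2)) * test_gaussian y e k) =
      of_real (LINT s|\<mu>. heat_kernel y (s + e))"
proof -
  interpret finite_measure \<mu> by fact
  interpret P: pair_sigma_finite \<mu> "lborel :: (real ^ 'n) measure" by unfold_locales
  \<comment> \<open>\<open>max s 0\<close> keeps the integrand dominated by the test function for all \<open>s\<close>; almost surely \<open>s > 0\<close>\<close>
  define F where "F s k = of_real (exp (- max s 0 * (norm k)\<^sup>2)) * test_gaussian y e k" for s and k :: "real ^ 'n"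
  have tg: "integrable lborel (test_gaussian y e)" by (rule schwartz_integrable[OF schwartz_test_gaussian[OF \<open>e > 0\<close>]])
  have F_le: "norm (F s k) \<le> norm (test_gaussian y e k)" for s k
    unfolding F_def norm_mult by (rule mult_left_le_one_le) (auto simp del: of_real_exp)
  have mF: "case_prod F \<in> borel_measurable (\<mu> \<Otimes>\<^sub>M lborel)" unfolding F_def by measurable
  have "integrable (\<mu> \<Otimes>\<^sub>M lborel) (\<lambda>(s, k). test_gaussian y e k)"
    by (rule P.Fubini_integrable) (use tg in auto)
  then have int: "integrable (\<mu> \<Otimes>\<^sub>M lborel) (case_prod F)"
    by (rule Bochner_Integration.integrable_bound[OF _ mF]) (use F_le in auto)
  have "(LINT k|lborel. of_real (LINT s|\<mu>. exp (- s * (norm k)\<^sup>2)) * test_gaussian y e k) =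
     (LINT k|lborel. LINT s|\<mu>. F s k)"
  proof (rule Bochner_Integration.integral_cong[OF refl])
    fix k :: "real ^ 'n"
    have "(LINT s|\<mu>. exp (- s * (norm k)\<^sup>2)) = (LINT s|\<mu>. exp (- max s 0 * (norm k)\<^sup>2))"
    proof (rule integral_cong_AE)
      show "AE s in \<mu>. exp (- s * (norm k)\<^sup>2) = exp (- max s 0 * (norm k)\<^sup>2)"
        using pos by eventually_elim (simp add: max_def)
    qed measurable
    then show "of_real (LINT s|\<mu>. exp (- s * (norm k)\<^sup>2)) * test_gaussian y e k = (LINT s|\<mu>. F s k)"
      unfolding F_def by (simp add: integral_complex_of_real del: of_real_exp)
  qed
  also have "\<dots> = (LINT s|\<mu>. LINT k|lborel. F s k)" by (rule P.Fubini_integral[OF int])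
  also have "\<dots> = (LINT s|\<mu>. complex_of_real (heat_kernel y (s + e)))"
  proof (rule integral_cong_AE)
    show "AE s in \<mu>. (LINT k|lborel. F s k) = complex_of_real (heat_kernel y (s + e))"
      using pos
    proof eventually_elim
      case (elim s)
      have "F s k = exp (\<i> * of_real (0 \<bullet> k)) * test_gaussian y (s + e) k" for k
        using elim by (simp add: F_def test_gaussian_def exp_of_real[symmetric] exp_add[symmetric] algebra_simps)
      then have "(LINT k|lborel. F s k) = fourier (test_gaussian y (s + e)) 0"
        unfolding fourier_def by simp
      also have "\<dots> = of_real (heat_kernel (0 - y) (s + e))"
        using elim \<open>e > 0\<close> by (intro fourier_test_gaussian) simp
      finally show ?case by (simp add: heat_kernel_def)
    qed
    show "(\<lambda>s. LINT k|lborel. F s k) \<in> borel_measurable \<mu>" using mF by measurable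
  qed measurable
  finally show ?thesis by (simp add: integral_complex_of_real)
qed

lemma heat_mixture_limit:
  fixes y :: "real ^ 'n::finite" and \<mu> :: "real measure"
  assumes "finite_measure \<mu>" and [measurable_cong]: "sets \<mu> = sets borel" and pos: "AE s in \<mu>. s > 0" and "y \<noteq> 0"
  shows "integrable \<mu> (heat_kernel y)"
    and "(\<lambda>k. LINT s|\<mu>. heat_kernel y (s + 1 / real (Suc k))) \<longlonglongrightarrow> (LINT s|\<mu>. heat_kernel y s)"
proof -
  interpret finite_measure \<mu> by fact
  obtain B where B: "\<And>s. s > 0 \<Longrightarrow> heat_kernel y s \<le> B" using heat_kernel_bounded[OF \<open>y \<noteq> 0\<close>] by blast
  show "integrable \<mu> (heat_kernel y)"
  proof (rule integrable_const_bound[of _ B])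
    show "AE s in \<mu>. norm (heat_kernel y s) \<le> B" using pos by eventually_elim (use B in \<open>simp add: heat_kernel_nonneg\<close>)
  qed measurable
  show "(\<lambda>k. LINT s|\<mu>. heat_kernel y (s + 1 / real (Suc k))) \<longlonglongrightarrow> (LINT s|\<mu>. heat_kernel y s)"
  proof (rule integral_dominated_convergence[where w="\<lambda>_. B"])
    show "AE s in \<mu>. (\<lambda>k. heat_kernel y (s + 1 / real (Suc k))) \<longlonglongrightarrow> heat_kernel y s"
      using pos
    proof eventually_elim
      case (elim s)
      have "(\<lambda>k. s + 1 / real (Suc k)) \<longlonglongrightarrow> s + 0" by (intro tendsto_intros LIMSEQ_Suc[OF lim_1_over_n])
      then have l: "(\<lambda>k. s + 1 / real (Suc k)) \<longlonglongrightarrow> s" by simp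
      show ?case unfolding heat_kernel_def using elim by (intro tendsto_intros l) auto
    qed
    show "AE s in \<mu>. norm (heat_kernel y (s + 1 / real (Suc k))) \<le> B" for k
      using pos
    proof eventually_elim
      case (elim s)
      then have "s + 1 / real (Suc k) > 0" by (intro add_pos_nonneg) auto
      then show ?case
        using B[of "s + 1 / real (Suc k)"] heat_kernel_nonneg[of "s + 1 / real (Suc k)" y] by (simp del: of_nat_Suc)
    qed
  qed auto
qed

text \<open>
  Testing the distributional identity with the Gaussian of width \<open>e\<close> at \<open>y\<close>
  equates \<open>\<integral> f x h(x - y, e) dx\<close> with \<open>\<integral> h(y, s + e) d\<mu> s\<close>, where \<open>h\<close> is the heat kernel. As \<open>e \<longrightarrow> 0\<close>, the
  left side tends to \<open>f y\<close> and the right side to \<open>\<integral> h(y, s) d\<mu> s\<close>.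
\<close>

lemma eq_heat_mixture_of_Fourier:
  fixes f :: "real ^ 'n::finite \<Rightarrow> real" and \<mu> :: "real measure"
  assumes \<mu>: "finite_measure \<mu>" "sets \<mu> = sets borel" "AE s in \<mu>. s > 0"
    and F: "has_tempered_fourier (\<lambda>x. complex_of_real (f x)) (\<lambda>k. of_real (LINT s|\<mu>. exp (- s * (norm k)\<^sup>2)))"
    and cont: "continuous_on (- {0}) f" and "y \<noteq> 0"
  shows "f y = (LINT s|\<mu>. heat_kernel y s)"
proof -
  have "isCont f y" using cont \<open>y \<noteq> 0\<close> by (simp add: continuous_on_eq_continuous_at open_Compl)
  then have c: "isCont (\<lambda>x. complex_of_real (f x)) y" by (intro continuous_intros)
  have temp: "tempered (\<lambda>x. complex_of_real (f x))" using F by (simp add: has_tempered_fourier_def)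
  have eq: "(LINT x|lborel. complex_of_real (f x) * of_real (heat_kernel (x - y) e)) = of_real (LINT s|\<mu>. heat_kernel y (s + e))"
    if "e > 0" for e
  proof -
    have "(LINT x|lborel. complex_of_real (f x) * fourier (test_gaussian y e) x) =
       (LINT k|lborel. of_real (LINT s|\<mu>. exp (- s * (norm k)\<^sup>2)) * test_gaussian y e k)"
      using F schwartz_test_gaussian[OF that, of y] unfolding has_tempered_fourier_def by blast
    then show ?thesis unfolding fourier_test_gaussian[OF that] gaussian_mixture_pairing[OF \<mu> that] .
  qed
  have "filterlim (\<lambda>k. 1 / real (Suc k)) (at_right 0) sequentially" by real_asymp
  from filterlim_compose[OF heat_kernel_approximate_identity[OF temp c] this]
  have "(\<lambda>k. complex_of_real (LINT s|\<mu>. heat_kernel y (s + 1 / real (Suc k)))) \<longlonglongrightarrow> of_real (f y)"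
    by (simp add: eq del: of_nat_Suc)
  then have "(\<lambda>k. LINT s|\<mu>. heat_kernel y (s + 1 / real (Suc k))) \<longlonglongrightarrow> f y"
    by (simp only: tendsto_of_real_iff)
  with heat_mixture_limit(2)[OF \<mu> \<open>y \<noteq> 0\<close>] show ?thesis by (rule LIMSEQ_unique[rotated])
qed



section \<open>The subordination formula\<close>

text \<open>
  The density of the rescaled variable: in the theorem \<open>c = t\<^bsup>-2\<beta>/\<alpha>\<^esup>\<close> and \<open>q = |k|\<^sup>2\<close>, so that
  \<open>(q / c)\<^bsup>\<alpha>/2\<^esup> = |k|\<^sup>\<alpha> t\<^sup>\<beta>\<close>.
\<close>

lemma Phi_scaled_Laplace:
  assumes "0 < \<beta>" "\<beta> \<le> 1" "0 < \<alpha>" "\<alpha> \<le> 2" "2 * \<beta> + \<alpha> < 4" "c > 0" "q \<ge> 0"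
  shows "(\<integral>\<^sup>+s. ennreal (c * Phi \<alpha> \<beta> (c * s)) * ennreal (exp (- s * q)) \<partial>half_line) =
      ennreal (mittag_leffler \<beta> (- ((q / c) powr (\<alpha> / 2))))"
proof -
  note \<Phi> = Phi_nonneg[of \<beta> "\<alpha> / 2"] and L = Phi_Laplace(1)[of \<beta> "\<alpha> / 2" "q / c"]
  have "(\<integral>\<^sup>+s. ennreal (c * Phi \<alpha> \<beta> (c * s)) * ennreal (exp (- s * q)) \<partial>half_line) =
     (\<integral>\<^sup>+s. ennreal c * ennreal (exp (- (q / c) * (c * s)) * Phi \<alpha> \<beta> (c * s)) \<partial>half_line)"
  proof (rule nn_integral_half_line_cong)
    fix s :: real assume "s > 0"
    then have "0 \<le> Phi \<alpha> \<beta> (c * s)" using assms \<Phi>[of "c * s"] by simp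
    then show "ennreal (c * Phi \<alpha> \<beta> (c * s)) * ennreal (exp (- s * q)) =
        ennreal c * ennreal (exp (- (q / c) * (c * s)) * Phi \<alpha> \<beta> (c * s))"
      using assms by (simp add: ennreal_mult[symmetric] mult_ac)
  qed
  also have "\<dots> = ennreal c * (\<integral>\<^sup>+s. ennreal (exp (- (q / c) * (c * s)) * Phi \<alpha> \<beta> (c * s)) \<partial>half_line)"
    by (rule nn_integral_cmult) measurable
  also have "\<dots> = (\<integral>\<^sup>+s. ennreal (exp (- (q / c) * s) * Phi \<alpha> \<beta> s) \<partial>half_line)"
    using assms by (intro nn_integral_half_line_scale[symmetric]) auto
  finally show ?thesis using L assms by simp
qed

theorem theorem4p1:
  fixes \<alpha> \<beta> :: real
  assumes "0 < \<beta>" and "\<beta> \<le> 1" and "0 < \<alpha>" and "\<alpha> \<le> 2" and "2 * \<beta> + \<alpha> < 4"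
  shows "(\<forall>\<tau>>0. Phi \<alpha> \<beta> \<tau> \<ge> 0) \<and>
    set_integrable lborel {0<..} (Phi \<alpha> \<beta>) \<and>
    (LBINT \<tau>:{0<..}. Phi \<alpha> \<beta> \<tau>) = 1 \<and>
    first_fundamental_solution 2 1 (heat_kernel :: real ^ 'n::finite \<Rightarrow> real \<Rightarrow> real) \<and>
    (\<forall>G :: real ^ 'n \<Rightarrow> real \<Rightarrow> real. first_fundamental_solution \<alpha> \<beta> G \<longrightarrow>
      (\<forall>x t. x \<noteq> 0 \<and> t > 0 \<longrightarrow>
        set_integrable lborel {0<..}
          (\<lambda>s. t powr (- (2 * \<beta> / \<alpha>)) * Phi \<alpha> \<beta> (s * t powr (- (2 * \<beta> / \<alpha>))) * heat_kernel x s) \<and>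
        G x t = (LBINT s:{0<..}.
          t powr (- (2 * \<beta> / \<alpha>)) * Phi \<alpha> \<beta> (s * t powr (- (2 * \<beta> / \<alpha>))) * heat_kernel x s)))"
proof (intro conjI allI impI)
  have nonneg: "0 \<le> Phi \<alpha> \<beta> \<tau>" if "\<tau> > 0" for \<tau>
    using Phi_nonneg[of \<beta> "\<alpha> / 2" \<tau>] assms that by simp
  then show "0 \<le> Phi \<alpha> \<beta> \<tau>" if "\<tau> > 0" for \<tau> using that .
  have ml0: "mittag_leffler \<beta> (0 :: real) = 1"
    unfolding mittag_leffler_def using sums_unique[OF powser_sums_zero[of "\<lambda>k. 1 / Gamma (1 + \<beta> * real k)"]] by simp
  have "(\<integral>\<^sup>+\<tau>. ennreal (Phi \<alpha> \<beta> \<tau>) \<partial>half_line) = ennreal 1"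
    using Phi_Laplace(1)[of \<beta> "\<alpha> / 2" 0] assms ml0 by simp
  then have hb: "has_bochner_integral half_line (Phi \<alpha> \<beta>) 1"
    using nonneg by (intro has_bochner_integral_nn_integral AE_half_lineI) auto
  then show "set_integrable lborel {0<..} (Phi \<alpha> \<beta>)" and "(LBINT \<tau>:{0<..}. Phi \<alpha> \<beta> \<tau>) = 1"
    using integrable_half_line[of "Phi \<alpha> \<beta>"] integral_half_line[of "Phi \<alpha> \<beta>"] by (auto simp: has_bochner_integral_iff)
  show "first_fundamental_solution 2 1 (heat_kernel :: real ^ 'n \<Rightarrow> real \<Rightarrow> real)"
    by (rule heat_kernel_fundamental_solution)
  fix G :: "real ^ 'n \<Rightarrow> real \<Rightarrow> real" and x :: "real ^ 'n" and t :: real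
  assume G: "first_fundamental_solution \<alpha> \<beta> G" and xt: "x \<noteq> 0 \<and> t > 0"
  then have x: "x \<noteq> 0" and t: "t > 0" by auto
  define c where "c = t powr (- (2 * \<beta> / \<alpha>))"
  have c: "c > 0" using t by (simp add: c_def)
  define w where "w s = c * Phi \<alpha> \<beta> (s * c)" for s
  have [measurable]: "w \<in> borel_measurable borel" unfolding w_def[abs_def] by measurable
  have w_nonneg: "AE s in half_line. 0 \<le> w s"
    using nonneg c by (intro AE_half_lineI) (simp add: w_def)
  \<comment> \<open>the law of the random time at which the Brownian motion is evaluated\<close>
  define \<mu> where "\<mu> = density half_line (\<lambda>s. ennreal (w s))"
  have sets_\<mu>: "sets \<mu> = sets borel" by (simp add: \<mu>_def)
  note [measurable_cong] = sets_\<mu>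
  have pos: "AE s in \<mu>. s > 0"
    unfolding \<mu>_def by (subst AE_density) (auto intro: AE_half_lineI)
  have Lap: "(\<integral>\<^sup>+s. ennreal (exp (- s * q)) \<partial>\<mu>) = ennreal (mittag_leffler \<beta> (- ((q / c) powr (\<alpha> / 2))))" if "q \<ge> 0" for q
    using Phi_scaled_Laplace[OF assms c that] unfolding \<mu>_def
    by (subst nn_integral_density) (auto simp: w_def mult.commute)
  have fin: "finite_measure \<mu>"
  proof (rule finite_measureI)
    have "(\<integral>\<^sup>+s. 1 \<partial>\<mu>) = 1" using Lap[of 0] ml0 by simp
    then show "emeasure \<mu> (space \<mu>) \<noteq> \<infinity>" by simp
  qed
  have E: "mittag_leffler \<beta> (- complex_of_real (norm \<kappa> powr \<alpha> * t powr \<beta>)) = of_real (LINT s|\<mu>. exp (- s * (norm \<kappa>)\<^sup>2))"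
    for \<kappa> :: "real ^ 'n"
  proof -
    have "((norm \<kappa>)\<^sup>2 / c) powr (\<alpha> / 2) = norm \<kappa> powr \<alpha> * t powr \<beta>"
    proof -
      have "(norm \<kappa>)\<^sup>2 / c = (norm \<kappa>)\<^sup>2 * t powr (2 * \<beta> / \<alpha>)" using t by (simp add: c_def powr_minus field_simps)
      moreover have "((norm \<kappa>)\<^sup>2) powr (\<alpha> / 2) = norm \<kappa> powr \<alpha>"
        using powr_powr[of "norm \<kappa>" 2 "\<alpha> / 2"] by (simp add: powr_numeral)
      ultimately show ?thesis using assms t by (simp add: powr_mult powr_powr)
    qed
    moreover have "0 \<le> mittag_leffler \<beta> (- (((norm \<kappa>)\<^sup>2 / c) powr (\<alpha> / 2)))"
      using Phi_Laplace(2)[of \<beta> "\<alpha> / 2" "(norm \<kappa>)\<^sup>2 / c"] assms c by simp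
    ultimately have "has_bochner_integral \<mu> (\<lambda>s. exp (- s * (norm \<kappa>)\<^sup>2)) (mittag_leffler \<beta> (- (norm \<kappa> powr \<alpha> * t powr \<beta>)))"
      using Lap[of "(norm \<kappa>)\<^sup>2"] by (intro has_bochner_integral_nn_integral) auto
    then have "(LINT s|\<mu>. exp (- s * (norm \<kappa>)\<^sup>2)) = mittag_leffler \<beta> (- (norm \<kappa> powr \<alpha> * t powr \<beta>))"
      by (rule has_bochner_integral_integral_eq)
    then show ?thesis using mittag_leffler_of_real[OF assms(1), of "- (norm \<kappa> powr \<alpha> * t powr \<beta>)"] by simp
  qed
  have "continuous_on (- {0}) (\<lambda>x. G x t)"
    and "has_tempered_fourier (\<lambda>x. complex_of_real (G x t))
      (\<lambda>\<kappa>. mittag_leffler \<beta> (- complex_of_real (norm \<kappa> powr \<alpha> * t powr \<beta>)))"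
    using G t unfolding first_fundamental_solution_def by blast+
  from eq_heat_mixture_of_Fourier[OF fin sets_\<mu> pos this(2)[unfolded E] this(1) x]
  have val: "G x t = (LINT s|\<mu>. heat_kernel x s)" .
  have int: "integrable \<mu> (heat_kernel x)" by (rule heat_mixture_limit(1)[OF fin sets_\<mu> pos x])
  have wh: "w s * heat_kernel x s = t powr (- (2 * \<beta> / \<alpha>)) * Phi \<alpha> \<beta> (s * t powr (- (2 * \<beta> / \<alpha>))) * heat_kernel x s" for s
    by (simp add: w_def c_def)
  have "integrable half_line (\<lambda>s. w s * heat_kernel x s)"
    using int w_nonneg unfolding \<mu>_def by (subst (asm) integrable_density) auto
  then show "set_integrable lborel {0<..}
      (\<lambda>s. t powr (- (2 * \<beta> / \<alpha>)) * Phi \<alpha> \<beta> (s * t powr (- (2 * \<beta> / \<alpha>))) * heat_kernel x s)"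
    unfolding wh[symmetric] by (subst (asm) integrable_half_line) auto
  have "(LINT s|\<mu>. heat_kernel x s) = (LINT s|half_line. w s * heat_kernel x s)"
    using w_nonneg unfolding \<mu>_def by (subst integral_density) auto
  also have "\<dots> = (LBINT s:{0<..}. w s * heat_kernel x s)" by (rule integral_half_line) measurable
  finally show "G x t = (LBINT s:{0<..}.
      t powr (- (2 * \<beta> / \<alpha>)) * Phi \<alpha> \<beta> (s * t powr (- (2 * \<beta> / \<alpha>))) * heat_kernel x s)"
    unfolding val wh .
qed

end
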